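(* Consider the generalized join the shortest orbit queue system with parameters $\lambda_0,\lambda_1,\lambda_2,\mu,\alpha_1,\alpha_2>0$, $\lambda=\lambda_0+\lambda_1+\lambda_2$, normalized so that $\lambda+\mu+\alpha_1+\alpha_2=1$, and let $\{(N_{1,n},N_{2,n},C_n);n\ge 0\}$ be its uniformized discrete-time Markov chain (described in the context), assumed positive recurrent. Put $\widehat{\lambda}=\lambda(\lambda+\alpha_1+\alpha_2)$, $\widehat{\lambda}_k=\lambda_k(\lambda+\alpha_1+\alpha_2)$ for $k=0,1,2$, $\widehat{\mu}_k=\mu\alpha_k$ for $k=1,2$, $\rho_k=\widehat{\lambda}_k/\widehat{\mu}_k$ for $k=1,2$, $\rho=\widehat{\lambda}/(\widehat{\mu}_1+\widehat{\mu}_2)$, $\gamma_1=\widehat{\mu}_1\rho^2+\widehat{\lambda}_2$, $\gamma_2=\widehat{\mu}_2\rho^2+\widehat{\lambda}_1$. For $m\ge 0$ and $l\in\mathbb{Z}$ let $$\pi_{m,l}(1)=\lim_{n\to\infty}\mathbb{P}\big(\min\{N_{1,n},N_{2,n}\}=m,\;N_{2,n}-N_{1,n}=l,\;C_n=1\big).$$ Suppose that $\max\{\rho_1,\rho_2\}<\rho<1$ and $\widehat{\lambda}_0>|\widehat{\lambda}_2-\widehat{\lambda}_1+\rho^2(\widehat{\mu}_1-\widehat{\mu}_2)|$. Then $(\pi_{m,l}(1))_{l\in\mathbb{Z}}$ decays geometrically as $m\to\infty$ with decay rate $\rho^2$; that is, there is a constant $x_0>0$ such that for every $l\in\mathbb{Z}$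 $$\lim_{m\to\infty}\rho^{-2m}\pi_{m,l}(1)=x_l(\rho^{-2}),$$ where $$x_l(\rho^{-2})=\begin{cases}\dfrac{\gamma_2+\widehat{\lambda}_0/2}{\gamma_2}\,x_0\left(\rho\,\dfrac{\gamma_2}{\gamma_1+\widehat{\lambda}_0}\right)^{|l|}, & l\le -1,\\[2mm] x_0, & l=0,\\[1mm] \dfrac{\gamma_1+\widehat{\lambda}_0/2}{\gamma_1}\,x_0\left(\rho\,\dfrac{\gamma_1}{\gamma_2+\widehat{\lambda}_0}\right)^{l}, & l\ge 1.\end{cases}$$ Moreover, the two orbit queues are strongly balanced if and only if $\gamma_2<\rho(\gamma_1+\widehat{\lambda}_0)$ and $\gamma_1<\rho(\gamma_2+\widehat{\lambda}_0)$.
   Context: The system: a single server that holds at most one job, with exponential($\mu$) service times, is fed by three independent Poisson streams: a smart stream (rate $\lambda_0$) and two dedicated streams (rates $\lambda_1,\lambda_2$). A job finding the server idle starts service at once. If the server is busy, a job of dedicated stream $k\in\{1,2\}$ joins orbit queue $k$, and a smart job joins the shorter orbit queue (each with probability $1/2$ in case of a tie). When nonempty, orbit queue $k$ sends retrials at rate $\alpha_k$ (constant retrial policy); a retrial succeeds if and only if the server is idle. $N_k$ is the number of jobs in orbit $k$, and $C\in\{0,1\}$ is the server state ($1$ = busy). Uniformized chain on $\mathbb{N}_0\times\mathbb{N}_0\times\{0,1\}$ (with $\lambda+\mu+\alpha_1+\alpha_2=1$): - From $(i,j,0)$: to $(i,j,1)$ with probability $\lambda$; to $(i-1,j,1)$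 with probability $\alpha_1$ if $i>0$; to $(i,j-1,1)$ with probability $\alpha_2$ if $j>0$; it stays put with the remaining probability. - From $(i,j,1)$: to $(i,j,0)$ with probability $\mu$; to $(i+1,j,1)$ with probability $\lambda_1+\lambda_0h(j-i)$; to $(i,j+1,1)$ with probability $\lambda_2+\lambda_0h(i-j)$; it stays put with probability $\alpha_1+\alpha_2$. Here $h(n)=1$ for $n\geq 1$, $h(0)=1/2$, and $h(n)=0$ for $n\leq -1$. This chain has the same stationary distribution as the continuous-time process $(N_1(t),N_2(t),C(t))$. Strongly balanced: the two orbit queues are called strongly balanced if $\lim_{l\to+\infty}\rho^{-2l}x_l(\rho^{-2})=\lim_{l\to-\infty}\rho^{2l}x_l(\rho^{-2})=0$, where $x_l(\rho^{-2})$ is the limit vector in the claim. *)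

theory Defs
  imports "HOL-Probability.Probability"
begin

text \<open>The chain conditions are stated for a transition matrix \<open>p\<close>. The Markov property is
  the elementary one, written as a product so that histories of probability zero need no
  separate treatment. The initial distribution is unrestricted.\<close>

definition markov_chain ::
    "'a measure \<Rightarrow> ('s \<Rightarrow> 's \<Rightarrow> real) \<Rightarrow> (nat \<Rightarrow> 'a \<Rightarrow> 's) \<Rightarrow> bool" where
  "markov_chain M p X \<longleftrightarrow>
     prob_space M \<and>
     (\<forall>n. X n \<in> measurable M (count_space UNIV)) \<and>
     (\<forall>n s. measure M {\<omega> \<in> space M. \<forall>k\<le>Suc n. X k \<omega> = s k} =
            measure M {\<omega> \<in> space M. \<forall>k\<le>n. X k \<omega> = s k} * p (s n) (s (Suc n)))"

text \<open>\<open>first_passage p n s t\<close> is the probability that the chain started in \<open>s\<close> visits \<open>t\<close>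
  for the first time after time 0 at time \<open>n\<close>; for \<open>s = t\<close> this is the law of the return time.\<close>

fun first_passage :: "('s \<Rightarrow> 's \<Rightarrow> real) \<Rightarrow> nat \<Rightarrow> 's \<Rightarrow> 's \<Rightarrow> real" where
  "first_passage p 0 s t = 0"
| "first_passage p (Suc 0) s t = p s t"
| "first_passage p (Suc (Suc n)) s t = infsum (\<lambda>u. p s u * first_passage p (Suc n) u t) (- {t})"

definition positive_recurrent :: "('s \<Rightarrow> 's \<Rightarrow> real) \<Rightarrow> bool" where
  "positive_recurrent p \<longleftrightarrow>
     (\<forall>s. (\<lambda>n. first_passage p n s s) sums 1 \<and>
          summable (\<lambda>n. real n * first_passage p n s s))"

text \<open>A state \<open>(i, j, c)\<close> consists of the two orbit lengths and the server state, with
  \<open>c = True\<close> meaning busy (\<open>C = 1\<close>).\<close>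

type_synonym state = "nat \<times> nat \<times> bool"

definition jsq_h :: "int \<Rightarrow> real" where
  "jsq_h n = (if n \<ge> 1 then 1 else if n = 0 then 1 / 2 else 0)"

fun jsoq_trans ::
    "real \<Rightarrow> real \<Rightarrow> real \<Rightarrow> real \<Rightarrow> real \<Rightarrow> real \<Rightarrow> state \<Rightarrow> state \<Rightarrow> real" where
  "jsoq_trans lam0 lam1 lam2 \<mu> \<alpha>1 \<alpha>2 (i, j, False) t =
     (lam0 + lam1 + lam2) * of_bool (t = (i, j, True))
     + \<alpha>1 * of_bool (i > 0 \<and> t = (i - 1, j, True))
     + \<alpha>2 * of_bool (j > 0 \<and> t = (i, j - 1, True))
     + (1 - (lam0 + lam1 + lam2) - \<alpha>1 * of_bool (i > 0) - \<alpha>2 * of_bool (j > 0))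
         * of_bool (t = (i, j, False))"
| "jsoq_trans lam0 lam1 lam2 \<mu> \<alpha>1 \<alpha>2 (i, j, True) t =
     \<mu> * of_bool (t = (i, j, False))
     + (lam1 + lam0 * jsq_h (int j - int i)) * of_bool (t = (i + 1, j, True))
     + (lam2 + lam0 * jsq_h (int i - int j)) * of_bool (t = (i, j + 1, True))
     + (\<alpha>1 + \<alpha>2) * of_bool (t = (i, j, True))"

text \<open>The limiting probability \<open>\<pi>\<^sub>m\<^sub>,\<^sub>l(1)\<close>.\<close>

definition busy_limit_prob ::
    "'a measure \<Rightarrow> (nat \<Rightarrow> 'a \<Rightarrow> nat) \<Rightarrow> (nat \<Rightarrow> 'a \<Rightarrow> nat) \<Rightarrow> (nat \<Rightarrow> 'a \<Rightarrow> bool) \<Rightarrow>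
      nat \<Rightarrow> int \<Rightarrow> real" where
  "busy_limit_prob M N1 N2 C m l =
     lim (\<lambda>n. measure M {\<omega> \<in> space M.
       min (N1 n \<omega>) (N2 n \<omega>) = m \<and> int (N2 n \<omega>) - int (N1 n \<omega>) = l \<and> C n \<omega>})"

text \<open>The vector \<open>x\<^sub>l(\<rho>\<^sup>-\<^sup>2)\<close>; the argument \<open>lamh0\<close> is \<open>\<lambda>\<^sub>0(\<lambda> + \<alpha>\<^sub>1 + \<alpha>\<^sub>2)\<close>.\<close>

definition limit_vector :: "real \<Rightarrow> real \<Rightarrow> real \<Rightarrow> real \<Rightarrow> real \<Rightarrow> int \<Rightarrow> real" where
  "limit_vector lamh0 \<gamma>1 \<gamma>2 \<rho> x0 l =
     (if l \<le> -1 then (\<gamma>2 + lamh0 / 2) / \<gamma>2 * x0 * (\<rho> * (\<gamma>2 / (\<gamma>1 + lamh0))) ^ nat \<bar>l\<bar>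
      else if l = 0 then x0
      else (\<gamma>1 + lamh0 / 2) / \<gamma>1 * x0 * (\<rho> * (\<gamma>1 / (\<gamma>2 + lamh0))) ^ nat l)"

definition strongly_balanced :: "real \<Rightarrow> (int \<Rightarrow> real) \<Rightarrow> bool" where
  "strongly_balanced \<rho> x \<longleftrightarrow>
     ((\<lambda>l. \<rho> powi (- 2 * l) * x l) \<longlongrightarrow> 0) at_top \<and>
     ((\<lambda>l. \<rho> powi (2 * l) * x l) \<longlongrightarrow> 0) at_bot"

end

theory Submission
  imports Defs
begin

text \<open>The busy part \<open>q\<close> of the stationary law is invariant for a nearest-neighbour walk on pairs of
  orbit lengths, homogeneous off the axes, for which \<open>\<rho>\<^sup>-\<^sup>(\<^sup>i\<^sup>+\<^sup>j\<^sup>)\<close> is harmonic. In the coordinates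
  minimum \<open>m\<close> and difference \<open>l\<close>, the ratio \<open>u\<^sub>m(l) = \<rho>\<^sup>-\<^sup>2\<^sup>m q(m,l) / x\<^sub>l\<close> is harmonic for the time reversal
  of a Markov additive process whose modulating chain is a positive recurrent birth-death chain on
  the integers. For the bounded strictly convex \<open>f = 1 / (1 + u)\<close> the flux through level \<open>m\<close> is decreasing in
  \<open>m\<close> and bounded, and its decrement dominates the squared differences of \<open>f\<close> along jumps. Hence
  \<open>f\<close> becomes constant in \<open>l\<close>, the flux becomes the drift times this constant, and convergence
  of the flux forces convergence of \<open>f\<close>. The limit of \<open>u\<close> is positive because the flux of \<open>u\<close> itself
  equals the positive source on the axes; that this source is finite follows from a Lyapunov function,
  and this is where \<open>max \<rho>\<^sub>1 \<rho>\<^sub>2 < \<rho>\<close> enters.\<close>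

section \<open>Renewal sequences\<close>

text \<open>Nothing is known in advance about \<open>u\<close> away from the diagonal: the estimates
  bound \<open>q i j * b ^ (i + j)\<close> with \<open>b = 1 / \<rho>\<close>, but not its ratio to
  a weight that is geometrically small in \<open>l\<close>. So \<open>u\<close> may be unbounded in
  \<open>l\<close>, and dominated convergence does not apply to it. For a bounded function of
  \<open>u\<close> every sum over \<open>l\<close> is dominated by the weight, and this is why
  \<open>f\<close> replaces \<open>u\<close>. The choice of \<rho> makes arrivals and retrials
  balance in \<open>i + j\<close>, whatever the routing. Routing enters only through the weight in
  \<open>l\<close>, found by equating the flows across each cut between \<open>l\<close> and
  \<open>l + 1\<close>; the bound on \<open>lamh0\<close> says
  \<open>\<bar>\<gamma>1 - \<gamma>2\<bar> < lamh0\<close> and is exactly the summability of that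
  weight. On the axes one orbit has no retrials to offer, so \<open>b ^ (i + j)\<close> gains there;
  this gain is the source. The existence of the limits in \<open>busy_limit_prob\<close> is not a
  hypothesis. Recurrence is given through the law of the return time, so convergence is a matter of
  renewal theory; the self-loops of the uniformized chain give the return time an atom at 1.\<close>

lemma limsup_witness:
  fixes v :: "nat \<Rightarrow> real"
  assumes bnd: "\<And>n. \<bar>v n\<bar> \<le> B"
  obtains a g where "\<And>e. e > 0 \<Longrightarrow> eventually (\<lambda>n. v n < a + e) sequentially"
    "filterlim g at_top sequentially" "(\<lambda>k. v (g k)) \<longlonglongrightarrow> a"
proof -
  define S where "S = {x. eventually (\<lambda>n. v n < x) sequentially}"
  define a where "a = Inf S"
  have lb: "- B \<le> x" if "x \<in> S" for x
  proof -
    from that obtain n where "v n < x"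
      unfolding S_def eventually_sequentially by auto
    with bnd[of n] show ?thesis by linarith
  qed
  have bdd: "bdd_below S" using lb by (auto simp: bdd_below_def)
  have "v n < B + 1" for n
    using bnd[of n] by linarith
  hence ne: "B + 1 \<in> S" unfolding S_def by simp
  have up: "eventually (\<lambda>n. v n < a + e) sequentially" if "e > 0" for e
  proof -
    have "Inf S < a + e" using that by (simp add: a_def)
    then obtain x where "x \<in> S" "x < a + e" using ne by (metis cInf_lessD empty_iff)
    thus ?thesis unfolding S_def by (auto elim: eventually_mono)
  qed
  have fr: "\<exists>n\<ge>k. v n \<ge> a - e" if "e > 0" for e k
  proof (rule ccontr)
    assume "\<not> ?thesis"
    hence "eventually (\<lambda>n. v n < a - e) sequentially"
      unfolding eventually_sequentially by (metis not_le)
    hence "a - e \<in> S" unfolding S_def by simp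
    hence "a \<le> a - e" unfolding a_def using bdd by (rule cInf_lower)
    with that show False by simp
  qed
  have "\<forall>k. \<exists>n\<ge>k. v n \<ge> a - 1 / real (Suc k)" using fr by simp
  then obtain g where g: "\<And>k. g k \<ge> k" "\<And>k. v (g k) \<ge> a - 1 / real (Suc k)" by metis
  have gt: "filterlim g at_top sequentially"
    using g(1) by (intro filterlim_at_top_mono[OF filterlim_ident]) auto
  have "(\<lambda>k. v (g k)) \<longlonglongrightarrow> a"
  proof (rule order_tendstoI)
    fix c assume "c < a"
    have "(\<lambda>k. a - 1 / real (Suc k)) \<longlonglongrightarrow> a - 0"
      by (intro tendsto_intros LIMSEQ_inverse_real_of_nat[unfolded inverse_eq_divide])
    hence "eventually (\<lambda>k. a - 1 / real (Suc k) > c) sequentially"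
      using \<open>c < a\<close> by (intro order_tendstoD(1)) auto
    thus "eventually (\<lambda>k. c < v (g k)) sequentially"
      by eventually_elim (use g(2) less_le_trans in blast)
  next
    fix c assume "a < c"
    from up[of "c - a"] \<open>a < c\<close> have "eventually (\<lambda>n. v n < c) sequentially" by simp
    thus "eventually (\<lambda>k. v (g k) < c) sequentially"
      using gt by (rule eventually_compose_filterlim)
  qed
  with up gt show ?thesis by (rule that)
qed

lemma tail_sums_summable:
  fixes f :: "nat \<Rightarrow> real"
  assumes f: "\<And>k. f k \<ge> 0" "f sums 1" and mean: "summable (\<lambda>k. real k * f k)"
  defines "r \<equiv> \<lambda>j. 1 - (\<Sum>k\<le>j. f k)"
  shows "\<And>j. 0 \<le> r j" "summable r"
proof -
  have tail: "r n = (\<Sum>k. f (k + Suc n))" for n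
    using suminf_minus_initial_segment[OF sums_summable[OF f(2)], of "Suc n"] sums_unique[OF f(2)]
    by (simp add: r_def lessThan_Suc_atMost)
  have sf: "summable (\<lambda>k. f (k + Suc n))" for n
    using sums_summable[OF f(2)] by (rule summable_ignore_initial_segment)
  show r0: "0 \<le> r j" for j
    unfolding tail by (intro suminf_nonneg sf f)
  \<comment> \<open>Summation by parts. The boundary term \<open>real n * r n\<close> is at most the
    remaining tail of the mean, which bounds the partial sums uniformly in \<open>n\<close>.\<close>
  have part: "(\<Sum>j<n. r j) = real n * r n + (\<Sum>k\<le>n. real k * f k)" for n
    by (induction n) (auto simp: r_def algebra_simps)
  have "(\<Sum>j<n. r j) \<le> (\<Sum>k. real k * f k)" for n
  proof -
    have "real n * r n = (\<Sum>k. real n * f (k + Suc n))"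
      unfolding tail by (rule suminf_mult[symmetric]) (rule sf)
    also have "\<dots> \<le> (\<Sum>k. real (k + Suc n) * f (k + Suc n))"
      by (intro suminf_le summable_mult sf summable_ignore_initial_segment[OF mean, of "Suc n"]
          mult_right_mono f) auto
    also have "\<dots> = (\<Sum>k. real k * f k) - (\<Sum>k\<le>n. real k * f k)"
      using suminf_minus_initial_segment[OF mean, of "Suc n"] by (simp add: lessThan_Suc_atMost)
    finally show ?thesis unfolding part by simp
  qed
  with r0 show "summable r" by (intro summableI_nonneg_bounded)
qed

text \<open>The renewal equation writes \<open>v (Suc n)\<close> as an average in which
  \<open>v n\<close> has the fixed weight \<open>f 1 > 0\<close> and the other relevant values
  barely exceed the limsup \<open>a\<close>. If \<open>v (Suc n)\<close> is near \<open>a\<close>,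
  then \<open>v n\<close> cannot lie far below \<open>a\<close>.\<close>

lemma renewal_limsup_shift:
  fixes f v :: "nat \<Rightarrow> real"
  assumes f: "\<And>k. f k \<ge> 0" "f 0 = 0" "f 1 > 0" "f sums 1"
    and bnd: "\<And>n. \<bar>v n\<bar> \<le> B"
    and ren: "\<And>n. v (Suc n) = (\<Sum>k\<le>Suc n. f k * v (Suc n - k))"
    and up: "\<And>e. e > 0 \<Longrightarrow> eventually (\<lambda>n. v n < a + e) sequentially"
    and g: "filterlim g at_top sequentially" "(\<lambda>k. v (g k)) \<longlonglongrightarrow> a"
  shows "(\<lambda>k. v (g k - Suc 0)) \<longlonglongrightarrow> a"
proof -
  define D where "D = B + \<bar>a\<bar> + 1"
  have D: "D \<ge> 1" using bnd[of 0] by (simp add: D_def)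
  have step: "eventually (\<lambda>n. v n \<ge> a + (v (Suc n) - a - e) / f 1) sequentially" if e: "e > 0" for e
  proof -
    \<comment> \<open>Three errors occur: the mass missing from the finite sum
      (\<open>D * e'\<close>), the excess of the middle terms (\<open>e'\<close>), and the tail
      (\<open>D * e'\<close>). Their total \<open>e' * (2 * D + 1)\<close> is at most
      \<open>e\<close>.\<close>
    define e' where "e' = e / (2 * D + 2)"
    have e': "e' > 0" "e' * (2 * D + 2) = e" using e D by (auto simp: e'_def)
    have "(\<lambda>n. \<Sum>k<n. f k) \<longlonglongrightarrow> 1" using f(4) by (simp add: sums_def)
    hence "eventually (\<lambda>n. (\<Sum>k<n. f k) > 1 - e') sequentially"
      using e' by (intro order_tendstoD(1)) auto
    hence "eventually (\<lambda>n. (\<Sum>k<n. f k) > 1 - e' \<and> n \<ge> 2) sequentially"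
      using eventually_ge_at_top by (rule eventually_conj)
    \<comment> \<open>\<open>J\<close> cuts off all but \<open>e'\<close> of the mass of
      \<open>f\<close>; taking \<open>n \<ge> N + J\<close> keeps every index
      \<open>Suc n - k\<close> with \<open>k < J\<close> in the range where \<open>v\<close> is
      below \<open>a + e'\<close>.\<close>
    then obtain J where J: "(\<Sum>k<J. f k) > 1 - e'" "J \<ge> 2"
      unfolding eventually_sequentially by auto
    from up[OF e'(1)] obtain N where N: "\<And>n. n \<ge> N \<Longrightarrow> v n < a + e'"
      unfolding eventually_sequentially by auto
    have "v n \<ge> a + (v (Suc n) - a - e) / f 1" if n: "n \<ge> N + J" for n
    proof -
      have tot: "(\<Sum>k\<le>Suc n. f k) \<le> 1"
        using sum_le_suminf[OF sums_summable[OF f(4)], of "{..Suc n}"] f(1) sums_unique[OF f(4)] by simp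
      have split: "(\<Sum>k\<le>Suc n. F k) = F 0 + F 1 + (\<Sum>k\<in>{2..<J}. F k) + (\<Sum>k\<in>{J..Suc n}. F k)"
        for F :: "nat \<Rightarrow> real"
      proof -
        have "{..Suc n} = {0,1} \<union> {2..<J} \<union> {J..Suc n}" using J(2) n by auto
        hence "(\<Sum>k\<le>Suc n. F k) = sum F ({0,1} \<union> {2..<J} \<union> {J..Suc n})" by simp
        also have "\<dots> = sum F {0,1} + sum F {2..<J} + sum F {J..Suc n}"
          using J(2) by (subst sum.union_disjoint; auto)+
        finally show ?thesis by simp
      qed
      have "(\<Sum>k<J. f k) = f 0 + f 1 + (\<Sum>k\<in>{2..<J}. f k)"
      proof -
        have "{..<J} = {0,1} \<union> {2..<J}" using J(2) by auto
        hence "(\<Sum>k<J. f k) = sum f ({0,1} \<union> {2..<J})" by simp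
        also have "\<dots> = sum f {0,1} + sum f {2..<J}"
          by (subst sum.union_disjoint) auto
        finally show ?thesis by simp
      qed
      hence mid: "f 1 + (\<Sum>k\<in>{2..<J}. f k) > 1 - e'" using J(1) f(2) by simp
      have tl: "(\<Sum>k\<in>{J..Suc n}. f k) < e'" using tot split[of f] mid f(2) by simp
      define d where "d k = v k - a" for k
      have dD: "d k \<le> D" "d k \<ge> - D" for k using bnd[of k] by (auto simp: d_def D_def abs_le_iff)
      have "d (Suc n) = (\<Sum>k\<le>Suc n. f k * v (Suc n - k)) - a" by (simp add: d_def ren)
      also have "\<dots> = (\<Sum>k\<le>Suc n. f k * d (Suc n - k)) - a * (1 - (\<Sum>k\<le>Suc n. f k))"
        by (simp add: d_def algebra_simps sum_subtractf sum_distrib_left)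
      also have "\<dots> \<le> (\<Sum>k\<le>Suc n. f k * d (Suc n - k)) + D * e'"
      proof -
        have "1 - (\<Sum>k\<le>Suc n. f k) \<le> e'"
        proof -
          have "(\<Sum>k\<in>{J..Suc n}. f k) \<ge> 0" by (intro sum_nonneg f)
          thus ?thesis using split[of f] mid f(2) by simp
        qed
        moreover have "- a \<le> D" "D \<ge> 0" using D bnd[of 0] unfolding D_def by linarith+
        ultimately have "(- a) * (1 - (\<Sum>k\<le>Suc n. f k)) \<le> D * e'"
          using tot by (intro order.trans[OF mult_right_mono mult_left_mono]) auto
        thus ?thesis by simp
      qed
      also have "(\<Sum>k\<le>Suc n. f k * d (Suc n - k)) = f 1 * d n + (\<Sum>k\<in>{2..<J}. f k * d (Suc n - k))
          + (\<Sum>k\<in>{J..Suc n}. f k * d (Suc n - k))"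
        by (subst split) (simp add: f)
      also have "(\<Sum>k\<in>{2..<J}. f k * d (Suc n - k)) \<le> (\<Sum>k\<in>{2..<J}. f k * e')"
      proof (rule sum_mono)
        fix k assume "k \<in> {2..<J}"
        hence "Suc n - k \<ge> N" using n by auto
        from N[OF this] show "f k * d (Suc n - k) \<le> f k * e'"
          by (intro mult_left_mono f) (simp add: d_def)
      qed
      also have "\<dots> \<le> e'"
      proof -
        have "(\<Sum>k\<in>{J..Suc n}. f k) \<ge> 0" by (intro sum_nonneg f)
        hence "(\<Sum>k\<in>{2..<J}. f k) \<le> 1" using split[of f] tot f(2,3) by linarith
        thus ?thesis using e'(1) by (simp add: sum_distrib_right[symmetric])
      qed
      also have "(\<Sum>k\<in>{J..Suc n}. f k * d (Suc n - k)) \<le> (\<Sum>k\<in>{J..Suc n}. f k * D)"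
        by (intro sum_mono mult_left_mono f dD)
      also have "\<dots> \<le> D * e'"
        using mult_left_mono[OF less_imp_le[OF tl], of D] D
        by (simp only: sum_distrib_right[symmetric] mult.commute[of D])
      finally have "d (Suc n) \<le> f 1 * d n + e' * (2 * D + 1)" by (simp add: algebra_simps)
      also have "\<dots> \<le> f 1 * d n + e" using e' by (simp add: algebra_simps)
      finally have "(d (Suc n) - e) / f 1 \<le> d n" using f(3) by (simp add: field_simps)
      thus ?thesis by (simp add: d_def algebra_simps)
    qed
    thus ?thesis unfolding eventually_sequentially by blast
  qed
  have g': "filterlim (\<lambda>k. g k - Suc 0) at_top sequentially"
    using g(1) by (rule filterlim_compose[OF filterlim_minus_const_nat_at_top])
  show ?thesis
  proof (rule order_tendstoI)
    fix c assume c: "c < a"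
    define e where "e = (a - c) * f 1 / 3"
    have e: "e > 0" using c f(3) by (simp add: e_def field_simps)
    have "eventually (\<lambda>k. v (g k) > a - e) sequentially"
      using g(2) e by (intro order_tendstoD(1)) auto
    moreover have "eventually (\<lambda>k. v (g k - Suc 0) \<ge> a + (v (Suc (g k - Suc 0)) - a - e) / f 1) sequentially"
      by (rule eventually_compose_filterlim[OF step[OF e] g'])
    moreover have "eventually (\<lambda>k. g k \<ge> 1) sequentially"
      using g(1) by (simp add: filterlim_at_top)
    ultimately show "eventually (\<lambda>k. c < v (g k - Suc 0)) sequentially"
    proof eventually_elim
      case (elim k)
      have "c < a + (- 2 * e) / f 1" using c f(3) by (simp add: e_def field_simps)
      also have "(- 2 * e) / f 1 \<le> (v (g k) - a - e) / f 1"
        using elim f(3) by (intro divide_right_mono) auto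
      finally show ?case using elim by simp
    qed
  next
    fix c assume "a < c"
    from up[of "c - a"] \<open>a < c\<close> have "eventually (\<lambda>n. v n < c) sequentially" by simp
    thus "eventually (\<lambda>k. v (g k - Suc 0) < c) sequentially"
      using g' by (rule eventually_compose_filterlim)
  qed
qed

text \<open>Feller's argument: along a subsequence realising the limsup, all earlier values have the same
  limit, so the conserved sum \<open>\<Sum>j. r j * v (n - j)\<close> identifies it.\<close>

lemma renewal_limsup:
  fixes f v :: "nat \<Rightarrow> real"
  assumes f: "\<And>k. f k \<ge> 0" "f 0 = 0" "f 1 > 0" "f sums 1"
    and mean: "summable (\<lambda>k. real k * f k)"
    and bnd: "\<And>n. \<bar>v n\<bar> \<le> B"
    and ren: "\<And>n. v (Suc n) = (\<Sum>k\<le>Suc n. f k * v (Suc n - k))"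
  defines "m \<equiv> \<Sum>j. 1 - (\<Sum>k\<le>j. f k)"
  shows "m \<ge> 1" "\<And>e. e > 0 \<Longrightarrow> eventually (\<lambda>n. v n < v 0 / m + e) sequentially"
proof -
  define r where "r j = 1 - (\<Sum>k\<le>j. f k)" for j
  have r: "\<And>j. 0 \<le> r j" "summable r"
    unfolding r_def using tail_sums_summable[OF f(1) f(4) mean] by blast+
  have "r 0 \<le> suminf r"
    using sum_le_suminf[OF r(2), of "{0}"] r(1) by simp
  moreover have "m = suminf r" unfolding m_def r_def ..
  ultimately show m: "m \<ge> 1" by (simp add: r_def f)
  \<comment> \<open>A conservation law: since \<open>r (Suc j) = r j - f (Suc j)\<close>, the
    renewal equation makes this sum independent of \<open>n\<close>.\<close>
  have const: "(\<Sum>j\<le>n. r j * v (n - j)) = v 0" for n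
  proof (induction n)
    case 0 thus ?case by (simp add: r_def f)
  next
    case (Suc n)
    have rS: "r (Suc j) = r j - f (Suc j)" for j by (simp add: r_def)
    have "(\<Sum>j\<le>Suc n. r j * v (Suc n - j)) = r 0 * v (Suc n) + (\<Sum>j\<le>n. r (Suc j) * v (n - j))"
      by (subst sum.atMost_Suc_shift) simp
    also have "(\<Sum>j\<le>n. r (Suc j) * v (n - j)) = v 0 - (\<Sum>j\<le>n. f (Suc j) * v (n - j))"
      by (simp add: rS left_diff_distrib sum_subtractf Suc.IH)
    also have "(\<Sum>j\<le>n. f (Suc j) * v (n - j)) = v (Suc n)"
      by (subst ren, subst sum.atMost_Suc_shift) (simp add: f)
    finally show ?case by (simp add: r_def f)
  qed
  obtain a g where a: "\<And>e. e > 0 \<Longrightarrow> eventually (\<lambda>n. v n < a + e) sequentially"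
    and g: "filterlim g at_top sequentially" "(\<lambda>k. v (g k)) \<longlonglongrightarrow> a"
    using limsup_witness[of v, OF bnd] by metis
  have shift: "(\<lambda>k. v (g k - j)) \<longlonglongrightarrow> a" for j
  proof (induction j)
    case 0 show ?case using g(2) by simp
  next
    case (Suc j)
    have "filterlim (\<lambda>k. g k - j) at_top sequentially"
      using g(1) by (rule filterlim_compose[OF filterlim_minus_const_nat_at_top])
    from renewal_limsup_shift[OF f bnd ren a this Suc] show ?case by simp
  qed
  have B0: "B \<ge> 0" using bnd[of 0] by simp
  have lim: "(\<lambda>k. \<Sum>j. if j \<le> g k then r j * v (g k - j) else 0) \<longlonglongrightarrow> (\<Sum>j. r j * a)"
  proof -
    have "(\<lambda>k. if j \<le> g k then r j * v (g k - j) else 0) \<longlonglongrightarrow> r j * a" for j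
    proof -
      have "(\<lambda>k. r j * v (g k - j)) \<longlonglongrightarrow> r j * a" by (intro tendsto_intros shift)
      moreover have "eventually (\<lambda>k. j \<le> g k) sequentially" using g(1) by (simp add: filterlim_at_top)
      hence "eventually (\<lambda>k. r j * v (g k - j) = (if j \<le> g k then r j * v (g k - j) else 0)) sequentially"
        by eventually_elim simp
      ultimately show ?thesis using tendsto_cong by fast
    qed
    moreover have "norm (if j \<le> g k then r j * v (g k - j) else 0) \<le> r j * B" for j k
      using r(1)[of j] bnd[of "g k - j"] B0 by (auto simp: abs_mult intro!: mult_left_mono)
    hence "eventually (\<lambda>(j,k). norm (if j \<le> g k then r j * v (g k - j) else 0) \<le> r j * B) (at_top \<times>\<^sub>F sequentially)"
      by (intro always_eventually) auto
    moreover have "summable (\<lambda>j. r j * B)" using r(2) by (rule summable_mult2)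
    ultimately show ?thesis
      using tannerys_theorem[of "\<lambda>j k. if j \<le> g k then r j * v (g k - j) else 0" "\<lambda>j. r j * a" sequentially "\<lambda>j. r j * B"]
      by simp
  qed
  have "(\<Sum>j. if j \<le> g k then r j * v (g k - j) else 0) = v 0" for k
  proof -
    have "(\<Sum>j. if j \<le> g k then r j * v (g k - j) else 0)
        = (\<Sum>j\<le>g k. if j \<le> g k then r j * v (g k - j) else 0)"
      by (rule suminf_finite) auto
    thus ?thesis using const[of "g k"] by simp
  qed
  with lim have "(\<Sum>j. r j * a) = v 0" by (simp add: LIMSEQ_const_iff)
  hence "suminf r * a = v 0" using suminf_mult2[OF r(2), of a] by simp
  hence "a = v 0 / m" using m \<open>m = suminf r\<close> by (simp add: field_simps)
  with a show "eventually (\<lambda>n. v n < v 0 / m + e) sequentially" if "e > 0" for e using that by simp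
qed

text \<open>The renewal equation is linear, so the upper bound from \<open>renewal_limsup\<close>
  applies to \<open>u\<close> and to \<open>- u\<close>; the two bounds share the constant
  \<open>1 / m\<close>, with \<open>m\<close> the mean return time.\<close>

theorem renewal_theorem:
  fixes f u :: "nat \<Rightarrow> real"
  assumes f: "\<And>k. f k \<ge> 0" "f 0 = 0" "f 1 > 0" "f sums 1"
    and mean: "summable (\<lambda>k. real k * f k)"
    and bnd: "\<And>n. \<bar>u n\<bar> \<le> B" and u0: "u 0 = 1"
    and ren: "\<And>n. u (Suc n) = (\<Sum>k\<le>Suc n. f k * u (Suc n - k))"
  shows "\<exists>c>0. u \<longlonglongrightarrow> c"
proof -
  define m where "m = (\<Sum>j. 1 - (\<Sum>k\<le>j. f k))"
  have up: "eventually (\<lambda>n. u n < 1 / m + e) sequentially" if "e > 0" for e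
    using renewal_limsup(2)[OF f mean bnd ren that] u0 by (simp add: m_def)
  have "\<bar>- u n\<bar> \<le> B" for n using bnd by simp
  moreover have "- u (Suc n) = (\<Sum>k\<le>Suc n. f k * - u (Suc n - k))" for n
    by (subst ren) (simp only: mult_minus_right sum_negf)
  ultimately have lo: "eventually (\<lambda>n. - u n < - 1 / m + e) sequentially" if "e > 0" for e
    using renewal_limsup(2)[OF f mean, of "\<lambda>n. - u n" B e] u0 that by (simp add: m_def)
  have "m \<ge> 1" using renewal_limsup(1)[OF f mean bnd ren] by (simp add: m_def)
  moreover have "u \<longlonglongrightarrow> 1 / m"
  proof (rule order_tendstoI)
    fix c assume "c < 1 / m"
    with lo[of "1 / m - c"] show "eventually (\<lambda>n. c < u n) sequentially" by simp
  next
    fix c assume "c > 1 / m"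
    with up[of "c - 1 / m"] show "eventually (\<lambda>n. u n < c) sequentially" by simp
  qed
  ultimately show ?thesis by (intro exI[of _ "1 / m"]) auto
qed

section \<open>Convergence of positive recurrent chains\<close>

lemma integrable_count_space_boundedI:
  fixes f :: "'a \<Rightarrow> real"
  assumes "\<And>x. f x \<ge> 0" "\<And>F. finite F \<Longrightarrow> sum f F \<le> B"
  shows "integrable (count_space UNIV) f"
proof -
  have "f summable_on UNIV"
    using assms by (intro nonneg_bdd_above_summable_on) (auto simp: bdd_above_def)
  hence "Infinite_Set_Sum.abs_summable_on f UNIV"
    by (metis summable_on_iff_abs_summable_on_real abs_summable_equivalent)
  thus ?thesis by (simp add: Infinite_Set_Sum.abs_summable_on_def)
qed

lemma integral_count_space_finite_superset:
  fixes f :: "'a \<Rightarrow> real"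
  assumes "finite F" "\<And>x. x \<notin> F \<Longrightarrow> f x = 0"
  shows "(\<integral>x. f x \<partial>count_space UNIV) = sum f F"
proof -
  have sub: "{x. f x \<noteq> 0} \<subseteq> F" using assms(2) by auto
  have "(\<integral>x. f x \<partial>count_space UNIV) = sum f {x. f x \<noteq> 0}"
    using finite_subset[OF sub assms(1)] by (simp add: lebesgue_integral_count_space_finite_support)
  also have "\<dots> = sum f F" using assms sub by (intro sum.mono_neutral_left) auto
  finally show ?thesis .
qed

lemma (in prob_space) total_probability_countable:
  fixes X :: "'a \<Rightarrow> 's::countable"
  assumes X: "X \<in> measurable M (count_space UNIV)" and A: "A \<in> sets M"
  shows "has_bochner_integral (count_space UNIV) (\<lambda>s. measure M {\<omega> \<in> A. X \<omega> = s}) (measure M A)"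
proof (rule has_bochner_integral_nn_integral)
  have sets: "{\<omega> \<in> A. X \<omega> = s} \<in> sets M" for s
  proof -
    have "{\<omega> \<in> A. X \<omega> = s} = A \<inter> (X -` {s} \<inter> space M)"
      using sets.sets_into_space[OF A] by auto
    thus ?thesis using A X by (simp add: measurable_sets)
  qed
  have "emeasure M (\<Union>s. {\<omega> \<in> A. X \<omega> = s}) = (\<integral>\<^sup>+s. emeasure M {\<omega> \<in> A. X \<omega> = s} \<partial>count_space UNIV)"
    using sets by (intro emeasure_UN_countable) (auto simp: disjoint_family_on_def)
  moreover have "(\<Union>s. {\<omega> \<in> A. X \<omega> = s}) = A" by auto
  ultimately show "(\<integral>\<^sup>+s. ennreal (measure M {\<omega> \<in> A. X \<omega> = s}) \<partial>count_space UNIV) = ennreal (measure M A)"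
    by (simp add: emeasure_eq_measure)
qed auto

section \<open>First passage decomposition for a stochastic matrix with finite rows and
  columns\<close>

locale markov_matrix =
  fixes P :: "'s \<Rightarrow> 's \<Rightarrow> real"
  assumes P_nonneg: "P s t \<ge> 0"
    and finite_succ: "finite {t. P s t \<noteq> 0}"
    and finite_pred: "finite {s. P s t \<noteq> 0}"
    and P_sum: "(\<Sum>t | P s t \<noteq> 0. P s t) = 1"
begin

primrec tp :: "nat \<Rightarrow> 's \<Rightarrow> 's \<Rightarrow> real" where
  "tp 0 s t = of_bool (s = t)"
| "tp (Suc n) s t = (\<Sum>u | P s u \<noteq> 0. P s u * tp n u t)"

lemma tp_nonneg: "tp n s t \<ge> 0"
  by (induction n arbitrary: s) (auto intro!: sum_nonneg mult_nonneg_nonneg P_nonneg)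

lemma tp_le_1: "tp n s t \<le> 1"
proof (induction n arbitrary: s)
  case (Suc n)
  have "tp (Suc n) s t \<le> (\<Sum>u | P s u \<noteq> 0. P s u * 1)"
    unfolding tp.simps by (intro sum_mono mult_left_mono Suc P_nonneg)
  thus ?case using P_sum by simp
qed auto

lemma sum_tp_le_1: "finite F \<Longrightarrow> (\<Sum>t\<in>F. tp n s t) \<le> 1"
proof (induction n arbitrary: s)
  case 0
  thus ?case by (simp add: of_bool_def)
next
  case (Suc n)
  have "(\<Sum>t\<in>F. tp (Suc n) s t) = (\<Sum>u | P s u \<noteq> 0. P s u * (\<Sum>t\<in>F. tp n u t))"
    unfolding tp.simps by (subst sum.swap) (simp add: sum_distrib_left)
  also have "\<dots> \<le> (\<Sum>u | P s u \<noteq> 0. P s u * 1)"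
    by (intro sum_mono mult_left_mono Suc P_nonneg)
  finally show ?case using P_sum by simp
qed

text \<open>The recursion defining \<open>tp\<close> splits off the first step; laws and
  stationarity need the last step split off instead.\<close>

lemma tp_forward: "tp (Suc n) s t = (\<Sum>u | P u t \<noteq> 0. tp n s u * P u t)"
proof (induction n arbitrary: s)
  case 0
  have "tp (Suc 0) s t = (\<Sum>u | P s u \<noteq> 0. if u = t then P s u else 0)"
    unfolding tp.simps by (intro sum.cong) auto
  also have "\<dots> = P s t" using finite_succ[of s] by (subst sum.delta) auto
  also have "\<dots> = (\<Sum>u | P u t \<noteq> 0. if u = s then P u t else 0)"
    using finite_pred[of t] by (subst sum.delta) auto
  also have "\<dots> = (\<Sum>u | P u t \<noteq> 0. tp 0 s u * P u t)" by (intro sum.cong) auto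
  finally show ?case .
next
  case (Suc n)
  have "tp (Suc (Suc n)) s t = (\<Sum>u | P s u \<noteq> 0. P s u * (\<Sum>v | P v t \<noteq> 0. tp n u v * P v t))"
    unfolding tp.simps(2)[of "Suc n"] Suc ..
  also have "\<dots> = (\<Sum>u | P s u \<noteq> 0. \<Sum>v | P v t \<noteq> 0. P s u * tp n u v * P v t)"
    by (simp add: sum_distrib_left mult.assoc)
  also have "\<dots> = (\<Sum>v | P v t \<noteq> 0. tp (Suc n) s v * P v t)"
    by (subst sum.swap) (simp add: sum_distrib_right)
  finally show ?case .
qed

abbreviation fp :: "nat \<Rightarrow> 's \<Rightarrow> 's \<Rightarrow> real" where "fp \<equiv> first_passage P"

text \<open>Finite rows turn the infinite sum of the definition into a finite one, so the later
  interchanges of sums need no summability argument.\<close>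

lemma fp_Suc_Suc: "fp (Suc (Suc n)) s t = (\<Sum>u\<in>{u. P s u \<noteq> 0} - {t}. P s u * fp (Suc n) u t)"
proof -
  have "infsum (\<lambda>u. P s u * fp (Suc n) u t) (- {t})
      = infsum (\<lambda>u. P s u * fp (Suc n) u t) ({u. P s u \<noteq> 0} - {t})"
    by (rule infsum_cong_neutral) auto
  thus ?thesis using finite_succ[of s] by simp
qed

lemma fp_nonneg: "fp n s t \<ge> 0"
proof (induction n arbitrary: s rule: less_induct)
  case (less n)
  consider "n = 0" | "n = Suc 0" | k where "n = Suc (Suc k)" by (metis not0_implies_Suc)
  thus ?case
  proof cases
    case (3 k)
    with less[of "Suc k"] show ?thesis
      by (simp only: fp_Suc_Suc) (auto intro!: sum_nonneg mult_nonneg_nonneg P_nonneg)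
  qed (auto simp: P_nonneg)
qed

lemma sum_fp_Suc:
  "(\<Sum>k\<le>Suc n. fp k s t) = P s t + (\<Sum>u\<in>{u. P s u \<noteq> 0} - {t}. P s u * (\<Sum>k\<le>n. fp k u t))"
proof -
  have "(\<Sum>k\<le>Suc n. fp k s t) = P s t + (\<Sum>k<n. fp (Suc (Suc k)) s t)"
    by (simp add: sum.atMost_Suc_shift sum.lessThan_Suc_shift lessThan_Suc_atMost[symmetric] del: first_passage.simps(3) sum.lessThan_Suc)
  also have "(\<Sum>k<n. fp (Suc (Suc k)) s t) = (\<Sum>u\<in>{u. P s u \<noteq> 0} - {t}. P s u * (\<Sum>k<n. fp (Suc k) u t))"
    unfolding fp_Suc_Suc by (subst sum.swap) (simp add: sum_distrib_left)
  also have "\<dots> = (\<Sum>u\<in>{u. P s u \<noteq> 0} - {t}. P s u * (\<Sum>k\<le>n. fp k u t))"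
  proof -
    have "(\<Sum>k<n. fp (Suc k) u t) = (\<Sum>k\<le>n. fp k u t)" for u
      by (simp add: sum.lessThan_Suc_shift lessThan_Suc_atMost[symmetric] del: first_passage.simps(3) sum.lessThan_Suc)
    thus ?thesis by simp
  qed
  finally show ?thesis .
qed

lemma P_split: "P s t + (\<Sum>u\<in>{u. P s u \<noteq> 0} - {t}. P s u) = 1"
proof (cases "P s t = 0")
  case True
  hence "{u. P s u \<noteq> 0} - {t} = {u. P s u \<noteq> 0}" by auto
  thus ?thesis using True P_sum[of s] by simp
next
  case False
  thus ?thesis using sum.remove[OF finite_succ[of s], of t "P s"] P_sum[of s] by simp
qed

lemma sum_fp_le_1: "(\<Sum>k\<le>n. fp k s t) \<le> 1"
proof (induction n arbitrary: s)
  case (Suc n)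
  have "(\<Sum>k\<le>Suc n. fp k s t) \<le> P s t + (\<Sum>u\<in>{u. P s u \<noteq> 0} - {t}. P s u * 1)"
    unfolding sum_fp_Suc by (intro add_left_mono sum_mono mult_left_mono Suc P_nonneg)
  thus ?case using P_split[of s t] by simp
qed simp

lemma summable_fp: "summable (\<lambda>n. fp n s t)"
proof (rule summableI_nonneg_bounded)
  show "(\<Sum>k<n. fp k s t) \<le> 1" for n
    using sum_fp_le_1[of s t n] fp_nonneg[of n s t] by (simp add: lessThan_Suc_atMost[symmetric])
qed (rule fp_nonneg)

definition hit :: "'s \<Rightarrow> 's \<Rightarrow> real" where "hit s t = (\<Sum>n. fp n s t)"

lemma hit_le_1: "hit s t \<le> 1"
  unfolding hit_def
proof (rule suminf_le_const[OF summable_fp])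
  show "(\<Sum>k<n. fp k s t) \<le> 1" for n
    using sum_fp_le_1[of s t n] fp_nonneg[of n s t] by (simp add: lessThan_Suc_atMost[symmetric])
qed

lemma hit_step: "hit s t = P s t + (\<Sum>u\<in>{u. P s u \<noteq> 0} - {t}. P s u * hit u t)"
proof (rule LIMSEQ_unique)
  have lim: "(\<lambda>n. \<Sum>k\<le>n. fp k s t) \<longlonglongrightarrow> hit s t" for s
    unfolding hit_def by (rule summable_LIMSEQ'[OF summable_fp])
  show "(\<lambda>n. \<Sum>k\<le>Suc n. fp k s t) \<longlonglongrightarrow> hit s t"
    using lim by (rule LIMSEQ_Suc)
  show "(\<lambda>n. \<Sum>k\<le>Suc n. fp k s t) \<longlonglongrightarrow> P s t + (\<Sum>u\<in>{u. P s u \<noteq> 0} - {t}. P s u * hit u t)"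
    unfolding sum_fp_Suc by (intro tendsto_intros lim)
qed

text \<open>Decomposition by the first visit to \<open>t\<close>. It begins at time 1, because
  \<open>tp 0 s t\<close> may be 1 while \<open>fp 0 s t = 0\<close>. The induction varies the start
  \<open>s\<close>, as one step leads to other starts.\<close>

lemma tp_renewal: "tp (Suc n) s t = (\<Sum>k\<le>Suc n. fp k s t * tp (Suc n - k) t t)"
proof (induction n arbitrary: s)
  case 0
  show ?case using tp_forward[of 0 s t] finite_pred[of t]
    by (simp add: of_bool_def if_distrib[of "\<lambda>x. x * _"] sum.delta' cong: if_cong del: tp.simps(2))
next
  case (Suc n)
  let ?U = "{u. P s u \<noteq> 0} - {t}"
  have "tp (Suc (Suc n)) s t = P s t * tp (Suc n) t t + (\<Sum>u\<in>?U. P s u * tp (Suc n) u t)"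
  proof (cases "P s t = 0")
    case True
    hence "?U = {u. P s u \<noteq> 0}" by auto
    thus ?thesis using True by simp
  next
    case False
    thus ?thesis
      unfolding tp.simps(2)[of "Suc n"] using finite_succ[of s] by (subst sum.remove[of _ t]) auto
  qed
  also have "(\<Sum>u\<in>?U. P s u * tp (Suc n) u t)
      = (\<Sum>u\<in>?U. P s u * (\<Sum>k\<le>n. fp (Suc k) u t * tp (n - k) t t))"
    unfolding Suc by (simp add: sum.atMost_Suc_shift del: sum.atMost_Suc first_passage.simps(3))
  also have "\<dots> = (\<Sum>k\<le>n. fp (Suc (Suc k)) s t * tp (n - k) t t)"
    unfolding fp_Suc_Suc sum_distrib_left sum_distrib_right
    by (subst sum.swap) (simp add: mult.assoc)
  also have "P s t * tp (Suc n) t t + \<dots> = (\<Sum>k\<le>Suc (Suc n). fp k s t * tp (Suc (Suc n) - k) t t)"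
    by (simp add: sum.atMost_Suc_shift del: sum.atMost_Suc first_passage.simps(3) tp.simps)
  finally show ?case .
qed

end

section \<open>Limiting probabilities of an irreducible positive recurrent matrix\<close>

locale ergodic_matrix = markov_matrix P for P :: "'s::countable \<Rightarrow> 's \<Rightarrow> real" +
  assumes recurrent: "positive_recurrent P"
    and irreducible: "(s, t) \<in> {(s, t). P s t > 0}\<^sup>*"
    and loop: "P s s > 0"
begin

lemma hit_self: "hit t t = 1"
  using recurrent unfolding positive_recurrent_def hit_def by (metis sums_unique)

text \<open>Certainty of hitting \<open>t\<close> spreads along a path from \<open>t\<close> to
  \<open>s\<close>: if \<open>hit x t = 1\<close>, then the deficits \<open>1 - hit u t\<close> over
  the successors \<open>u\<close> other than \<open>t\<close> have weighted sum zero, so each of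
  them vanishes.\<close>

lemma hit_eq_1: "hit s t = 1"
proof -
  from irreducible[of t s] show ?thesis
  proof (induction rule: rtrancl_induct)
    case base show ?case by (rule hit_self)
  next
    case (step x y)
    show ?case
    proof (cases "y = t")
      case True thus ?thesis using hit_self by simp
    next
      case False
      let ?U = "{u. P x u \<noteq> 0} - {t}"
      have fin: "finite ?U" using finite_succ[of x] by simp
      have "(\<Sum>u\<in>?U. P x u * (1 - hit u t)) = 0"
        using hit_step[of x t] P_split[of x t] step.IH
        by (simp add: right_diff_distrib sum_subtractf)
      hence "P x y * (1 - hit y t) = 0"
        using sum_nonneg_eq_0_iff[OF fin, of "\<lambda>u. P x u * (1 - hit u t)"] hit_le_1 P_nonneg step False
        by auto
      thus ?thesis using step by auto
    qed
  qed
qed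

text \<open>\<open>loop\<close> supplies the atom of the return time law at 1 that
  \<open>renewal_theorem\<close> asks for, in place of a general aperiodicity condition.\<close>

lemma tp_self_limit: "\<exists>c>0. (\<lambda>n. tp n t t) \<longlonglongrightarrow> c"
proof (rule renewal_theorem)
  show "(\<lambda>n. fp n t t) sums 1" "summable (\<lambda>k. real k * fp k t t)"
    using recurrent unfolding positive_recurrent_def by auto
  show "\<bar>tp n t t\<bar> \<le> 1" for n using tp_nonneg[of n t t] tp_le_1[of n t t] by simp
  show "tp (Suc n) t t = (\<Sum>k\<le>Suc n. fp k t t * tp (Suc n - k) t t)" for n
    by (rule tp_renewal)
qed (simp_all add: fp_nonneg loop)

definition stat :: "'s \<Rightarrow> real" where "stat t = lim (\<lambda>n. tp n t t)"

lemma stat: "stat t > 0" "(\<lambda>n. tp n t t) \<longlonglongrightarrow> stat t"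
  using tp_self_limit[of t] unfolding stat_def by (metis limI)+

text \<open>Wait for the first visit to \<open>t\<close>, which is certain, and use the limit from
  \<open>t\<close>. Exchanging limit and sum is Tannery's theorem with the majorant
  \<open>fp k s t\<close>.\<close>

lemma tp_limit: "(\<lambda>n. tp n s t) \<longlonglongrightarrow> stat t"
proof -
  let ?a = "\<lambda>k n. if k \<le> Suc n then fp k s t * tp (Suc n - k) t t else 0"
  have "(\<lambda>n. ?a k n) \<longlonglongrightarrow> fp k s t * stat t" for k
  proof -
    have "(\<lambda>n. tp (Suc n - k) t t) \<longlonglongrightarrow> stat t"
      by (rule filterlim_compose[OF stat(2)])
        (rule filterlim_compose[OF filterlim_minus_const_nat_at_top filterlim_Suc])
    hence "(\<lambda>n. fp k s t * tp (Suc n - k) t t) \<longlonglongrightarrow> fp k s t * stat t"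
      by (intro tendsto_intros)
    moreover have "eventually (\<lambda>n. fp k s t * tp (Suc n - k) t t = ?a k n) sequentially"
      using eventually_ge_at_top[of k] by eventually_elim simp
    ultimately show ?thesis using tendsto_cong by fast
  qed
  moreover have "norm (?a k n) \<le> fp k s t" for k n
    using tp_nonneg[of "Suc n - k" t t] tp_le_1[of "Suc n - k" t t] fp_nonneg[of k s t]
    by (auto simp: abs_mult mult_left_le simp del: tp.simps)
  hence "eventually (\<lambda>(k,n). norm (?a k n) \<le> fp k s t) (at_top \<times>\<^sub>F sequentially)"
    by (intro always_eventually) auto
  ultimately have "(\<lambda>n. \<Sum>k. ?a k n) \<longlonglongrightarrow> (\<Sum>k. fp k s t * stat t)"
    using tannerys_theorem[of ?a "\<lambda>k. fp k s t * stat t" sequentially "\<lambda>k. fp k s t"] summable_fp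
    by simp
  moreover have "(\<Sum>k. ?a k n) = tp (Suc n) s t" for n
  proof -
    have "(\<Sum>k. ?a k n) = (\<Sum>k\<le>Suc n. ?a k n)" by (rule suminf_finite) auto
    thus ?thesis unfolding tp_renewal by simp
  qed
  moreover have "(\<Sum>k. fp k s t * stat t) = stat t"
    using hit_eq_1[of s t] suminf_mult2[OF summable_fp[of s t], of "stat t"] by (simp add: hit_def)
  ultimately have "(\<lambda>n. tp (Suc n) s t) \<longlonglongrightarrow> stat t" by (simp del: tp.simps)
  thus ?thesis by (rule LIMSEQ_imp_Suc)
qed

lemma stat_stationary: "stat t = (\<Sum>s | P s t \<noteq> 0. stat s * P s t)"
proof (rule LIMSEQ_unique)
  fix r
  show "(\<lambda>n. tp (Suc n) r t) \<longlonglongrightarrow> stat t" by (rule LIMSEQ_Suc[OF tp_limit])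
  show "(\<lambda>n. tp (Suc n) r t) \<longlonglongrightarrow> (\<Sum>s | P s t \<noteq> 0. stat s * P s t)"
    unfolding tp_forward by (intro tendsto_intros tp_limit)
qed

lemma stat_integrable: "integrable (count_space UNIV) stat"
proof (rule integrable_count_space_boundedI)
  fix F :: "'s set" assume F: "finite F"
  fix s
  have "(\<lambda>n. \<Sum>t\<in>F. tp n s t) \<longlonglongrightarrow> (\<Sum>t\<in>F. stat t)" by (intro tendsto_intros tp_limit)
  thus "(\<Sum>t\<in>F. stat t) \<le> 1" by (rule LIMSEQ_le_const2) (use sum_tp_le_1[OF F] in auto)
qed (use stat in \<open>auto intro: less_imp_le\<close>)

section \<open>One-dimensional laws of a chain with this matrix\<close>

context
  fixes M :: "'a measure" and X :: "nat \<Rightarrow> 'a \<Rightarrow> 's"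
  assumes chain: "markov_chain M P X"
begin

interpretation prob_space M using chain by (simp add: markov_chain_def)

lemma X_meas: "X n \<in> measurable M (count_space UNIV)"
  using chain by (simp add: markov_chain_def)

lemma path_sets: "{\<omega> \<in> space M. \<forall>k\<in>I. X k \<omega> = s k} \<in> sets M" if "finite I"
proof -
  have "{\<omega> \<in> space M. X k \<omega> = s k} \<in> sets M" for k
    using measurable_sets[OF X_meas[of k], of "{s k}"] by (simp add: vimage_def Int_def conj_commute)
  with that show ?thesis by (intro sets.sets_Collect_finite_All)
qed

text \<open>The hypothesis on the chain conditions on the whole history from time 0. Summing out the
  oldest coordinate, one per induction step, leaves the same product rule for histories that begin
  at time \<open>i\<close>; the case \<open>i = n\<close> is the one-step transition rule.\<close>

lemma markov_from:
  assumes "i \<le> n"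
  shows "measure M {\<omega> \<in> space M. \<forall>k\<in>{i..Suc n}. X k \<omega> = s k}
       = measure M {\<omega> \<in> space M. \<forall>k\<in>{i..n}. X k \<omega> = s k} * P (s n) (s (Suc n))"
  using assms
proof (induction i arbitrary: s)
  case 0
  have "measure M {\<omega> \<in> space M. \<forall>k\<le>Suc n. X k \<omega> = s k}
       = measure M {\<omega> \<in> space M. \<forall>k\<le>n. X k \<omega> = s k} * P (s n) (s (Suc n))"
    using chain unfolding markov_chain_def by blast
  thus ?case by (simp add: Ball_def)
next
  case (Suc i)
  \<comment> \<open>\<open>s(i := x)\<close> restores a value at the discarded time
    \<open>i\<close>; total probability sums over \<open>x\<close>.\<close>
  have split: "measure M {\<omega> \<in> space M. \<forall>k\<in>{Suc i..m}. X k \<omega> = s k}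
      = (\<integral>x. measure M {\<omega> \<in> space M. \<forall>k\<in>{i..m}. X k \<omega> = (s(i := x)) k} \<partial>count_space UNIV)"
    if "i \<le> m" for m
  proof -
    have "{\<omega> \<in> {\<omega> \<in> space M. \<forall>k\<in>{Suc i..m}. X k \<omega> = s k}. X i \<omega> = x}
        = {\<omega> \<in> space M. \<forall>k\<in>{i..m}. X k \<omega> = (s(i := x)) k}" for x
    proof -
      have "{i..m} = insert i {Suc i..m}" using that by auto
      thus ?thesis by auto
    qed
    with has_bochner_integral_integral_eq[OF total_probability_countable[OF X_meas[of i] path_sets[of "{Suc i..m}" s]]]
    show ?thesis by simp
  qed
  have "measure M {\<omega> \<in> space M. \<forall>k\<in>{Suc i..Suc n}. X k \<omega> = s k}
      = (\<integral>x. measure M {\<omega> \<in> space M. \<forall>k\<in>{i..n}. X k \<omega> = (s(i := x)) k} * P (s n) (s (Suc n)) \<partial>count_space UNIV)"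
    using Suc.prems by (subst split, simp, subst Suc.IH) auto
  also have "\<dots> = measure M {\<omega> \<in> space M. \<forall>k\<in>{Suc i..n}. X k \<omega> = s k} * P (s n) (s (Suc n))"
    using Suc.prems by (simp add: split)
  finally show ?case .
qed

definition law :: "nat \<Rightarrow> 's \<Rightarrow> real" where
  "law n t = measure M {\<omega> \<in> space M. X n \<omega> = t}"

lemma law_Suc: "law (Suc n) t = (\<Sum>s | P s t \<noteq> 0. law n s * P s t)"
proof -
  have joint: "measure M {\<omega> \<in> {\<omega> \<in> space M. X (Suc n) \<omega> = t}. X n \<omega> = x} = law n x * P x t" for x
  proof -
    have "{n..Suc n} = {n, Suc n}" by auto
    thus ?thesis
      using markov_from[of n n "\<lambda>k. if k = n then x else t"]
      by (simp add: law_def conj_ac)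
  qed
  have "{\<omega> \<in> space M. X (Suc n) \<omega> = t} \<in> sets M"
    using path_sets[of "{Suc n}" "\<lambda>_. t"] by simp
  from has_bochner_integral_integral_eq[OF total_probability_countable[OF X_meas[of n] this]]
  have "law (Suc n) t = (\<integral>x. law n x * P x t \<partial>count_space UNIV)"
    by (simp only: joint) (simp add: law_def)
  also have "\<dots> = (\<Sum>s | P s t \<noteq> 0. law n s * P s t)"
    by (rule integral_count_space_finite_superset) (auto simp: finite_pred)
  finally show ?thesis .
qed

lemma law_integral: "has_bochner_integral (count_space UNIV) (law n) 1"
  using total_probability_countable[OF X_meas[of n] sets.top] prob_space by (simp add: law_def[abs_def])

lemma law_tp_integrable: "integrable (count_space UNIV) (\<lambda>r. law 0 r * tp n r t)"
proof (rule Bochner_Integration.integrable_bound)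
  show "integrable (count_space UNIV) (law 0)" using law_integral by (rule integrable.intros)
  show "AE r in count_space UNIV. norm (law 0 r * tp n r t) \<le> norm (law 0 r)"
    using tp_nonneg tp_le_1 by (auto simp: abs_mult intro!: AE_I2 mult_left_le)
qed simp

lemma law_eq: "law n t = (\<integral>r. law 0 r * tp n r t \<partial>count_space UNIV)"
proof (induction n arbitrary: t)
  case 0
  have "(\<integral>r. law 0 r * tp 0 r t \<partial>count_space UNIV) = (\<Sum>r\<in>{t}. law 0 r * tp 0 r t)"
    by (rule integral_count_space_finite_superset) auto
  thus ?case by simp
next
  case (Suc n)
  have "law (Suc n) t = (\<Sum>s | P s t \<noteq> 0. (\<integral>r. law 0 r * tp n r s * P s t \<partial>count_space UNIV))"
    unfolding law_Suc Suc by simp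
  also have "\<dots> = (\<integral>r. (\<Sum>s | P s t \<noteq> 0. law 0 r * tp n r s * P s t) \<partial>count_space UNIV)"
    by (rule Bochner_Integration.integral_sum[symmetric]) (intro integrable_mult_left law_tp_integrable)
  also have "\<dots> = (\<integral>r. law 0 r * tp (Suc n) r t \<partial>count_space UNIV)"
    unfolding tp_forward by (simp add: sum_distrib_left mult.assoc)
  finally show ?case .
qed

text \<open>Averaging \<open>tp_limit\<close> over the initial law, which serves as the dominating
  function; hence the initial distribution is arbitrary.\<close>

lemma law_limit: "(\<lambda>n. law n t) \<longlonglongrightarrow> stat t"
proof -
  have "(\<lambda>n. \<integral>r. law 0 r * tp n r t \<partial>count_space UNIV) \<longlonglongrightarrow> (\<integral>r. law 0 r * stat t \<partial>count_space UNIV)"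
  proof (rule integral_dominated_convergence)
    show "integrable (count_space UNIV) (law 0)" using law_integral by (rule integrable.intros)
    show "AE r in count_space UNIV. norm (law 0 r * tp n r t) \<le> law 0 r" for n
      using tp_nonneg tp_le_1 by (auto simp: abs_mult law_def intro!: AE_I2 mult_left_le)
  qed (auto intro!: tendsto_intros tp_limit)
  thus ?thesis using has_bochner_integral_integral_eq[OF law_integral[of 0]] by (simp flip: law_eq)
qed

end

end

section \<open>Harmonic functions of Markov additive processes\<close>

lemma count_space_member_le_integral:
  fixes g :: "'a \<Rightarrow> real"
  assumes "integrable (count_space UNIV) g" "\<And>x. g x \<ge> 0"
  shows "g a \<le> (\<integral>x. g x \<partial>count_space UNIV)"
proof -
  have "g a = (\<integral>x. indicator {a} x * g x \<partial>count_space UNIV)"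
    by (subst integral_count_space_finite_superset[of "{a}"]) (auto simp: indicator_def)
  also have "\<dots> \<le> (\<integral>x. g x \<partial>count_space UNIV)"
  proof (rule integral_mono)
    show "integrable (count_space UNIV) (\<lambda>x. indicator {a} x * g x)"
      by (rule Bochner_Integration.integrable_bound[OF assms(1)]) (auto simp: indicator_def)
  qed (use assms in \<open>auto simp: indicator_def\<close>)
  finally show ?thesis .
qed

lemma integral_int_shift:
  fixes g :: "int \<Rightarrow> real"
  shows "(\<integral>l. g (l - s) \<partial>count_space UNIV) = (\<integral>l. g l \<partial>count_space UNIV)"
    and "integrable (count_space UNIV) (\<lambda>l. g (l - s)) \<longleftrightarrow> integrable (count_space UNIV) g"
proof -
  have b: "bij_betw (\<lambda>l. l - s) (UNIV :: int set) UNIV"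
    by (rule bij_betwI[where g = "\<lambda>l. l + s"]) auto
  show "(\<integral>l. g (l - s) \<partial>count_space UNIV) = (\<integral>l. g l \<partial>count_space UNIV)"
    using integral_bij_count_space[OF b, of g] by simp
  show "integrable (count_space UNIV) (\<lambda>l. g (l - s)) \<longleftrightarrow> integrable (count_space UNIV) g"
    using abs_summable_on_reindex_bij_betw[OF b, of g]
    by (simp add: Infinite_Set_Sum.abs_summable_on_def)
qed

text \<open>Each event changes one orbit length by one, so the difference always moves by exactly
  one, while the minimum rises, stays or falls.\<close>

definition edges :: "(nat \<times> int) set" where "edges = {0,1,2} \<times> {-1,1}"

lemma sum_edges:
  fixes F :: "nat \<times> int \<Rightarrow> real"
  shows "(\<Sum>e\<in>edges. F e) = F (0,-1) + F (0,1) + F (1,-1) + F (1,1) + F (2,-1) + F (2,1)"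
proof -
  have eq: "edges = {(0,-1), (0,1), (1,-1), (1,1), (2,-1), (2,1)}" by (auto simp: edges_def)
  show ?thesis unfolding eq by simp
qed

lemma finite_edges [simp]: "finite edges" by (simp add: edges_def)

text \<open>\<open>K (d, s) l\<close> is the stationary flow along the jump from \<open>(m, l)\<close> to \<open>(m + 1 - d, l + s)\<close>;
  with this indexing no natural subtraction occurs in the balance equations.\<close>

locale markov_additive =
  fixes K :: "nat \<times> int \<Rightarrow> int \<Rightarrow> real" and \<phi> :: "int \<Rightarrow> real"
  assumes K_nonneg: "e \<in> edges \<Longrightarrow> K e l \<ge> 0"
    and K_out: "(\<Sum>e\<in>edges. K e l) = \<phi> l"
    and K_in: "(\<Sum>e\<in>edges. K e (l - snd e)) = \<phi> l"
    and \<phi>_integrable: "integrable (count_space UNIV) \<phi>"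
    and K_right: "l \<ge> 0 \<Longrightarrow> K (1, 1) l > 0"
    and K_left: "l \<le> 0 \<Longrightarrow> K (1, -1) l > 0"
    and K_down: "K (2, 1) 0 > 0"
begin

definition \<kappa> :: "nat \<Rightarrow> int \<Rightarrow> real" where "\<kappa> d l = K (d, -1) l + K (d, 1) l"

definition drift :: real where "drift = (\<integral>l. \<kappa> 0 l - \<kappa> 2 l \<partial>count_space UNIV)"

text \<open>Net upward flow of \<open>f\<close> through the cut between levels \<open>m\<close> and
  \<open>m + 1\<close>: upward jumps carry the value at \<open>m\<close>, downward jumps the value
  at \<open>m + 1\<close>. For \<open>f = 1\<close> it is \<open>drift\<close>.\<close>

definition flux :: "(nat \<Rightarrow> int \<Rightarrow> real) \<Rightarrow> nat \<Rightarrow> real" where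
  "flux f m = (\<integral>l. \<kappa> 0 l * f m l - \<kappa> 2 l * f (Suc m) l \<partial>count_space UNIV)"

lemma \<phi>_nonneg: "\<phi> l \<ge> 0"
  unfolding K_out[symmetric] by (intro sum_nonneg K_nonneg)

lemma K_le_\<phi>: "e \<in> edges \<Longrightarrow> K e l \<le> \<phi> l"
  unfolding K_out[symmetric] by (rule member_le_sum) (auto simp: K_nonneg)

lemma \<kappa>_nonneg: "d \<in> {0,1,2} \<Longrightarrow> \<kappa> d l \<ge> 0"
  unfolding \<kappa>_def using K_nonneg[of "(d,-1)" l] K_nonneg[of "(d,1)" l] by (auto simp: edges_def)

lemma \<phi>_eq: "\<phi> l = \<kappa> 0 l + \<kappa> 1 l + \<kappa> 2 l"
  unfolding K_out[symmetric] sum_edges \<kappa>_def by simp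

lemma \<kappa>_le_\<phi>: "d \<in> {0,1,2} \<Longrightarrow> \<kappa> d l \<le> \<phi> l"
  using \<kappa>_nonneg[of 0 l] \<kappa>_nonneg[of 1 l] \<kappa>_nonneg[of 2 l] unfolding \<phi>_eq by auto

lemma integrable_\<phi>_bound:
  assumes "\<And>l. \<bar>g l\<bar> \<le> \<phi> l"
  shows "integrable (count_space UNIV) g"
  using assms \<phi>_nonneg by (intro Bochner_Integration.integrable_bound[OF \<phi>_integrable]) (auto intro!: AE_I2)

context
  fixes f :: "nat \<Rightarrow> int \<Rightarrow> real"
  assumes f01: "\<And>m l. 0 \<le> f m l" "\<And>m l. f m l \<le> 1"
begin

lemma K_f_integrable: "e \<in> edges \<Longrightarrow> integrable (count_space UNIV) (\<lambda>l. K e l * f m l)"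
  using f01 K_nonneg[of e] K_le_\<phi>[of e]
  by (intro integrable_\<phi>_bound) (simp add: abs_mult order.trans[OF mult_left_le])

lemma \<kappa>_f_integrable: "d \<in> {0,1,2} \<Longrightarrow> integrable (count_space UNIV) (\<lambda>l. \<kappa> d l * f m l)"
  using f01 \<kappa>_nonneg[of d] \<kappa>_le_\<phi>[of d]
  by (intro integrable_\<phi>_bound) (simp add: abs_mult order.trans[OF mult_left_le])

lemma \<phi>_f_integrable: "integrable (count_space UNIV) (\<lambda>l. \<phi> l * f m l)"
  using f01 \<phi>_nonneg by (intro integrable_\<phi>_bound) (auto simp: abs_mult intro!: mult_left_le)

lemma in_integrable: "e \<in> edges \<Longrightarrow> integrable (count_space UNIV) (\<lambda>l. K e (l - snd e) * f m (l - snd e))"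
  using K_f_integrable[of e m] integral_int_shift(2)[of "\<lambda>l. K e l * f m l" "snd e"] by simp

text \<open>A discrete divergence theorem. Summed over \<open>l\<close>, the horizontal
  displacements disappear by translation, and only the flows through the cuts below and above level
  \<open>m + 1\<close> survive.\<close>

lemma flux_step:
  "(\<integral>l. (\<Sum>e\<in>edges. K e (l - snd e) * f (m + fst e) (l - snd e)) - \<phi> l * f (Suc m) l \<partial>count_space UNIV)
     = flux f m - flux f (Suc m)" (is "?L = ?R")
proof -
  have "?L = (\<Sum>e\<in>edges. \<integral>l. K e (l - snd e) * f (m + fst e) (l - snd e) \<partial>count_space UNIV)
      - (\<integral>l. \<phi> l * f (Suc m) l \<partial>count_space UNIV)"
    by (subst Bochner_Integration.integral_diff)
      (auto intro!: Bochner_Integration.integrable_sum in_integrable \<phi>_f_integrable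
        simp: Bochner_Integration.integral_sum in_integrable)
  also have "(\<Sum>e\<in>edges. \<integral>l. K e (l - snd e) * f (m + fst e) (l - snd e) \<partial>count_space UNIV)
      = (\<Sum>e\<in>edges. \<integral>l. K e l * f (m + fst e) l \<partial>count_space UNIV)"
  proof (rule sum.cong)
    fix e show "(\<integral>l. K e (l - snd e) * f (m + fst e) (l - snd e) \<partial>count_space UNIV)
      = (\<integral>l. K e l * f (m + fst e) l \<partial>count_space UNIV)"
      using integral_int_shift(1)[of "\<lambda>l. K e l * f (m + fst e) l" "snd e"] .
  qed simp
  also have "\<dots> = (\<integral>l. (\<Sum>e\<in>edges. K e l * f (m + fst e) l) \<partial>count_space UNIV)"
    by (rule Bochner_Integration.integral_sum[symmetric]) (rule K_f_integrable)
  also have "\<dots> = (\<integral>l. \<kappa> 0 l * f m l + \<kappa> 1 l * f (Suc m) l + \<kappa> 2 l * f (Suc (Suc m)) l \<partial>count_space UNIV)"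
    by (rule Bochner_Integration.integral_cong) (auto simp: sum_edges \<kappa>_def algebra_simps)
  also have "\<dots> - (\<integral>l. \<phi> l * f (Suc m) l \<partial>count_space UNIV)
     = (\<integral>l. (\<kappa> 0 l * f m l + \<kappa> 1 l * f (Suc m) l + \<kappa> 2 l * f (Suc (Suc m)) l) - \<phi> l * f (Suc m) l \<partial>count_space UNIV)"
    by (rule Bochner_Integration.integral_diff[symmetric])
      (auto intro!: Bochner_Integration.integrable_add \<kappa>_f_integrable \<phi>_f_integrable)
  also have "\<dots> = (\<integral>l. (\<kappa> 0 l * f m l - \<kappa> 2 l * f (Suc m) l)
      - (\<kappa> 0 l * f (Suc m) l - \<kappa> 2 l * f (Suc (Suc m)) l) \<partial>count_space UNIV)"
    by (rule Bochner_Integration.integral_cong) (auto simp: \<phi>_eq algebra_simps)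
  also have "\<dots> = ?R"
    unfolding flux_def
    by (rule Bochner_Integration.integral_diff)
      (auto intro!: Bochner_Integration.integrable_diff \<kappa>_f_integrable)
  finally show ?thesis .
qed

lemma flux_bounded: "\<bar>flux f m\<bar> \<le> 2 * (\<integral>l. \<phi> l \<partial>count_space UNIV)"
proof -
  have "\<bar>flux f m\<bar> \<le> (\<integral>l. \<bar>\<kappa> 0 l * f m l - \<kappa> 2 l * f (Suc m) l\<bar> \<partial>count_space UNIV)"
    unfolding flux_def by (rule integral_abs_bound)
  also have "\<dots> \<le> (\<integral>l. 2 * \<phi> l \<partial>count_space UNIV)"
  proof (rule integral_mono)
    show "integrable (count_space UNIV) (\<lambda>l. \<bar>\<kappa> 0 l * f m l - \<kappa> 2 l * f (Suc m) l\<bar>)"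
      by (auto intro!: integrable_abs Bochner_Integration.integrable_diff \<kappa>_f_integrable)
    show "\<bar>\<kappa> 0 l * f m l - \<kappa> 2 l * f (Suc m) l\<bar> \<le> 2 * \<phi> l" for l
    proof -
      have "\<kappa> d l * f k l \<in> {0..\<phi> l}" if "d \<in> {0,1,2}" for d k
        using f01[of k l] \<kappa>_nonneg[OF that, of l] \<kappa>_le_\<phi>[OF that, of l] by (simp add: order.trans[OF mult_left_le])
      from this[of 0 m] this[of 2 "Suc m"] show ?thesis by auto
    qed
  qed (intro integrable_mult_right \<phi>_integrable)
  finally show ?thesis by simp
qed

text \<open>Convergence at each fixed \<open>l\<close> suffices, without uniformity, since
  \<open>\<phi>\<close> is a summable majorant.\<close>

lemma flux_tendsto:
  assumes dif: "\<And>l. (\<lambda>m. f m l - f m 0) \<longlonglongrightarrow> 0" and suc: "(\<lambda>m. f (Suc m) 0 - f m 0) \<longlonglongrightarrow> 0"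
  shows "(\<lambda>m. flux f m - drift * f m 0) \<longlonglongrightarrow> 0"
proof -
  have I0: "integrable (count_space UNIV) (\<kappa> d)" if "d \<in> {0,1,2}" for d
    using \<kappa>_nonneg[OF that] \<kappa>_le_\<phi>[OF that] by (intro integrable_\<phi>_bound) simp
  have "flux f m - drift * f m 0
      = (\<integral>l. \<kappa> 0 l * (f m l - f m 0) - \<kappa> 2 l * (f (Suc m) l - f m 0) \<partial>count_space UNIV)" for m
  proof -
    have "drift * f m 0 = (\<integral>l. (\<kappa> 0 l - \<kappa> 2 l) * f m 0 \<partial>count_space UNIV)"
      by (simp add: drift_def)
    hence "flux f m - drift * f m 0 = (\<integral>l. (\<kappa> 0 l * f m l - \<kappa> 2 l * f (Suc m) l)
        - (\<kappa> 0 l - \<kappa> 2 l) * f m 0 \<partial>count_space UNIV)"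
      unfolding flux_def
      by (subst Bochner_Integration.integral_diff)
        (auto intro!: Bochner_Integration.integrable_diff \<kappa>_f_integrable integrable_mult_left I0)
    thus ?thesis by (simp add: algebra_simps)
  qed
  moreover have "(\<lambda>m. \<integral>l. \<kappa> 0 l * (f m l - f m 0) - \<kappa> 2 l * (f (Suc m) l - f m 0) \<partial>count_space UNIV)
      \<longlonglongrightarrow> (\<integral>l. 0 \<partial>(count_space UNIV :: int measure))"
  proof (rule integral_dominated_convergence)
    show "integrable (count_space UNIV) (\<lambda>l. 2 * \<phi> l)" by (intro integrable_mult_right \<phi>_integrable)
    show "AE l in count_space UNIV. (\<lambda>m. \<kappa> 0 l * (f m l - f m 0) - \<kappa> 2 l * (f (Suc m) l - f m 0)) \<longlonglongrightarrow> 0"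
    proof (rule AE_I2)
      fix l
      have "(\<lambda>m. (f (Suc m) l - f (Suc m) 0) + (f (Suc m) 0 - f m 0)) \<longlonglongrightarrow> 0 + 0"
        by (intro tendsto_add suc LIMSEQ_Suc[OF dif])
      hence "(\<lambda>m. f (Suc m) l - f m 0) \<longlonglongrightarrow> 0" by simp
      hence "(\<lambda>m. \<kappa> 0 l * (f m l - f m 0) - \<kappa> 2 l * (f (Suc m) l - f m 0)) \<longlonglongrightarrow> \<kappa> 0 l * 0 - \<kappa> 2 l * 0"
        by (intro tendsto_intros dif)
      thus "(\<lambda>m. \<kappa> 0 l * (f m l - f m 0) - \<kappa> 2 l * (f (Suc m) l - f m 0)) \<longlonglongrightarrow> 0" by simp
    qed
    show "AE l in count_space UNIV. norm (\<kappa> 0 l * (f m l - f m 0) - \<kappa> 2 l * (f (Suc m) l - f m 0)) \<le> 2 * \<phi> l" for m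
    proof (rule AE_I2)
      fix l
      have "\<bar>\<kappa> d l * (f k l - f m 0)\<bar> \<le> \<phi> l" if "d \<in> {0,1,2}" for d k
      proof -
        have "\<bar>f k l - f m 0\<bar> \<le> 1" using f01[of k l] f01[of m 0] by linarith
        thus ?thesis using \<kappa>_nonneg[OF that, of l] \<kappa>_le_\<phi>[OF that, of l]
          by (simp add: abs_mult order.trans[OF mult_left_le])
      qed
      from this[of 0 m] this[of 2 "Suc m"]
      show "norm (\<kappa> 0 l * (f m l - f m 0) - \<kappa> 2 l * (f (Suc m) l - f m 0)) \<le> 2 * \<phi> l" by simp
    qed
  qed auto
  ultimately show ?thesis by simp
qed

end

section \<open>Harmonic functions and a quantitative Jensen inequality\<close>

definition harmonic :: "(nat \<Rightarrow> int \<Rightarrow> real) \<Rightarrow> bool" where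
  "harmonic u \<longleftrightarrow> (\<forall>m l. u m l \<ge> 0 \<and>
     (\<Sum>e\<in>edges. K e (l - snd e) * u (m + fst e) (l - snd e)) = \<phi> l * u (Suc m) l)"

text \<open>Harmonicity writes \<open>u (Suc m) l\<close> as an average over the predecessors of
  \<open>(Suc m, l)\<close>. The Jensen gap of \<open>f\<close> at that point is at least the
  weighted sum of squared differences, and by \<open>flux_step\<close> the gaps of a whole level add
  up to the decrement of the flux. One jump contributes at most the total.\<close>

lemma dissipation:
  assumes u: "harmonic u"
  defines "f \<equiv> \<lambda>m l. 1 / (1 + u m l)"
  assumes e: "e \<in> edges"
  shows "K e l * (f (m + fst e) l - f (Suc m) (l + snd e))\<^sup>2 \<le> flux f m - flux f (Suc m)"
proof -
  have u0: "u m l \<ge> 0" for m l using u by (simp add: harmonic_def)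
  have f01: "0 \<le> f m l" "f m l \<le> 1" for m l using u0[of m l] by (auto simp: f_def)
  define g where "g l = (\<Sum>e\<in>edges. K e (l - snd e) * (f (m + fst e) (l - snd e) - f (Suc m) l)\<^sup>2)" for l
  have g0: "g l \<ge> 0" for l unfolding g_def by (intro sum_nonneg mult_nonneg_nonneg K_nonneg) auto
  have g_le: "g l \<le> (\<Sum>e\<in>edges. K e (l - snd e) * f (m + fst e) (l - snd e)) - \<phi> l * f (Suc m) l" for l
  proof -
    define c where "c = u (Suc m) l"
    have c: "c \<ge> 0" using u0 by (simp add: c_def)
    \<comment> \<open>The right side is the remainder of the tangent to \<open>1 / (1 + x)\<close>
      at \<open>c\<close>, which equals \<open>(a - c)^2 / ((1 + a) * (1 + c)^2)\<close>; a further
      factor \<open>1 + a \<ge> 1\<close> in the denominator makes it the square. The linear term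
      averages to zero by harmonicity.\<close>
    have conv: "(1 / (1 + a) - 1 / (1 + c))\<^sup>2 \<le> 1 / (1 + a) - 1 / (1 + c) + (a - c) / (1 + c)\<^sup>2"
      if a: "a \<ge> 0" for a :: real
    proof -
      have "(1 / (1 + a) - 1 / (1 + c))\<^sup>2 = (a - c)\<^sup>2 / ((1 + a)\<^sup>2 * (1 + c)\<^sup>2)"
        using a c by (simp add: field_simps power2_eq_square)
      also have "\<dots> \<le> (a - c)\<^sup>2 / ((1 + a) * (1 + c)\<^sup>2)"
        using a c by (intro divide_left_mono mult_right_mono) (auto simp: power2_eq_square)
      also have "\<dots> = 1 / (1 + a) - 1 / (1 + c) + (a - c) / (1 + c)\<^sup>2"
      proof -
        have "1 + a \<noteq> 0" "1 + c \<noteq> 0" using a c by auto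
        thus ?thesis by (simp add: divide_simps) (simp add: algebra_simps power2_eq_square)
      qed
      finally show ?thesis .
    qed
    have "g l \<le> (\<Sum>e\<in>edges. K e (l - snd e) * (f (m + fst e) (l - snd e) - f (Suc m) l
        + (u (m + fst e) (l - snd e) - c) / (1 + c)\<^sup>2))"
      unfolding g_def
    proof (intro sum_mono mult_left_mono K_nonneg)
      fix e assume "e \<in> edges"
      show "(f (m + fst e) (l - snd e) - f (Suc m) l)\<^sup>2 \<le> f (m + fst e) (l - snd e) - f (Suc m) l
        + (u (m + fst e) (l - snd e) - c) / (1 + c)\<^sup>2"
        using conv[OF u0[of "m + fst e" "l - snd e"]] unfolding f_def c_def .
    qed
    also have "\<dots> = ((\<Sum>e\<in>edges. K e (l - snd e) * f (m + fst e) (l - snd e)) - (\<Sum>e\<in>edges. K e (l - snd e)) * f (Suc m) l)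
       + ((\<Sum>e\<in>edges. K e (l - snd e) * u (m + fst e) (l - snd e)) - (\<Sum>e\<in>edges. K e (l - snd e)) * c) / (1 + c)\<^sup>2"
      by (simp add: algebra_simps sum.distrib sum_subtractf sum_distrib_left sum_distrib_right
          sum_divide_distrib diff_divide_distrib)
    also have "(\<Sum>e\<in>edges. K e (l - snd e) * u (m + fst e) (l - snd e)) = (\<Sum>e\<in>edges. K e (l - snd e)) * c"
      using u by (simp add: harmonic_def K_in c_def)
    finally show ?thesis by (simp add: K_in)
  qed
  have I: "integrable (count_space UNIV) (\<lambda>l. (\<Sum>e\<in>edges. K e (l - snd e) * f (m + fst e) (l - snd e)) - \<phi> l * f (Suc m) l)"
    by (intro Bochner_Integration.integrable_diff Bochner_Integration.integrable_sum in_integrable \<phi>_f_integrable f01)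
  have Ig: "integrable (count_space UNIV) g"
    using g0 g_le by (intro Bochner_Integration.integrable_bound[OF I]) (auto intro!: AE_I2 order.trans[OF g_le])
  have "K e l * (f (m + fst e) l - f (Suc m) (l + snd e))\<^sup>2
      = K e ((l + snd e) - snd e) * (f (m + fst e) ((l + snd e) - snd e) - f (Suc m) (l + snd e))\<^sup>2" by simp
  also have "\<dots> \<le> g (l + snd e)"
    unfolding g_def
    by (rule member_le_sum[OF e, of "\<lambda>e'. K e' ((l + snd e) - snd e') *
        (f (m + fst e') ((l + snd e) - snd e') - f (Suc m) (l + snd e))\<^sup>2"]) (auto intro!: mult_nonneg_nonneg K_nonneg)
  also have "\<dots> \<le> (\<integral>l. g l \<partial>count_space UNIV)"
    by (rule count_space_member_le_integral[OF Ig g0])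
  also have "\<dots> \<le> (\<integral>l. (\<Sum>e\<in>edges. K e (l - snd e) * f (m + fst e) (l - snd e)) - \<phi> l * f (Suc m) l \<partial>count_space UNIV)"
    by (intro integral_mono Ig I g_le)
  also have "\<dots> = flux f m - flux f (Suc m)" by (rule flux_step[OF f01])
  finally show ?thesis .
qed

text \<open>A decreasing bounded flux has decrements tending to 0, so \<open>f\<close> equalizes
  along every jump with \<open>K > 0\<close>. The jumps of \<open>K_right\<close> and
  \<open>K_left\<close> connect each \<open>l\<close> to 0 within a level, and \<open>K_down\<close>
  connects levels. The lower bound on the flux is kept in the conclusion because the proof that the
  limit of \<open>u\<close> is nonzero needs it.\<close>

lemma reciprocal_limit:
  assumes u: "harmonic u" and drift: "drift > 0"
  defines "f \<equiv> \<lambda>m l. 1 / (1 + u m l)"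
  shows "\<exists>s. (\<forall>l. (\<lambda>m. f m l) \<longlonglongrightarrow> s) \<and> (\<forall>m. drift * s \<le> flux f m)"
proof -
  have u0: "u m l \<ge> 0" for m l using u by (simp add: harmonic_def)
  have f01: "0 \<le> f m l" "f m l \<le> 1" for m l using u0[of m l] by (auto simp: f_def)
  have diss: "K e l * (f (m + fst e) l - f (Suc m) (l + snd e))\<^sup>2 \<le> flux f m - flux f (Suc m)"
    if "e \<in> edges" for e l m
    using dissipation[OF u that, where l=l and m=m] unfolding f_def .
  have "flux f (Suc m) \<le> flux f m" for m
  proof -
    have "0 \<le> K (1,1) 0 * (f (m + fst (1, 1 :: int)) 0 - f (Suc m) (0 + snd (1 :: nat, 1)))\<^sup>2"
      using K_right[of 0] by (intro mult_nonneg_nonneg) auto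
    also have "\<dots> \<le> flux f m - flux f (Suc m)"
      using diss[of "(1,1)" 0 m] by (simp add: edges_def)
    finally show ?thesis by simp
  qed
  hence dec: "decseq (flux f)" by (rule decseq_SucI)
  have "flux f m \<ge> - (2 * (\<integral>l. \<phi> l \<partial>count_space UNIV))" for m
    using flux_bounded[of f m, OF f01] by simp
  then obtain L where L: "flux f \<longlonglongrightarrow> L" "\<And>m. L \<le> flux f m"
    using decseq_convergent[OF dec] by blast
  have edge: "(\<lambda>m. f (m + d) l - f (Suc m) (l + s)) \<longlonglongrightarrow> 0"
    if "K (d, s) l > 0" "(d, s) \<in> edges" for d s l
  proof -
    have "(\<lambda>m. (f (m + d) l - f (Suc m) (l + s))\<^sup>2) \<longlonglongrightarrow> 0"
    proof (rule Lim_null_comparison)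
      have "(\<lambda>m. (flux f m - flux f (Suc m)) / K (d, s) l) \<longlonglongrightarrow> (L - L) / K (d, s) l"
        using that by (intro tendsto_intros L(1) LIMSEQ_Suc[OF L(1)]) simp
      thus "(\<lambda>m. (flux f m - flux f (Suc m)) / K (d, s) l) \<longlonglongrightarrow> 0" by simp
      have "norm ((f (m + d) l - f (Suc m) (l + s))\<^sup>2) \<le> (flux f m - flux f (Suc m)) / K (d, s) l" for m
        using diss[OF that(2), of l m] that(1) by (simp add: pos_le_divide_eq mult.commute)
      thus "eventually (\<lambda>m. norm ((f (m + d) l - f (Suc m) (l + s))\<^sup>2) \<le> (flux f m - flux f (Suc m)) / K (d, s) l) sequentially"
        by (rule always_eventually[OF allI])
    qed
    thus ?thesis by (simp add: power_tendsto_0_iff)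
  qed
  have r: "(\<lambda>m. f m l - f m (l + 1)) \<longlonglongrightarrow> 0" if "l \<ge> 0" for l
    by (rule LIMSEQ_imp_Suc) (use edge[of 1 1 l] K_right[OF that] in \<open>simp add: edges_def\<close>)
  have lft: "(\<lambda>m. f m l - f m (l - 1)) \<longlonglongrightarrow> 0" if "l \<le> 0" for l
    by (rule LIMSEQ_imp_Suc) (use edge[of 1 "-1" l] K_left[OF that] in \<open>simp add: edges_def\<close>)
  have right: "(\<lambda>m. f m (int n) - f m 0) \<longlonglongrightarrow> 0" for n
  proof (induction n)
    case (Suc n)
    from tendsto_diff[OF Suc r[of "int n"]] show ?case by (simp add: add.commute)
  qed simp
  have left: "(\<lambda>m. f m (- int n) - f m 0) \<longlonglongrightarrow> 0" for n
  proof (induction n)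
    case (Suc n)
    have eq: "- int (Suc n) = - int n - 1" by simp
    from tendsto_diff[OF Suc lft[of "- int n"]] show ?case unfolding eq by simp
  qed simp
  have dif: "(\<lambda>m. f m l - f m 0) \<longlonglongrightarrow> 0" for l
    by (cases l rule: int_cases2) (use right left in auto)
  \<comment> \<open>The downward jump from \<open>l = 0\<close> ends at \<open>l = 1\<close> one
    level lower; \<open>dif\<close> at 1 brings it back to \<open>l = 0\<close>, so consecutive
    levels agree in the limit.\<close>
  have "(\<lambda>m. f (Suc (Suc m)) 0 - f (Suc m) 1) \<longlonglongrightarrow> 0"
    using edge[of 2 1 0] K_down by (simp add: edges_def)
  from tendsto_add[OF this LIMSEQ_Suc[OF dif[of 1]]]
  have "(\<lambda>m. f (Suc (Suc m)) 0 - f (Suc m) 0) \<longlonglongrightarrow> 0" by simp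
  hence suc: "(\<lambda>m. f (Suc m) 0 - f m 0) \<longlonglongrightarrow> 0" by (rule LIMSEQ_imp_Suc)
  have "(\<lambda>m. (flux f m - (flux f m - drift * f m 0)) / drift) \<longlonglongrightarrow> (L - 0) / drift"
    using drift by (intro tendsto_intros L(1) flux_tendsto[of f, OF f01 dif suc]) auto
  hence lim0: "(\<lambda>m. f m 0) \<longlonglongrightarrow> L / drift" using drift by simp
  have "(\<lambda>m. f m l) \<longlonglongrightarrow> L / drift" for l
    using tendsto_add[OF dif[of l] lim0] by simp
  with L(2) drift show ?thesis by (intro exI[of _ "L / drift"]) auto
qed

text \<open>A bound at \<open>l = 0\<close> is enough to keep the limit of
  \<open>1 / (1 + u)\<close> away from 0, as that limit does not depend on \<open>l\<close>.
  Integrability is required only for the two terms of the flux through the lowest cut.\<close>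

theorem harmonic_limit:
  assumes u: "harmonic u" and drift: "drift > 0"
    and bound: "\<And>m. u m 0 \<le> B"
    and int0: "integrable (count_space UNIV) (\<lambda>l. \<kappa> 0 l * u 0 l)"
    and int1: "integrable (count_space UNIV) (\<lambda>l. \<kappa> 2 l * u (Suc 0) l)"
    and flux: "flux u 0 > 0"
  shows "\<exists>c>0. \<forall>l. (\<lambda>m. u m l) \<longlonglongrightarrow> c"
proof -
  have u0: "u m l \<ge> 0" for m l using u by (simp add: harmonic_def)
  obtain s where s: "\<And>l. (\<lambda>m. 1 / (1 + u m l)) \<longlonglongrightarrow> s"
    using reciprocal_limit[OF u drift] by blast
  have B0: "B \<ge> 0" using bound[of 0] u0[of 0 0] by linarith
  have "1 / (1 + B) \<le> 1 / (1 + u m 0)" for m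
    using bound[of m] u0[of m 0] B0 by (intro divide_left_mono) auto
  hence "1 / (1 + B) \<le> s" by (intro LIMSEQ_le_const[OF s[of 0]]) auto
  moreover have "1 / (1 + B) > 0" using B0 by simp
  ultimately have s0: "s > 0" by linarith
  define c where "c = 1 / s - 1"
  have lim: "(\<lambda>m. u m l) \<longlonglongrightarrow> c" for l
  proof -
    have "(\<lambda>m. 1 / (1 / (1 + u m l)) - 1) \<longlonglongrightarrow> c"
      unfolding c_def using s0 by (intro tendsto_intros s) auto
    thus ?thesis by simp
  qed
  have c0: "c \<ge> 0" using u0 by (intro LIMSEQ_le_const[OF lim[of 0]]) auto
  have "c \<noteq> 0"
  proof
    assume c: "c = 0"
    \<comment> \<open>concave truncations of \<open>u\<close>: their flux is at most the drift times their limit 0\<close>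
    define g where "g N m l = u m l / (1 + u m l / real (Suc N))" for N m l
    have g: "0 \<le> g N m l" "g N m l \<le> u m l" "g N m l \<le> real (Suc N)" for N m l
      using u0[of m l] by (auto simp: g_def divide_simps algebra_simps)
    have neg: "flux (g N) 0 \<le> 0" for N
    proof -
      define f where "f m l = 1 / (1 + u m l / real (Suc N))" for m l
      have f01: "0 \<le> f m l" "f m l \<le> 1" for m l
        using divide_nonneg_nonneg[OF u0[of m l], of "real (Suc N)"] by (auto simp: f_def simp del: of_nat_Suc)
      have "harmonic (\<lambda>m l. u m l / real (Suc N))"
        using u by (simp add: harmonic_def flip: sum_divide_distrib)
      from reciprocal_limit[OF this drift, folded f_def]
      obtain t where t: "\<And>l. (\<lambda>m. f m l) \<longlonglongrightarrow> t" "\<And>m. drift * t \<le> flux f m" by blast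
      have "(\<lambda>m. f m 0) \<longlonglongrightarrow> 1 / (1 + 0 / real (Suc N))"
        unfolding f_def by (intro tendsto_intros lim[of 0, unfolded c]) auto
      with t(1)[of 0] have "t = 1" by (metis LIMSEQ_unique div_0 add_0_right div_by_1)
      hence "drift \<le> flux f 0" using t(2)[of 0] by simp
      \<comment> \<open>The truncation is an affine function of the reciprocal for the rescaled
        harmonic function \<open>u / real (Suc N)\<close>, so \<open>reciprocal_limit\<close>
        controls its flux; if \<open>u\<close> tends to 0, that reciprocal tends to 1.\<close>
      have gf: "g N m l = real (Suc N) * (1 - f m l)" for m l
        using u0[of m l] by (simp add: g_def f_def divide_simps)
      have I0: "integrable (count_space UNIV) (\<kappa> d)" if "d \<in> {0,1,2}" for d
        using \<kappa>_nonneg[OF that] \<kappa>_le_\<phi>[OF that] by (intro integrable_\<phi>_bound) simp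
      have "flux (g N) 0 = (\<integral>l. real (Suc N) * ((\<kappa> 0 l - \<kappa> 2 l) - (\<kappa> 0 l * f 0 l - \<kappa> 2 l * f (Suc 0) l)) \<partial>count_space UNIV)"
        unfolding flux_def gf by (rule Bochner_Integration.integral_cong) (auto simp: algebra_simps)
      also have "\<dots> = real (Suc N) * (drift - flux f 0)"
        unfolding drift_def flux_def
        by (subst integral_mult_right_zero, subst Bochner_Integration.integral_diff)
          (auto intro!: Bochner_Integration.integrable_diff \<kappa>_f_integrable f01 I0)
      finally show ?thesis using \<open>drift \<le> flux f 0\<close> by (simp add: mult_nonneg_nonpos)
    qed
    have "(\<lambda>N. flux (g N) 0) \<longlonglongrightarrow> flux u 0"
      unfolding flux_def
    proof (rule integral_dominated_convergence)
      show "integrable (count_space UNIV) (\<lambda>l. \<kappa> 0 l * u 0 l + \<kappa> 2 l * u (Suc 0) l)"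
        using int0 int1 by (rule Bochner_Integration.integrable_add)
      show "AE l in count_space UNIV. (\<lambda>N. \<kappa> 0 l * g N 0 l - \<kappa> 2 l * g N (Suc 0) l)
          \<longlonglongrightarrow> \<kappa> 0 l * u 0 l - \<kappa> 2 l * u (Suc 0) l"
      proof (rule AE_I2)
        fix l
        have "(\<lambda>N. g N m l) \<longlonglongrightarrow> u m l" for m
        proof -
          have "(\<lambda>N. u m l / (1 + u m l * inverse (real (Suc N)))) \<longlonglongrightarrow> u m l / (1 + u m l * 0)"
            by (intro tendsto_intros LIMSEQ_inverse_real_of_nat) auto
          thus ?thesis by (simp add: g_def divide_inverse)
        qed
        thus "(\<lambda>N. \<kappa> 0 l * g N 0 l - \<kappa> 2 l * g N (Suc 0) l) \<longlonglongrightarrow> \<kappa> 0 l * u 0 l - \<kappa> 2 l * u (Suc 0) l"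
          by (intro tendsto_intros)
      qed
      show "AE l in count_space UNIV. norm (\<kappa> 0 l * g N 0 l - \<kappa> 2 l * g N (Suc 0) l)
          \<le> \<kappa> 0 l * u 0 l + \<kappa> 2 l * u (Suc 0) l" for N
      proof (rule AE_I2)
        fix l
        have "\<kappa> 0 l * g N 0 l \<in> {0..\<kappa> 0 l * u 0 l}" "\<kappa> 2 l * g N (Suc 0) l \<in> {0..\<kappa> 2 l * u (Suc 0) l}"
          using \<kappa>_nonneg[of 0 l] \<kappa>_nonneg[of 2 l] g by (auto intro!: mult_left_mono)
        thus "norm (\<kappa> 0 l * g N 0 l - \<kappa> 2 l * g N (Suc 0) l) \<le> \<kappa> 0 l * u 0 l + \<kappa> 2 l * u (Suc 0) l" by auto
      qed
    qed auto
    hence "flux u 0 \<le> 0" by (rule LIMSEQ_le_const2) (use neg in auto)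
    with flux show False by simp
  qed
  with c0 lim show ?thesis by (intro exI[of _ c]) auto
qed

end

section \<open>The orbit queue chain\<close>

lemma integrable_inj_comp:
  fixes F :: "'b \<Rightarrow> real"
  assumes "inj g" "integrable (count_space UNIV) F"
  shows "integrable (count_space UNIV) (\<lambda>x. F (g x))"
proof -
  have "Infinite_Set_Sum.abs_summable_on F UNIV"
    using assms(2) by (simp add: Infinite_Set_Sum.abs_summable_on_def)
  hence "Infinite_Set_Sum.abs_summable_on F (range g)"
    by (rule abs_summable_on_subset) simp
  hence "Infinite_Set_Sum.abs_summable_on (\<lambda>x. F (g x)) UNIV"
    by (rule abs_summable_on_reindex_iff[OF assms(1), THEN iffD2])
  thus ?thesis by (simp add: Infinite_Set_Sum.abs_summable_on_def)
qed

lemma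
  fixes F :: "'b \<Rightarrow> real"
  assumes inj: "inj g" and zero: "\<And>y. y \<notin> range g \<Longrightarrow> F y = 0"
  shows integral_inj_comp: "(\<integral>x. F (g x) \<partial>count_space UNIV) = (\<integral>y. F y \<partial>count_space UNIV)"
    and integrable_inj_comp_iff:
      "integrable (count_space UNIV) (\<lambda>x. F (g x)) \<longleftrightarrow> integrable (count_space UNIV) F"
proof -
  have "infsetsum (\<lambda>x. F (g x)) UNIV = infsetsum F (range g)"
    using infsetsum_reindex[OF inj, of F] by simp
  also have "\<dots> = infsetsum F UNIV"
    by (rule infsetsum_cong_neutral) (use zero in auto)
  finally show "(\<integral>x. F (g x) \<partial>count_space UNIV) = (\<integral>y. F y \<partial>count_space UNIV)"
    by (simp add: infsetsum_def)
  have "Infinite_Set_Sum.abs_summable_on (\<lambda>x. F (g x)) UNIV \<longleftrightarrow>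
      Infinite_Set_Sum.abs_summable_on F (range g)"
    by (rule abs_summable_on_reindex_iff[OF inj])
  also have "\<dots> \<longleftrightarrow> Infinite_Set_Sum.abs_summable_on F UNIV"
    by (rule abs_summable_on_cong_neutral) (use zero in auto)
  finally show "integrable (count_space UNIV) (\<lambda>x. F (g x)) \<longleftrightarrow> integrable (count_space UNIV) F"
    by (simp add: Infinite_Set_Sum.abs_summable_on_def)
qed

locale jsoq =
  fixes lam0 lam1 lam2 \<mu> \<alpha>1 \<alpha>2 :: real
  assumes pos: "lam0 > 0" "lam1 > 0" "lam2 > 0" "\<mu> > 0" "\<alpha>1 > 0" "\<alpha>2 > 0"
    and normalized: "lam0 + lam1 + lam2 + \<mu> + \<alpha>1 + \<alpha>2 = 1"
begin

abbreviation lam :: real where "lam \<equiv> lam0 + lam1 + lam2"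

abbreviation P :: "state \<Rightarrow> state \<Rightarrow> real" where "P \<equiv> jsoq_trans lam0 lam1 lam2 \<mu> \<alpha>1 \<alpha>2"

definition arr1 :: "nat \<Rightarrow> nat \<Rightarrow> real" where "arr1 i j = lam1 + lam0 * jsq_h (int j - int i)"
definition arr2 :: "nat \<Rightarrow> nat \<Rightarrow> real" where "arr2 i j = lam2 + lam0 * jsq_h (int i - int j)"

lemma arr_pos: "arr1 i j > 0" "arr2 i j > 0"
  using pos by (auto simp: arr1_def arr2_def jsq_h_def)

lemma arr_sum: "arr1 i j + arr2 i j = lam"
  by (auto simp: arr1_def arr2_def jsq_h_def)

lemma P_nonneg: "P s t \<ge> 0"
proof (cases s)
  case (fields i j c)
  have "\<alpha>1 * of_bool (i > 0) + \<alpha>2 * of_bool (j > 0) + lam \<le> 1"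
    using pos normalized by (auto simp: of_bool_def)
  thus ?thesis using pos arr_pos[of i j] fields
    by (cases c) (auto intro!: add_nonneg_nonneg mult_nonneg_nonneg simp: arr1_def arr2_def)
qed

lemma P_support: "P (i, j, c) (i', j', c') \<noteq> 0 \<Longrightarrow> i' \<le> i + 1 \<and> j' \<le> j + 1 \<and> i \<le> i' + 1 \<and> j \<le> j' + 1"
  by (cases c) (auto split: if_splits simp: of_bool_def)

lemma P_sum_box: "(\<Sum>t\<in>{..i+1} \<times> {..j+1} \<times> UNIV. P (i, j, c) t) = 1"
proof -
  let ?B = "{..i+1} \<times> {..j+1} \<times> (UNIV :: bool set)"
  have B: "(\<Sum>t\<in>?B. a * of_bool (t = x)) = (if x \<in> ?B then a else 0)" for a :: real and x
    by (simp add: of_bool_def if_distrib[of "\<lambda>z. a * z"] sum.delta cong: if_cong)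
  have B': "(\<Sum>t\<in>?B. a * of_bool (b \<and> t = x)) = (if b \<and> x \<in> ?B then a else 0)" for a :: real and b x
    using B[of a x] by (cases b) auto
  show ?thesis
  proof (cases c)
    case True
    hence c: "c = True" by simp
    show ?thesis unfolding c jsoq_trans.simps sum.distrib B B'
      using normalized arr_sum[of i j] by (simp add: arr1_def arr2_def)
  next
    case False
    hence c: "c = False" by simp
    show ?thesis unfolding c jsoq_trans.simps sum.distrib B B' by (auto simp: of_bool_def)
  qed
qed

lemma finite_support:
  "finite {t. P s t \<noteq> 0}" "finite {s. P s t \<noteq> 0}"
proof -
  obtain i j c where s: "s = (i, j, c)" by (cases s)
  have "{t. P s t \<noteq> 0} \<subseteq> {..i+1} \<times> {..j+1} \<times> UNIV" using P_support unfolding s by fastforce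
  thus "finite {t. P s t \<noteq> 0}" by (rule finite_subset) simp
  obtain i j c where t: "t = (i, j, c)" by (cases t)
  have "{s. P s t \<noteq> 0} \<subseteq> {..i+1} \<times> {..j+1} \<times> UNIV" using P_support unfolding t by fastforce
  thus "finite {s. P s t \<noteq> 0}" by (rule finite_subset) simp
qed

sublocale markov_matrix P
proof
  fix s :: state
  obtain i j c where s: "s = (i, j, c)" by (cases s)
  have "(\<Sum>t | P s t \<noteq> 0. P s t) = (\<Sum>t\<in>{..i+1} \<times> {..j+1} \<times> UNIV. P s t)"
    using P_support unfolding s by (intro sum.mono_neutral_left) fastforce+
  thus "(\<Sum>t | P s t \<noteq> 0. P s t) = 1" unfolding s P_sum_box .
qed (rule P_nonneg finite_support)+

lemma P_loop: "P s s > 0"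
proof (cases s)
  case (fields i j c)
  have "\<alpha>1 * of_bool (i > 0) + \<alpha>2 * of_bool (j > 0) + lam < 1"
    using pos normalized by (auto simp: of_bool_def)
  thus ?thesis using fields pos by (cases c) (auto simp: of_bool_def)
qed

lemma irreducible: "(s, t) \<in> {(s, t). P s t > 0}\<^sup>*"
proof -
  let ?R = "{(s, t). P s t > 0}"
  have idle: "((i, j, True), (i, j, False)) \<in> ?R" for i j
    using pos by simp
  have busy: "((i, j, False), (i, j, True)) \<in> ?R" for i j
    using pos by simp
  have up1: "((i, j, True), (Suc i, j, True)) \<in> ?R" for i j
    using arr_pos[of i j] by (simp add: arr1_def)
  have up2: "((i, j, True), (i, Suc j, True)) \<in> ?R" for i j
    using arr_pos[of i j] by (simp add: arr2_def)
  have down1: "((Suc i, j, False), (i, j, True)) \<in> ?R" for i j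
    using pos by simp
  have down2: "((i, Suc j, False), (i, j, True)) \<in> ?R" for i j
    using pos by simp
  \<comment> \<open>All paths go through the busy empty state: each orbit is drained by alternating
    service completions and retrials, then refilled by arrivals during one service.\<close>
  have d1: "((i, j, True), (0, j, True)) \<in> ?R\<^sup>*" for i j
  proof (induction i)
    case (Suc i)
    have "((Suc i, j, True), (i, j, True)) \<in> ?R\<^sup>*"
      using idle down1 by (meson converse_rtrancl_into_rtrancl r_into_rtrancl)
    with Suc show ?case by (rule rtrancl_trans[rotated])
  qed simp
  have d2: "((0, j, True), (0, 0, True)) \<in> ?R\<^sup>*" for j
  proof (induction j)
    case (Suc j)
    have "((0, Suc j, True), (0, j, True)) \<in> ?R\<^sup>*"
      using idle down2 by (meson converse_rtrancl_into_rtrancl r_into_rtrancl)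
    with Suc show ?case by (rule rtrancl_trans[rotated])
  qed simp
  have u1: "((0, 0, True), (i, 0, True)) \<in> ?R\<^sup>*" for i
  proof (induction i)
    case (Suc i)
    from Suc up1[of i 0] show ?case by (rule rtrancl_into_rtrancl)
  qed simp
  have u2: "((i, 0, True), (i, j, True)) \<in> ?R\<^sup>*" for i j
  proof (induction j)
    case (Suc j)
    from Suc up2[of i j] show ?case by (rule rtrancl_into_rtrancl)
  qed simp
  have b: "((i, j, c), (i, j, True)) \<in> ?R\<^sup>*" "((i, j, True), (i, j, c)) \<in> ?R\<^sup>*" for i j c
    using r_into_rtrancl[OF idle[of i j]] r_into_rtrancl[OF busy[of i j]] by (cases c; simp)+
  obtain i j c i' j' c' where st: "s = (i, j, c)" "t = (i', j', c')" by (cases s; cases t)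
  show ?thesis unfolding st
    using rtrancl_trans[OF rtrancl_trans[OF rtrancl_trans[OF b(1) d1] d2]
      rtrancl_trans[OF rtrancl_trans[OF u1 u2] b(2)]] .
qed

definition dep :: "nat \<Rightarrow> nat \<Rightarrow> real" where
  "dep i j = lam + \<alpha>1 * of_bool (i > 0) + \<alpha>2 * of_bool (j > 0)"

text \<open>Probability that a service ends and the idle period that follows is ended by a retrial
  from orbit 1: \<open>dep\<close> is the exit probability from the idle state, and the alternative
  of a fresh arrival returns to the same busy state.\<close>

definition srv1 :: "nat \<Rightarrow> nat \<Rightarrow> real" where "srv1 i j = \<mu> * \<alpha>1 * of_bool (i > 0) / dep i j"
definition srv2 :: "nat \<Rightarrow> nat \<Rightarrow> real" where "srv2 i j = \<mu> * \<alpha>2 * of_bool (j > 0) / dep i j"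

lemma dep_pos: "dep i j > 0"
  using pos by (auto simp: dep_def of_bool_def intro!: add_pos_nonneg)

end

text \<open>Eliminating the idle states turns the stationary law into an invariant measure \<open>q\<close> of a
  nearest-neighbour walk on pairs of orbit lengths.\<close>

locale jsoq_invariant = jsoq +
  fixes q :: "nat \<Rightarrow> nat \<Rightarrow> real"
  assumes q_pos: "q i j > 0"
    and q_integrable: "integrable (count_space UNIV) (\<lambda>(i, j). q i j)"
    and q_balance: "q i j * (lam + srv1 i j + srv2 i j) =
        srv1 (Suc i) j * q (Suc i) j + srv2 i (Suc j) * q i (Suc j)
        + (if i > 0 then arr1 (i - 1) j * q (i - 1) j else 0)
        + (if j > 0 then arr2 i (j - 1) * q i (j - 1) else 0)"

section \<open>The stationary law and its restriction to busy states\<close>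

locale jsoq_recurrent = jsoq +
  assumes rec: "positive_recurrent P"
begin

sublocale ergodic_matrix P
  by unfold_locales (use rec irreducible P_loop in auto)

lemma stat_idle: "stat (i, j, False) * dep i j = \<mu> * stat (i, j, True)"
proof -
  have "stat (i, j, False) = (\<Sum>s | P s (i, j, False) \<noteq> 0. stat s * P s (i, j, False))"
    by (rule stat_stationary)
  also have "\<dots> = (\<Sum>s\<in>{(i, j, False), (i, j, True)}. stat s * P s (i, j, False))"
  proof (rule sum.mono_neutral_left)
    show "{s. P s (i, j, False) \<noteq> 0} \<subseteq> {(i, j, False), (i, j, True)}"
    proof
      fix s assume s: "s \<in> {s. P s (i, j, False) \<noteq> 0}"
      obtain i' j' c' where "s = (i', j', c')" by (cases s)
      with s show "s \<in> {(i, j, False), (i, j, True)}"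
        by (cases c') (auto simp: of_bool_def split: if_splits)
    qed
  qed auto
  finally show ?thesis by (simp add: dep_def algebra_simps)
qed

lemma stat_busy: "(lam + \<mu>) * stat (i, j, True) = lam * stat (i, j, False)
    + \<alpha>1 * stat (Suc i, j, False) + \<alpha>2 * stat (i, Suc j, False)
    + (if i > 0 then arr1 (i - 1) j * stat (i - 1, j, True) else 0)
    + (if j > 0 then arr2 i (j - 1) * stat (i, j - 1, True) else 0)"
proof -
  define S :: "state set" where "S = {(i, j, True), (i, j, False), (Suc i, j, False), (i, Suc j, False)}
    \<union> (if i > 0 then {(i - 1, j, True)} else {}) \<union> (if j > 0 then {(i, j - 1, True)} else {})"
  have "stat (i, j, True) = (\<Sum>s | P s (i, j, True) \<noteq> 0. stat s * P s (i, j, True))"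
    by (rule stat_stationary)
  also have "\<dots> = (\<Sum>s\<in>S. stat s * P s (i, j, True))"
  proof (rule sum.mono_neutral_left)
    show "{s. P s (i, j, True) \<noteq> 0} \<subseteq> S"
    proof
      fix s assume s: "s \<in> {s. P s (i, j, True) \<noteq> 0}"
      obtain i' j' c' where "s = (i', j', c')" by (cases s)
      with s show "s \<in> S"
        by (cases c') (auto simp: S_def of_bool_def split: if_splits)
    qed
  qed (auto simp: S_def)
  also have "\<dots> = stat (i, j, True) * (\<alpha>1 + \<alpha>2) + stat (i, j, False) * lam
     + stat (Suc i, j, False) * \<alpha>1 + stat (i, Suc j, False) * \<alpha>2
     + (if i > 0 then arr1 (i - 1) j * stat (i - 1, j, True) else 0)
     + (if j > 0 then arr2 i (j - 1) * stat (i, j - 1, True) else 0)"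
    by (cases i; cases j) (simp_all add: S_def arr1_def arr2_def algebra_simps)
  finally have "(1 - \<alpha>1 - \<alpha>2) * stat (i, j, True) = lam * stat (i, j, False)
    + \<alpha>1 * stat (Suc i, j, False) + \<alpha>2 * stat (i, Suc j, False)
    + (if i > 0 then arr1 (i - 1) j * stat (i - 1, j, True) else 0)
    + (if j > 0 then arr2 i (j - 1) * stat (i, j - 1, True) else 0)"
    by (simp add: algebra_simps)
  moreover have "1 - \<alpha>1 - \<alpha>2 = lam + \<mu>" using normalized by simp
  ultimately show ?thesis by simp
qed

sublocale jsoq_invariant lam0 lam1 lam2 \<mu> \<alpha>1 \<alpha>2 "\<lambda>i j. stat (i, j, True)"
proof
  show "stat (i, j, True) > 0" for i j by (rule stat)
  show "integrable (count_space UNIV) (\<lambda>(i, j). stat (i, j, True))"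
  proof -
    have "inj (\<lambda>x :: nat \<times> nat. (fst x, snd x, True))" by (auto simp: inj_on_def)
    from integrable_inj_comp[OF this stat_integrable] show ?thesis by (simp add: split_def)
  qed
  fix i j
  have idle: "stat (i, j, False) = \<mu> * stat (i, j, True) / dep i j" for i j
    using stat_idle[of i j] dep_pos[of i j] by (simp add: field_simps)
  have e1: "\<alpha>1 * stat (Suc i, j, False) = srv1 (Suc i) j * stat (Suc i, j, True)"
    by (simp add: idle srv1_def)
  have e2: "\<alpha>2 * stat (i, Suc j, False) = srv2 i (Suc j) * stat (i, Suc j, True)"
    by (simp add: idle srv2_def)
  \<comment> \<open>\<open>\<mu> - lam * \<mu> / dep i j\<close> is the completion probability minus
    that of returning to the same busy state after the idle period.\<close>
  have e: "lam + srv1 i j + srv2 i j = lam + \<mu> - lam * \<mu> / dep i j"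
    using dep_pos[of i j] by (simp add: srv1_def srv2_def field_simps) (simp add: dep_def algebra_simps)
  have "stat (i, j, True) * (lam + srv1 i j + srv2 i j)
     = (lam + \<mu>) * stat (i, j, True) - lam * stat (i, j, False)"
    unfolding e idle by (simp add: algebra_simps)
  thus "stat (i, j, True) * (lam + srv1 i j + srv2 i j) =
     srv1 (Suc i) j * stat (Suc i, j, True) + srv2 i (Suc j) * stat (i, Suc j, True)
     + (if i > 0 then arr1 (i - 1) j * stat (i - 1, j, True) else 0)
     + (if j > 0 then arr2 i (j - 1) * stat (i, j - 1, True) else 0)"
    unfolding stat_busy e1 e2 by simp
qed

end

section \<open>Test functions for the invariant measure\<close>

context jsoq_invariant
begin

lemma arr_le: "arr1 i j \<le> lam" "arr2 i j \<le> lam"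
  using arr_sum[of i j] arr_pos[of i j] by linarith+

lemma lam_le_dep: "lam \<le> dep i j"
  using pos by (simp add: dep_def)

lemma srv_nonneg: "srv1 i j \<ge> 0" "srv2 i j \<ge> 0"
  using pos dep_pos[of i j] by (auto simp: srv1_def srv2_def)

lemma srv_le: "srv1 i j \<le> \<mu> * \<alpha>1 / lam" "srv2 i j \<le> \<mu> * \<alpha>2 / lam"
  using pos lam_le_dep[of i j] dep_pos[of i j]
  by (auto simp: srv1_def srv2_def of_bool_def intro!: divide_left_mono mult_pos_pos)

lemma srv_0 [simp]: "srv1 0 j = 0" "srv2 i 0 = 0"
  by (simp_all add: srv1_def srv2_def)

text \<open>Generator of the walk on busy states. At 0 the truncated \<open>i - 1\<close> is
  harmless, since \<open>srv1 0 j = 0\<close>; likewise for \<open>j\<close>.\<close>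

definition gen :: "(nat \<Rightarrow> nat \<Rightarrow> real) \<Rightarrow> nat \<Rightarrow> nat \<Rightarrow> real" where
  "gen f i j = arr1 i j * (f (Suc i) j - f i j) + arr2 i j * (f i (Suc j) - f i j)
     + srv1 i j * (f (i - 1) j - f i j) + srv2 i j * (f i (j - 1) - f i j)"

abbreviation int2 :: "(nat \<Rightarrow> nat \<Rightarrow> real) \<Rightarrow> bool" where
  "int2 g \<equiv> integrable (count_space UNIV) (\<lambda>(i, j). g i j)"

abbreviation sum2 :: "(nat \<Rightarrow> nat \<Rightarrow> real) \<Rightarrow> real" where
  "sum2 g \<equiv> (\<integral>x. (case x of (i, j) \<Rightarrow> g i j) \<partial>count_space UNIV)"

lemma int2_bound:
  assumes "int2 g" "\<And>i j. \<bar>h i j\<bar> \<le> B * \<bar>g i j\<bar>"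
  shows "int2 h"
proof (rule Bochner_Integration.integrable_bound)
  show "integrable (count_space UNIV) (\<lambda>x. B * (case x of (i, j) \<Rightarrow> \<bar>g i j\<bar>))"
    using integrable_abs[OF assms(1)] by (intro integrable_mult_right) (simp add: split_def)
  show "AE x in count_space UNIV. norm (case x of (i, j) \<Rightarrow> h i j) \<le> norm (B * (case x of (i, j) \<Rightarrow> \<bar>g i j\<bar>))"
    using order.trans[OF assms(2) abs_ge_self] by (auto intro!: AE_I2)
qed simp

lemma int2_coeff:
  assumes "int2 (\<lambda>i j. q i j * g i j)" "\<And>i j. 0 \<le> a i j" "\<And>i j. a i j \<le> B"
  shows "int2 (\<lambda>i j. a i j * q i j * g i j)"
  by (rule int2_bound[OF assms(1), of _ B])
    (use assms q_pos in \<open>auto simp: abs_mult mult.assoc intro!: mult_right_mono\<close>)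

lemma shift1:
  assumes "\<And>j. g 0 j = 0"
  shows "sum2 (\<lambda>i j. g (Suc i) j) = sum2 g" "int2 (\<lambda>i j. g (Suc i) j) \<longleftrightarrow> int2 g"
proof -
  have inj: "inj (\<lambda>x :: nat \<times> nat. (Suc (fst x), snd x))" by (auto simp: inj_on_def)
  have z: "(case y of (i, j) \<Rightarrow> g i j) = 0" if "y \<notin> range (\<lambda>x. (Suc (fst x), snd x))" for y
  proof (cases y)
    case (Pair i j)
    with that assms show ?thesis by (cases i) (auto simp: image_iff)
  qed
  show "sum2 (\<lambda>i j. g (Suc i) j) = sum2 g" "int2 (\<lambda>i j. g (Suc i) j) \<longleftrightarrow> int2 g"
    using integral_inj_comp[where F = "\<lambda>(i, j). g i j", OF inj z]
      integrable_inj_comp_iff[where F = "\<lambda>(i, j). g i j", OF inj z]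
    by (simp_all add: split_def)
qed

lemma shift2:
  assumes "\<And>i. g i 0 = 0"
  shows "sum2 (\<lambda>i j. g i (Suc j)) = sum2 g" "int2 (\<lambda>i j. g i (Suc j)) \<longleftrightarrow> int2 g"
proof -
  have inj: "inj (\<lambda>x :: nat \<times> nat. (fst x, Suc (snd x)))" by (auto simp: inj_on_def)
  have z: "(case y of (i, j) \<Rightarrow> g i j) = 0" if "y \<notin> range (\<lambda>x. (fst x, Suc (snd x)))" for y
  proof (cases y)
    case (Pair i j)
    with that assms show ?thesis by (cases j) (auto simp: image_iff)
  qed
  show "sum2 (\<lambda>i j. g i (Suc j)) = sum2 g" "int2 (\<lambda>i j. g i (Suc j)) \<longleftrightarrow> int2 g"
    using integral_inj_comp[where F = "\<lambda>(i, j). g i j", OF inj z]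
      integrable_inj_comp_iff[where F = "\<lambda>(i, j). g i j", OF inj z]
    by (simp_all add: split_def)
qed

lemma sum2_add: "int2 g \<Longrightarrow> int2 h \<Longrightarrow> sum2 (\<lambda>i j. g i j + h i j) = sum2 g + sum2 h"
  using Bochner_Integration.integral_add[of "count_space UNIV" "\<lambda>(i, j). g i j" "\<lambda>(i, j). h i j"]
  by (simp add: split_def)

lemma sum2_diff: "int2 g \<Longrightarrow> int2 h \<Longrightarrow> sum2 (\<lambda>i j. g i j - h i j) = sum2 g - sum2 h"
  using Bochner_Integration.integral_diff[of "count_space UNIV" "\<lambda>(i, j). g i j" "\<lambda>(i, j). h i j"]
  by (simp add: split_def)

lemma int2_add: "int2 g \<Longrightarrow> int2 h \<Longrightarrow> int2 (\<lambda>i j. g i j + h i j)"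
  using Bochner_Integration.integrable_add[of "count_space UNIV" "\<lambda>(i, j). g i j" "\<lambda>(i, j). h i j"]
  by (simp add: split_def)

lemma int2_diff: "int2 g \<Longrightarrow> int2 h \<Longrightarrow> int2 (\<lambda>i j. g i j - h i j)"
  using Bochner_Integration.integrable_diff[of "count_space UNIV" "\<lambda>(i, j). g i j" "\<lambda>(i, j). h i j"]
  by (simp add: split_def)

lemma int2_cmult: "int2 g \<Longrightarrow> int2 (\<lambda>i j. c * g i j)"
  using integrable_mult_right[of c "count_space UNIV" "\<lambda>(i, j). g i j"] by (simp add: split_def)

lemma sum2_cmult: "sum2 (\<lambda>i j. c * g i j) = c * sum2 g"
  using integral_mult_right_zero[of "count_space UNIV" c "\<lambda>(i, j). g i j"] by (simp add: split_def)

lemma sum2_mono: "int2 g \<Longrightarrow> int2 h \<Longrightarrow> (\<And>i j. g i j \<le> h i j) \<Longrightarrow> sum2 g \<le> sum2 h"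
  by (rule integral_mono) auto

text \<open>Invariance tested against \<open>f\<close>, by moving the translations from
  \<open>q\<close> to \<open>f\<close>. The hypotheses on the translates admit unbounded
  \<open>f\<close>, which the flux through the axes requires.\<close>

lemma weak_balance:
  assumes f: "int2 (\<lambda>i j. q i j * f i j)"
    "int2 (\<lambda>i j. q i j * f (Suc i) j)" "int2 (\<lambda>i j. q i j * f i (Suc j))"
    "int2 (\<lambda>i j. q i j * f (i - 1) j)" "int2 (\<lambda>i j. q i j * f i (j - 1))"
  shows "int2 (\<lambda>i j. q i j * gen f i j)" "sum2 (\<lambda>i j. q i j * gen f i j) = 0"
proof -
  define a1 where "a1 i j = arr1 i j * q i j * f (Suc i) j" for i j
  define a2 where "a2 i j = arr2 i j * q i j * f i (Suc j)" for i j
  define s1 where "s1 i j = srv1 i j * q i j * f (i - 1) j" for i j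
  define s2 where "s2 i j = srv2 i j * q i j * f i (j - 1)" for i j
  define o1 where "o1 i j = (lam + srv1 i j + srv2 i j) * q i j * f i j" for i j
  define b1 where "b1 i j = (if i > 0 then arr1 (i - 1) j * q (i - 1) j else 0) * f i j" for i j
  define b2 where "b2 i j = (if j > 0 then arr2 i (j - 1) * q i (j - 1) else 0) * f i j" for i j
  have I: "int2 a1" "int2 a2" "int2 s1" "int2 s2"
    unfolding a1_def a2_def s1_def s2_def
    by (rule int2_coeff[OF f(2) less_imp_le[OF arr_pos(1)] arr_le(1)]
        int2_coeff[OF f(3) less_imp_le[OF arr_pos(2)] arr_le(2)]
        int2_coeff[OF f(4) srv_nonneg(1) srv_le(1)] int2_coeff[OF f(5) srv_nonneg(2) srv_le(2)])+
  have Io: "int2 o1"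
    unfolding o1_def
    by (rule int2_coeff[OF f(1), of _ "lam + \<mu> * \<alpha>1 / lam + \<mu> * \<alpha>2 / lam"])
      (use srv_le srv_nonneg pos in \<open>auto intro!: add_mono add_nonneg_nonneg\<close>)
  have eq: "q i j * gen f i j = (a1 i j + a2 i j) + (s1 i j + s2 i j) - o1 i j" for i j
  proof -
    have "lam = arr1 i j + arr2 i j" by (simp add: arr_sum)
    thus ?thesis
      unfolding gen_def a1_def a2_def s1_def s2_def o1_def by (simp only:) (simp add: algebra_simps)
  qed
  show "int2 (\<lambda>i j. q i j * gen f i j)"
    unfolding eq by (intro int2_diff int2_add I Io)
  \<comment> \<open>The shifts lose no boundary term: retrial terms vanish on the axis because
    \<open>srv\<close> does, arrival terms because of the case distinction.\<close>
  have S: "sum2 (\<lambda>i j. s1 (Suc i) j) = sum2 s1" "int2 (\<lambda>i j. s1 (Suc i) j) \<longleftrightarrow> int2 s1"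
     "sum2 (\<lambda>i j. s2 i (Suc j)) = sum2 s2" "int2 (\<lambda>i j. s2 i (Suc j)) \<longleftrightarrow> int2 s2"
    by (intro shift1 shift2; simp add: s1_def s2_def)+
  have B: "sum2 (\<lambda>i j. b1 (Suc i) j) = sum2 b1" "int2 (\<lambda>i j. b1 (Suc i) j) \<longleftrightarrow> int2 b1"
     "sum2 (\<lambda>i j. b2 i (Suc j)) = sum2 b2" "int2 (\<lambda>i j. b2 i (Suc j)) \<longleftrightarrow> int2 b2"
    by (intro shift1 shift2; simp add: b1_def b2_def)+
  have "(\<lambda>i j. b1 (Suc i) j) = a1" "(\<lambda>i j. b2 i (Suc j)) = a2"
    by (auto simp: b1_def b2_def a1_def a2_def fun_eq_iff)
  note B = B[unfolded this]
  have "o1 i j = (b1 i j + b2 i j) + (s1 (Suc i) j + s2 i (Suc j))" for i j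
  proof -
    have "o1 i j = q i j * (lam + srv1 i j + srv2 i j) * f i j" by (simp add: o1_def mult_ac)
    thus ?thesis unfolding q_balance by (simp add: b1_def b2_def s1_def s2_def algebra_simps)
  qed
  hence "sum2 o1 = sum2 (\<lambda>i j. (b1 i j + b2 i j) + (s1 (Suc i) j + s2 i (Suc j)))" by simp
  also have "\<dots> = (sum2 a1 + sum2 a2) + (sum2 s1 + sum2 s2)"
    using I B S by (simp add: sum2_add int2_add)
  also have "\<dots> = sum2 (\<lambda>i j. (a1 i j + a2 i j) + (s1 i j + s2 i j))"
    using I by (simp add: sum2_add int2_add)
  finally show "sum2 (\<lambda>i j. q i j * gen f i j) = 0"
    unfolding eq using I Io by (simp add: sum2_diff int2_add)
qed

lemma weak_balance_bounded:
  assumes "\<And>i j. \<bar>f i j\<bar> \<le> B"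
  shows "int2 (\<lambda>i j. q i j * gen f i j)" "sum2 (\<lambda>i j. q i j * gen f i j) = 0"
proof -
  have "int2 (\<lambda>i j. q i j * h i j)" if "\<And>i j. \<bar>h i j\<bar> \<le> B" for h
    by (rule int2_bound[OF q_integrable, of _ B])
      (use that q_pos in \<open>auto simp: abs_mult mult.commute intro!: mult_right_mono\<close>)
  thus "int2 (\<lambda>i j. q i j * gen f i j)" "sum2 (\<lambda>i j. q i j * gen f i j) = 0"
    using assms by (auto intro!: weak_balance)
qed

end

section \<open>Exponential moments and the bound off the axes\<close>

locale jsoq_stable = jsoq_invariant +
  fixes \<rho> :: real
  assumes rho_eq: "\<rho> * (\<mu> * (\<alpha>1 + \<alpha>2)) = lam * (lam + \<alpha>1 + \<alpha>2)"
    and rho_less_1: "\<rho> < 1"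
    and rho1: "lam1 * (lam + \<alpha>1 + \<alpha>2) < \<rho> * (\<mu> * \<alpha>1)"
    and rho2: "lam2 * (lam + \<alpha>1 + \<alpha>2) < \<rho> * (\<mu> * \<alpha>2)"
begin

definition D :: real where "D = lam + \<alpha>1 + \<alpha>2"
definition b :: real where "b = 1 / \<rho>"
definition m1 :: real where "m1 = \<mu> * \<alpha>1 / D"
definition m2 :: real where "m2 = \<mu> * \<alpha>2 / D"

lemma D_pos: "D > 0" using pos by (simp add: D_def)

lemma rho_pos: "\<rho> > 0"
proof (rule ccontr)
  assume "\<not> ?thesis"
  hence "\<rho> * (\<mu> * \<alpha>1) \<le> 0" using pos by (intro mult_nonpos_nonneg) auto
  moreover have "lam1 * (lam + \<alpha>1 + \<alpha>2) > 0" using pos by simp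
  ultimately show False using rho1 by simp
qed

lemma b_gt_1: "b > 1" using rho_pos rho_less_1 by (simp add: b_def)

text \<open>With \<open>m1\<close>, \<open>m2\<close> the retrial rates off the axes, this is the
  defining property of \<rho>: it gives \<open>lam * (b - 1) = (m1 + m2) * (1 - 1 / b)\<close>, so
  \<open>b ^ (i + j)\<close> is harmonic there.\<close>

lemma m_sum: "m1 + m2 = lam * b"
  using rho_eq rho_pos D_pos unfolding m1_def m2_def b_def
  by (simp add: field_simps) (simp add: D_def algebra_simps)

lemma m_pos: "m1 > 0" "m2 > 0" using pos D_pos by (simp_all add: m1_def m2_def)

lemma m_gt: "lam1 * b < m1" "lam2 * b < m2"
  using rho1 rho2 rho_pos D_pos unfolding m1_def m2_def b_def D_def[symmetric] by (simp_all add: field_simps)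

lemma dep_le_D: "dep i j \<le> D" using pos by (auto simp: dep_def D_def of_bool_def)

lemma srv_interior: "i > 0 \<Longrightarrow> j > 0 \<Longrightarrow> srv1 i j = m1" "i > 0 \<Longrightarrow> j > 0 \<Longrightarrow> srv2 i j = m2"
  by (simp_all add: srv1_def srv2_def m1_def m2_def dep_def D_def)

lemma srv_ge: "i > 0 \<Longrightarrow> m1 \<le> srv1 i j" "j > 0 \<Longrightarrow> m2 \<le> srv2 i j"
  unfolding srv1_def srv2_def m1_def m2_def
  using dep_le_D[of i j] dep_pos[of i j] D_pos pos by (auto intro!: divide_left_mono)

text \<open>The total \<open>\<mu> * x / (lam + x)\<close> increases strictly with the available
  retrial rate \<open>x\<close>, and on an axis \<open>x\<close> is smaller than
  \<open>\<alpha>1 + \<alpha>2\<close>. Hence \<open>b ^ (i + j)\<close> has strictly positive drift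
  on the axes.\<close>

lemma srv_less:
  assumes "i = 0 \<or> j = 0"
  shows "srv1 i j + srv2 i j < lam * b"
proof -
  have *: "\<mu> * x / (lam + x) < \<mu> * (\<alpha>1 + \<alpha>2) / D" if "0 \<le> x" "x < \<alpha>1 + \<alpha>2" for x
  proof -
    have "lam * x < lam * (\<alpha>1 + \<alpha>2)" using that pos by (intro mult_strict_left_mono) auto
    moreover have "(\<alpha>1 + \<alpha>2) * (lam + x) - x * D = lam * (\<alpha>1 + \<alpha>2) - lam * x"
      unfolding D_def by (simp add: algebra_simps)
    ultimately have "x * D < (\<alpha>1 + \<alpha>2) * (lam + x)" by linarith
    moreover have "lam + x > 0" using that pos by simp
    ultimately have "x / (lam + x) < (\<alpha>1 + \<alpha>2) / D"
      by (simp only: pos_divide_less_eq times_divide_eq_left pos_less_divide_eq[OF D_pos])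
    hence "\<mu> * (x / (lam + x)) < \<mu> * ((\<alpha>1 + \<alpha>2) / D)" using pos by (intro mult_strict_left_mono) auto
    thus ?thesis by simp
  qed
  have "\<mu> * (\<alpha>1 + \<alpha>2) / D = lam * b" using m_sum
    by (simp add: m1_def m2_def add_divide_distrib distrib_left)
  with *[of 0] *[of \<alpha>1] *[of \<alpha>2] assms pos show ?thesis
    by (cases "i = 0"; cases "j = 0") (auto simp: srv1_def srv2_def dep_def)
qed

text \<open>Off the diagonal only dedicated arrivals feed the longer orbit, and \<open>m_gt\<close>
  makes its drift negative. On the diagonal any arrival raises the maximum and no retrial lowers it,
  so the drift is positive.\<close>

lemma gen_max:
  "i < j \<Longrightarrow> gen (\<lambda>i j. b ^ max i j) i j \<le> - ((1 - 1 / b) * (m2 - lam2 * b)) * b ^ max i j"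
  "j < i \<Longrightarrow> gen (\<lambda>i j. b ^ max i j) i j \<le> - ((1 - 1 / b) * (m1 - lam1 * b)) * b ^ max i j"
  "gen (\<lambda>i j. b ^ max i j) i i = lam * (b - 1) * b ^ i"
proof -
  have pw: "b ^ (n - 1) = b ^ n / b" if "n > 0" for n
    using that b_gt_1 by (cases n) auto
  {
    assume "i < j"
    have "gen (\<lambda>i j. b ^ max i j) i j = lam2 * (b * b ^ j - b ^ j) + srv2 i j * (b ^ j / b - b ^ j)"
    proof -
      have "max i j = j" "max (Suc i) j = j" "max i (Suc j) = Suc j" "max (i - 1) j = j" "max i (j - 1) = j - 1"
        using \<open>i < j\<close> by auto
      thus ?thesis using \<open>i < j\<close> pw[of j] by (simp add: gen_def arr2_def jsq_h_def)
    qed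
    also have "\<dots> = (lam2 * (b - 1) - srv2 i j * (1 - 1 / b)) * b ^ j" by (simp add: algebra_simps)
    also have "\<dots> \<le> (lam2 * (b - 1) - m2 * (1 - 1 / b)) * b ^ j"
      using srv_ge(2)[of j i] \<open>i < j\<close> b_gt_1 by (intro mult_right_mono diff_left_mono) auto
    also have "lam2 * (b - 1) - m2 * (1 - 1 / b) = - ((1 - 1 / b) * (m2 - lam2 * b))"
      using b_gt_1 by (simp add: field_simps)
    finally show "gen (\<lambda>i j. b ^ max i j) i j \<le> - ((1 - 1 / b) * (m2 - lam2 * b)) * b ^ max i j"
      using \<open>i < j\<close> by (simp add: max_def)
  }
  {
    assume "j < i"
    have "gen (\<lambda>i j. b ^ max i j) i j = lam1 * (b * b ^ i - b ^ i) + srv1 i j * (b ^ i / b - b ^ i)"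
    proof -
      have "max i j = i" "max (Suc i) j = Suc i" "max i (Suc j) = i" "max (i - 1) j = i - 1" "max i (j - 1) = i"
        using \<open>j < i\<close> by auto
      thus ?thesis using \<open>j < i\<close> pw[of i] by (simp add: gen_def arr1_def jsq_h_def)
    qed
    also have "\<dots> = (lam1 * (b - 1) - srv1 i j * (1 - 1 / b)) * b ^ i" by (simp add: algebra_simps)
    also have "\<dots> \<le> (lam1 * (b - 1) - m1 * (1 - 1 / b)) * b ^ i"
      using srv_ge(1)[of i j] \<open>j < i\<close> b_gt_1 by (intro mult_right_mono diff_left_mono) auto
    also have "lam1 * (b - 1) - m1 * (1 - 1 / b) = - ((1 - 1 / b) * (m1 - lam1 * b))"
      using b_gt_1 by (simp add: field_simps)
    finally show "gen (\<lambda>i j. b ^ max i j) i j \<le> - ((1 - 1 / b) * (m1 - lam1 * b)) * b ^ max i j"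
      using \<open>j < i\<close> by (simp add: max_def)
  }
  have "gen (\<lambda>i j. b ^ max i j) i i = (arr1 i i + arr2 i i) * (b * b ^ i - b ^ i)"
  proof -
    have "max (i - 1) i = i" "max i (i - 1) = i" by auto
    thus ?thesis by (simp add: gen_def algebra_simps)
  qed
  thus "gen (\<lambda>i j. b ^ max i j) i i = lam * (b - 1) * b ^ i" by (simp add: arr_sum algebra_simps)
qed

lemma gen_sum_power:
  assumes "s > 0"
  shows "gen (\<lambda>i j. s ^ (i + j)) i j = (lam * (s - 1) - (srv1 i j + srv2 i j) * (1 - 1 / s)) * s ^ (i + j)"
proof -
  have 1: "srv1 i j * s ^ (i - 1 + j) = srv1 i j * (s ^ (i + j) / s)"
    using assms by (cases i) auto
  have 2: "srv2 i j * s ^ (i + (j - 1)) = srv2 i j * (s ^ (i + j) / s)"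
    using assms by (cases j) auto
  have "gen (\<lambda>i j. s ^ (i + j)) i j = (arr1 i j + arr2 i j) * (s * s ^ (i + j) - s ^ (i + j))
      + (srv1 i j * s ^ (i - 1 + j) - srv1 i j * s ^ (i + j))
      + (srv2 i j * s ^ (i + (j - 1)) - srv2 i j * s ^ (i + j))"
    unfolding gen_def by (simp add: algebra_simps)
  thus ?thesis unfolding 1 2 arr_sum by (simp add: algebra_simps)
qed

lemma gen_add: "gen (\<lambda>i j. f i j + c * g i j) i j = gen f i j + c * gen g i j"
  by (simp add: gen_def algebra_simps)

text \<open>\<open>b ^ max i j\<close> drifts down off the diagonal since \<open>\<rho>\<^sub>k < \<rho>\<close>; the term \<open>sqrt b ^ (i + j)\<close>,
  of the same size on the diagonal and negligible on the axes, repairs the drift on the diagonal.\<close>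

lemma lyapunov:
  "\<exists>A C e. A \<ge> 0 \<and> e > 0 \<and> C \<ge> 0 \<and>
    (\<forall>i j. gen (\<lambda>i j. b ^ max i j + A * sqrt b ^ (i + j)) i j \<le> C - e * b ^ max i j)"
proof -
  define s where "s = sqrt b"
  have s: "s > 1" "s\<^sup>2 = b" using b_gt_1 by (auto simp: s_def)
  have lam: "lam > 0" using pos by simp
  \<comment> \<open>At \<open>s = sqrt b\<close>, \<open>m_sum\<close> turns the interior drift
    factor of \<open>s ^ (i + j)\<close> into \<open>lam * (s - 1) - lam * s * (s - 1)\<close>, that
    is \<open>- \<kappa>\<close>. \<open>A\<close> is then chosen to leave exactly
    \<open>- (b ^ i)\<close> on the diagonal away from the origin.\<close>
  define \<kappa> where "\<kappa> = lam * (s - 1)\<^sup>2"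
  have \<kappa>: "\<kappa> > 0" using lam s by (simp add: \<kappa>_def)
  define A where "A = (lam * (b - 1) + 1) / \<kappa>"
  have A: "A \<ge> 0" "A * \<kappa> = lam * (b - 1) + 1"
    using \<kappa> lam b_gt_1 by (auto simp: A_def)
  define e1 where "e1 = (1 - 1 / b) * (m1 - lam1 * b)"
  define e2 where "e2 = (1 - 1 / b) * (m2 - lam2 * b)"
  have e12: "e1 > 0" "e2 > 0" using b_gt_1 m_gt by (auto simp: e1_def e2_def)
  \<comment> \<open>Off the diagonal the decay is \<open>2 * e\<close>: one half is kept, the other
    half pays for the correction on the axes.\<close>
  define e where "e = min 1 (min e1 e2) / 2"
  have e: "e > 0" "e \<le> 1" "2 * e \<le> e1" "2 * e \<le> e2" using e12 by (auto simp: e_def)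
  define R where "R = A * (lam * (s - 1))"
  have R: "R \<ge> 0" using A lam s by (simp add: R_def)
  \<comment> \<open>\<open>R\<^sup>2 / (4 * e)\<close> is the maximum of
    \<open>R * w - e * w^2\<close>, used on the axes; the other terms cover the origin, where both
    parts of the test function drift upwards.\<close>
  define C where "C = lam * (b - 1) + R + 1 + R\<^sup>2 / (4 * e)"
  have C: "C \<ge> 0" "C \<ge> R\<^sup>2 / (4 * e)" "C \<ge> lam * (b - 1) + R + e"
  proof -
    have "R\<^sup>2 / (4 * e) \<ge> 0" "lam * (b - 1) \<ge> 0" using e lam b_gt_1 by auto
    thus "C \<ge> 0" "C \<ge> R\<^sup>2 / (4 * e)" "C \<ge> lam * (b - 1) + R + e"
      using R e unfolding C_def by linarith+
  qed
  have int: "gen (\<lambda>i j. s ^ (i + j)) i j = - \<kappa> * s ^ (i + j)" if "i > 0" "j > 0" for i j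
  proof -
    have "lam * (s - 1) - (srv1 i j + srv2 i j) * (1 - 1 / s) = - \<kappa>"
    proof -
      have "srv1 i j + srv2 i j = lam * s\<^sup>2" using srv_interior[OF that] m_sum s by simp
      thus ?thesis using s(1) by (simp add: \<kappa>_def field_simps power2_eq_square)
    qed
    thus ?thesis using gen_sum_power[of s i j] s by simp
  qed
  have bd: "A * gen (\<lambda>i j. s ^ (i + j)) i j \<le> R * s ^ (i + j)" for i j
  proof -
    have "(srv1 i j + srv2 i j) * (1 - 1 / s) \<ge> 0"
      using srv_nonneg[of i j] s by (intro mult_nonneg_nonneg) auto
    hence "gen (\<lambda>i j. s ^ (i + j)) i j \<le> lam * (s - 1) * s ^ (i + j)"
      using s gen_sum_power[of s i j] by (auto intro!: mult_right_mono)
    from mult_left_mono[OF this A(1)] show ?thesis by (simp add: R_def mult_ac)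
  qed
  have off: "gen (\<lambda>i j. b ^ max i j) i j \<le> - (2 * e) * b ^ max i j" if "i \<noteq> j" for i j
  proof (cases "i < j")
    case True
    from gen_max(1)[OF this] have "gen (\<lambda>i j. b ^ max i j) i j \<le> - e2 * b ^ max i j" by (simp add: e2_def)
    also have "\<dots> \<le> - (2 * e) * b ^ max i j" using e b_gt_1 by (intro mult_right_mono) auto
    finally show ?thesis .
  next
    case False
    with that have "j < i" by simp
    from gen_max(2)[OF this] have "gen (\<lambda>i j. b ^ max i j) i j \<le> - e1 * b ^ max i j" by (simp add: e1_def)
    also have "\<dots> \<le> - (2 * e) * b ^ max i j" using e b_gt_1 by (intro mult_right_mono) auto
    finally show ?thesis .
  qed
  have "gen (\<lambda>i j. b ^ max i j + A * s ^ (i + j)) i j \<le> C - e * b ^ max i j" for i j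
  proof -
    let ?G = "b ^ max i j"
    have G0: "?G > 0" using b_gt_1 by simp
    consider "i = j" "i > 0" | "i = 0" "j = 0" | "i \<noteq> j" "i > 0" "j > 0" | "i \<noteq> j" "i = 0 \<or> j = 0" by auto
    thus ?thesis
    proof cases
      case 1
      have "s ^ (i + j) = b ^ i" unfolding s(2)[symmetric] power_mult[symmetric] using 1 by (simp add: mult_2)
      hence "A * gen (\<lambda>i j. s ^ (i + j)) i j = - (A * \<kappa>) * b ^ i" using int[of i j] 1 by simp
      hence "gen (\<lambda>i j. b ^ max i j + A * s ^ (i + j)) i j = - (b ^ i)"
        unfolding gen_add using gen_max(3)[of i] 1 A(2) by (simp add: algebra_simps)
      also have "\<dots> \<le> - (e * b ^ i)" using e b_gt_1 by (simp add: mult_le_cancel_right1)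
      finally show ?thesis using C(1) 1 by simp
    next
      case 2
      thus ?thesis unfolding gen_add using gen_max(3)[of 0] bd[of 0 0] C(3) by simp
    next
      case 3
      have "A * gen (\<lambda>i j. s ^ (i + j)) i j \<le> 0"
        using int[OF 3(2,3)] A \<kappa> s by (simp add: mult_nonneg_nonpos)
      moreover have "e * ?G \<ge> 0" using e G0 by simp
      ultimately show ?thesis unfolding gen_add using off[OF 3(1)] C(1) by simp
    next
      case 4
      \<comment> \<open>On an axis \<open>i + j = max i j\<close>, so the correction is only the
        square root of the main term, and completing the square absorbs it.\<close>
      define w where "w = s ^ max i j"
      have "?G = w\<^sup>2" unfolding w_def s(2)[symmetric] by (simp add: power_mult[symmetric] mult.commute)
      moreover have "s ^ (i + j) = w" using 4 by (auto simp: w_def)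
      ultimately have "gen (\<lambda>i j. b ^ max i j + A * s ^ (i + j)) i j \<le> - (2 * e) * w\<^sup>2 + R * w"
        unfolding gen_add using off[OF 4(1)] bd[of i j] by simp
      also have "\<dots> \<le> R\<^sup>2 / (4 * e) - e * w\<^sup>2"
      proof -
        have "0 \<le> (2 * e * w - R)\<^sup>2" by simp
        hence "R * w * (4 * e) \<le> R\<^sup>2 + 4 * e * e * w\<^sup>2" by (simp add: power2_eq_square algebra_simps)
        thus ?thesis using e(1) by (simp add: field_simps)
      qed
      finally show ?thesis using C(2) \<open>?G = w\<^sup>2\<close> by simp
    qed
  qed
  thus ?thesis using A e C(1) unfolding s_def by blast
qed

text \<open>Truncation from above is concave, so an upper bound on the drift survives below
  \<open>N\<close>, and above \<open>N\<close> the drift is nonpositive. This makes the unbounded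
  Lyapunov function accessible to \<open>weak_balance_bounded\<close>.\<close>

lemma gen_min_le:
  "gen (\<lambda>i j. min (f i j) N) i j \<le> (if f i j \<le> N then gen f i j else 0)"
proof -
  note nn = less_imp_le[OF arr_pos(1)[of i j]] less_imp_le[OF arr_pos(2)[of i j]] srv_nonneg[of i j]
  show ?thesis
  proof (cases "f i j \<le> N")
    case True
    thus ?thesis unfolding gen_def using nn
      by (auto intro!: add_mono mult_left_mono)
  next
    case False
    have "gen (\<lambda>i j. min (f i j) N) i j \<le> 0 + 0 + 0 + 0"
      unfolding gen_def using nn False by (intro add_mono mult_nonneg_nonpos) auto
    thus ?thesis using False by simp
  qed
qed

lemma integrable_max_power: "int2 (\<lambda>i j. q i j * b ^ max i j)"
proof -
  obtain A C e where A: "A \<ge> 0" "e > 0" "C \<ge> 0" and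
    ly: "\<And>i j. gen (\<lambda>i j. b ^ max i j + A * sqrt b ^ (i + j)) i j \<le> C - e * b ^ max i j"
    using lyapunov by blast
  define F where "F i j = b ^ max i j + A * sqrt b ^ (i + j)" for i j
  have F0: "F i j \<ge> 0" for i j using A b_gt_1 by (simp add: F_def)
  show ?thesis
  proof (rule integrable_count_space_boundedI)
    show "0 \<le> (case x of (i, j) \<Rightarrow> q i j * b ^ max i j)" for x
      using q_pos b_gt_1 by (auto simp: split_def intro!: mult_nonneg_nonneg less_imp_le[OF q_pos])
    fix S :: "(nat \<times> nat) set" assume S: "finite S"
    \<comment> \<open>The truncation level is high enough to leave \<open>F\<close> unchanged on
      \<open>S\<close>; the resulting bound \<open>C * sum2 q / e\<close> does not depend on
      \<open>S\<close>.\<close>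
    define N where "N = Max (insert 0 ((\<lambda>(i, j). F i j) ` S))"
    have N: "F i j \<le> N" if "(i, j) \<in> S" for i j
      unfolding N_def using S that by (intro Max_ge) (auto simp: image_iff)
    have N0: "N \<ge> 0" unfolding N_def using S by (intro Max_ge) auto
    define f where "f i j = min (F i j) N" for i j
    have fb: "\<bar>f i j\<bar> \<le> N" for i j using F0[of i j] N0 by (auto simp: f_def)
    let ?h = "\<lambda>i j. (if (i, j) \<in> S then q i j * b ^ max i j else 0)"
    have pt: "q i j * gen f i j \<le> C * q i j - e * ?h i j" for i j
    proof -
      have "gen f i j \<le> C - e * (if (i, j) \<in> S then b ^ max i j else 0)"
        using gen_min_le[of F N i j] ly[of i j] N[of i j] A b_gt_1
        unfolding f_def F_def[symmetric] by (auto split: if_splits intro: order.trans)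
      from mult_left_mono[OF this less_imp_le[OF q_pos[of i j]]] show ?thesis
        by (simp add: algebra_simps split: if_splits)
    qed
    have Ih: "int2 ?h"
    proof -
      have "Infinite_Set_Sum.abs_summable_on (\<lambda>(i, j). ?h i j) UNIV
         \<longleftrightarrow> Infinite_Set_Sum.abs_summable_on (\<lambda>(i, j). ?h i j) S"
        by (rule abs_summable_on_cong_neutral) auto
      thus ?thesis using S by (simp add: Infinite_Set_Sum.abs_summable_on_def[of _ UNIV])
    qed
    have "0 = sum2 (\<lambda>i j. q i j * gen f i j)" using weak_balance_bounded[of f N, OF fb] by simp
    also have "\<dots> \<le> sum2 (\<lambda>i j. C * q i j - e * ?h i j)"
      by (intro sum2_mono weak_balance_bounded[of f N, OF fb] int2_diff int2_cmult Ih q_integrable pt)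
    also have "\<dots> = C * sum2 q - e * sum2 ?h"
      using sum2_diff[OF int2_cmult[OF q_integrable, of C] int2_cmult[OF Ih, of e]] by (simp only: sum2_cmult)
    also have "sum2 ?h = (\<Sum>(i, j)\<in>S. ?h i j)"
      by (rule integral_count_space_finite_superset[OF S]) auto
    also have "\<dots> = (\<Sum>(i, j)\<in>S. q i j * b ^ max i j)"
      by (rule sum.cong) auto
    finally show "(\<Sum>(i, j)\<in>S. q i j * b ^ max i j) \<le> C * sum2 q / e"
      using A by (simp add: field_simps)
  qed
qed

text \<open>The test function is \<open>b ^ (i + j)\<close> frozen from level
  \<open>N = i0 + j0\<close> on. Below \<open>N\<close> it gains only on the axes, by at most
  \<open>lam * (b - 1) * b ^ max i j\<close>; at level \<open>N\<close> the upward steps are lost,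
  so an interior point there has drift \<open>- lam * (b - 1) * b ^ N\<close>. Balancing the two
  bounds \<open>q i0 j0 * b ^ N\<close> by the finite exponential moment.\<close>

lemma interior_bound: "\<exists>B. \<forall>i>0. \<forall>j>0. q i j * b ^ (i + j) \<le> B"
proof (intro exI allI impI)
  fix i0 j0 :: nat assume p: "i0 > 0" "j0 > 0"
  define N where "N = i0 + j0"
  define f where "f i j = b ^ min (i + j) N" for i j
  have b0: "b \<ge> 1" using b_gt_1 by simp
  have fb: "\<bar>f i j\<bar> \<le> b ^ N" for i j
    unfolding f_def using b0 by (auto intro: power_increasing)
  have lam: "lam > 0" using pos by simp
  let ?h = "\<lambda>i j. (if (i, j) = (i0, j0) then q i j * b ^ N else 0)"
  let ?c = "lam * (b - 1)"
  have c0: "?c > 0" using lam b_gt_1 by simp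
  have key: "gen f i j \<le> ?c * b ^ max i j - ?c * (if (i, j) = (i0, j0) then b ^ N else 0)" for i j
  proof -
    have nn: "0 \<le> ?c * b ^ max i j" using c0 b0 by simp
    consider "i + j < N" | "i + j = N" | "i + j > N" by linarith
    thus ?thesis
    proof cases
      case 1
      hence "min (i + j) N = i + j" "min (Suc (i + j)) N = Suc (i + j)" "min (i - 1 + j) N = i - 1 + j"
          "min (i + (j - 1)) N = i + (j - 1)" by auto
      hence "gen f i j = gen (\<lambda>i j. b ^ (i + j)) i j" by (simp add: gen_def f_def)
      also have "\<dots> \<le> ?c * b ^ max i j"
      proof (cases "i = 0 \<or> j = 0")
        case True
        hence m: "max i j = i + j" by auto
        have "(srv1 i j + srv2 i j) * (1 - 1 / b) \<ge> 0"
          using srv_nonneg[of i j] b_gt_1 by (intro mult_nonneg_nonneg) auto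
        thus ?thesis using gen_sum_power[of b i j] b_gt_1 unfolding m by (auto intro!: mult_right_mono)
      next
        case False
        have "lam * (b - 1) - lam * b * (1 - 1 / b) = 0" using b_gt_1 by (simp add: field_simps)
        hence "gen (\<lambda>i j. b ^ (i + j)) i j = 0"
          using gen_sum_power[of b i j] b_gt_1 srv_interior[of i j] m_sum False by simp
        thus ?thesis using nn by simp
      qed
      finally show ?thesis using 1 by (auto simp: N_def)
    next
      case 2
      have d1: "srv1 i j * (f (i - 1) j - f i j) = srv1 i j * (b ^ N / b - b ^ N)"
        using 2 b_gt_1 by (cases i) (auto simp: f_def min_def)
      have d2: "srv2 i j * (f i (j - 1) - f i j) = srv2 i j * (b ^ N / b - b ^ N)"
        using 2 b_gt_1 by (cases j) (auto simp: f_def min_def)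
      have "f (Suc i) j = f i j" "f i (Suc j) = f i j" using 2 by (auto simp: f_def)
      hence g: "gen f i j = (srv1 i j + srv2 i j) * (b ^ N / b - b ^ N)"
        unfolding gen_def d1 d2 by (simp add: algebra_simps)
      show ?thesis
      proof (cases "(i, j) = (i0, j0)")
        case True
        hence "gen f i j = (m1 + m2) * (b ^ N / b - b ^ N)"
          using g srv_interior[of i j] p by simp
        also have "\<dots> = - ?c * b ^ N" unfolding m_sum using b_gt_1 by (simp add: field_simps)
        finally have "gen f i j = - ?c * b ^ N" .
        thus ?thesis using True nn by simp
      next
        case False
        have "b ^ N / b - b ^ N \<le> 0" using b_gt_1 by (simp add: divide_le_eq)
        hence "gen f i j \<le> 0" unfolding g using srv_nonneg[of i j] by (intro mult_nonneg_nonpos) auto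
        thus ?thesis using False nn by auto
      qed
    next
      case 3
      have "srv1 i j * (f (i - 1) j - f i j) = 0"
        by (cases i) (use 3 in \<open>simp_all add: f_def min_absorb2\<close>)
      moreover have "srv2 i j * (f i (j - 1) - f i j) = 0"
        by (cases j) (use 3 in \<open>simp_all add: f_def min_absorb2\<close>)
      moreover have "f (Suc i) j = f i j" "f i (Suc j) = f i j" using 3 by (auto simp: f_def)
      ultimately have "gen f i j = 0"
        unfolding gen_def by (simp only: diff_self mult_zero_right add_0_right)
      thus ?thesis using nn 3 by (auto simp: N_def)
    qed
  qed
  have pt: "q i j * gen f i j \<le> ?c * (q i j * b ^ max i j) - ?c * ?h i j" for i j
  proof -
    have "Q * (c * G - c * (if R then B else 0)) = c * (Q * G) - c * (if R then Q * B else 0)"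
      for Q c G B :: real and R by (simp add: algebra_simps)
    thus ?thesis using mult_left_mono[OF key[of i j] less_imp_le[OF q_pos[of i j]]] by simp
  qed
  have Ih: "int2 ?h"
    by (rule int2_bound[OF q_integrable, of _ "b ^ N"]) (use q_pos b0 in \<open>auto simp: abs_mult\<close>)
  have "0 = sum2 (\<lambda>i j. q i j * gen f i j)" using weak_balance_bounded[of f "b ^ N", OF fb] by simp
  also have "\<dots> \<le> sum2 (\<lambda>i j. ?c * (q i j * b ^ max i j) - ?c * ?h i j)"
    by (intro sum2_mono weak_balance_bounded[of f "b ^ N", OF fb] int2_diff int2_cmult Ih integrable_max_power pt)
  also have "\<dots> = ?c * sum2 (\<lambda>i j. q i j * b ^ max i j) - ?c * sum2 ?h"
    using sum2_diff[OF int2_cmult[OF integrable_max_power, of ?c] int2_cmult[OF Ih, of ?c]] by (simp only: sum2_cmult)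
  also have "sum2 ?h = (\<Sum>(i, j)\<in>{(i0, j0)}. ?h i j)"
    by (rule integral_count_space_finite_superset) (auto split: if_splits)
  finally have "?c * (q i0 j0 * b ^ N) \<le> ?c * sum2 (\<lambda>i j. q i j * b ^ max i j)" by simp
  thus "q i0 j0 * b ^ (i0 + j0) \<le> sum2 (\<lambda>i j. q i j * b ^ max i j)"
    unfolding N_def by (rule mult_left_le_imp_le) (rule c0)
qed

end

section \<open>Levels of the minimum and the flux out of the axes\<close>

context jsoq_stable
begin

definition pt :: "nat \<Rightarrow> int \<Rightarrow> nat \<times> nat" where "pt m l = (m + nat (- l), m + nat l)"

definition Q :: "nat \<Rightarrow> int \<Rightarrow> real" where "Q m l = (case pt m l of (i, j) \<Rightarrow> q i j)"

text \<open>Rate at which the minimum rises: an arrival at the shorter orbit, smart or dedicated. In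
  a tie no single arrival raises it, whereas either retrial lowers it in \<open>dn\<close>.\<close>

definition up :: "int \<Rightarrow> real" where
  "up l = (if l > 0 then lam0 + lam1 else if l < 0 then lam0 + lam2 else 0)"

definition dn :: "int \<Rightarrow> real" where
  "dn l = (if l > 0 then m1 else if l < 0 then m2 else m1 + m2)"

lemma inj_pt: "inj (pt m)" by (auto simp: inj_on_def pt_def)

lemma range_pt: "(i, j) \<in> range (pt m) \<longleftrightarrow> min i j = m"
proof
  assume "min i j = m"
  hence "(i, j) = pt m (int j - int i)" by (auto simp: pt_def min_def split: if_splits)
  thus "(i, j) \<in> range (pt m)" by blast
qed (auto simp: pt_def min_def)

text \<open>The test function is \<open>b ^ (i + j)\<close> restricted to the axes. Weak balance
  says that what it gains on level 0, less the loss \<open>U\<close> to level 1, plus the return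
  \<open>V\<close> from level 1, is zero; so the net flux equals the gain, which
  \<open>srv_less\<close> makes positive.\<close>

lemma boundary_flux:
  defines "U \<equiv> \<lambda>l. up l * b ^ Suc (nat \<bar>l\<bar>) * Q 0 l"
    and "V \<equiv> \<lambda>l. dn l * b ^ Suc (nat \<bar>l\<bar>) * Q 1 l"
  shows "integrable (count_space UNIV) U" "integrable (count_space UNIV) V"
    "(\<integral>l. U l - V l \<partial>count_space UNIV) > 0"
proof -
  define f where "f i j = (if i = 0 \<or> j = 0 then b ^ max i j else 0)" for i j :: nat
  have b1: "b \<ge> 1" using b_gt_1 by simp
  \<comment> \<open>Every one-step translate of \<open>f\<close> is at most
    \<open>b ^ Suc (max i j)\<close>, so the exponential moment supplies all integrability demanded
    by \<open>weak_balance\<close>.\<close>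
  have sh: "int2 (\<lambda>i j. q i j * g i j)" if "\<And>i j. 0 \<le> g i j" "\<And>i j. g i j \<le> b ^ Suc (max i j)" for g
    by (rule int2_bound[OF integrable_max_power, of _ b])
      (use that q_pos b1 in \<open>auto simp: abs_mult mult.left_commute less_imp_le intro!: mult_left_mono\<close>)
  have f0: "f i j \<ge> 0" for i j using b1 by (simp add: f_def)
  have fle: "f i j \<le> b ^ Suc (max i' j')" if "max i j \<le> Suc (max i' j')" for i j i' j'
    using power_increasing[OF that b1] b1 by (auto simp: f_def simp del: power_Suc)
  note wb = weak_balance[of f, OF sh[OF f0 fle] sh[OF f0 fle] sh[OF f0 fle] sh[OF f0 fle] sh[OF f0 fle]]
  have I: "int2 (\<lambda>i j. q i j * gen f i j)" and Z: "sum2 (\<lambda>i j. q i j * gen f i j) = 0"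
    by (rule wb; auto)+
  define h where "h m i j = (if min i j = m then q i j * gen f i j else 0)" for m i j
  have Ih: "int2 (h m)" for m
    by (rule int2_bound[OF I, of _ 1]) (auto simp: h_def)
  have far: "gen f i j = 0" if "min i j \<ge> 2" for i j
    using that by (auto simp: gen_def f_def)
  have "q i j * gen f i j = h 0 i j + h 1 i j" for i j
    using far[of i j] by (cases "min i j \<ge> 2") (auto simp: h_def)
  hence sum0: "sum2 (h 0) + sum2 (h 1) = 0"
    using Z sum2_add[OF Ih[of 0] Ih[of 1]] by simp
  have hz: "(case y of (i, j) \<Rightarrow> h m i j) = 0" if "y \<notin> range (pt m)" for y m
    using that range_pt[of "fst y" "snd y" m] by (auto simp: h_def split_def)
  have hpt: "(case pt m l of (i, j) \<Rightarrow> h m i j) = Q m l * (case pt m l of (i, j) \<Rightarrow> gen f i j)" for m l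
    by (auto simp: h_def Q_def pt_def min_def)
  have S: "(\<integral>l. Q m l * (case pt m l of (i, j) \<Rightarrow> gen f i j) \<partial>count_space UNIV) = sum2 (h m)" for m
    using integral_inj_comp[where F = "\<lambda>(i, j). h m i j", OF inj_pt[of m] hz] by (simp add: hpt)
  have S': "integrable (count_space UNIV) (\<lambda>l. Q m l * (case pt m l of (i, j) \<Rightarrow> gen f i j))" for m
    using integrable_inj_comp[OF inj_pt[of m] Ih[of m]] by (simp add: hpt)
  define r where "r l = (case pt 0 l of (i, j) \<Rightarrow> gen (\<lambda>i j. b ^ (i + j)) i j)" for l
  have r_pos: "r l > 0" for l
  proof -
    have "0 \<le> l \<or> l \<le> 0" by linarith
    then obtain i j where p: "pt 0 l = (i, j)" "i = 0 \<or> j = 0" by (auto simp: pt_def)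
    have "(srv1 i j + srv2 i j) * (1 - 1 / b) < lam * b * (1 - 1 / b)"
      using srv_less[OF p(2)] b_gt_1 by (intro mult_strict_right_mono) auto
    also have "\<dots> = lam * (b - 1)" using b_gt_1 by (simp add: field_simps)
    finally show ?thesis using gen_sum_power[of b i j] b_gt_1 by (simp add: r_def p(1))
  qed
  \<comment> \<open>Compared with the unrestricted power, only the arrivals that leave the axis are
    missing.\<close>
  have lvl0: "(case pt 0 l of (i, j) \<Rightarrow> gen f i j) = r l - up l * b ^ Suc (nat \<bar>l\<bar>)" for l
  proof (cases l rule: int_cases3)
    case zero
    thus ?thesis by (simp add: pt_def r_def up_def gen_def f_def)
  next
    case (pos n)
    thus ?thesis by (simp add: pt_def r_def up_def gen_def f_def arr1_def jsq_h_def algebra_simps)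
  next
    case (neg n)
    thus ?thesis by (simp add: pt_def r_def up_def gen_def f_def arr2_def jsq_h_def algebra_simps)
  qed
  have lvl1: "(case pt 1 l of (i, j) \<Rightarrow> gen f i j) = dn l * b ^ Suc (nat \<bar>l\<bar>)" for l
  proof (cases l rule: int_cases3)
    case zero
    thus ?thesis using srv_interior[of 1 1] by (simp add: pt_def dn_def gen_def f_def algebra_simps)
  next
    case (pos n)
    thus ?thesis using srv_interior[of 1 "Suc n"] by (simp add: pt_def dn_def gen_def f_def)
  next
    case (neg n)
    thus ?thesis using srv_interior[of "Suc n" 1] by (simp add: pt_def dn_def gen_def f_def)
  qed
  have Qpos: "Q m l > 0" for m l using q_pos by (simp add: Q_def split_def)
  have VV: "V = (\<lambda>l. Q 1 l * (case pt 1 l of (i, j) \<Rightarrow> gen f i j))"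
    by (simp only: V_def lvl1 mult.commute)
  show IV: "integrable (count_space UNIV) V"
    unfolding VV by (rule S')
  have IQ: "integrable (count_space UNIV) (\<lambda>l. Q 0 l * b ^ nat \<bar>l\<bar>)"
  proof -
    have "(case pt 0 l of (i, j) \<Rightarrow> q i j * b ^ max i j) = Q 0 l * b ^ nat \<bar>l\<bar>" for l
      by (cases l rule: int_cases3) (simp_all add: pt_def Q_def)
    thus ?thesis using integrable_inj_comp[OF inj_pt[of 0] integrable_max_power] by simp
  qed
  have "U l = (up l * b) * (Q 0 l * b ^ nat \<bar>l\<bar>)" for l by (simp add: U_def)
  moreover have "\<bar>up l * b\<bar> \<le> lam * b" for l using pos b1 by (auto simp: up_def abs_mult)
  ultimately have Ub: "\<bar>U l\<bar> \<le> lam * b * \<bar>Q 0 l * b ^ nat \<bar>l\<bar>\<bar>" for l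
    by (simp only: abs_mult[of "up l * b"] mult_right_mono abs_ge_zero)
  show IU: "integrable (count_space UNIV) U"
    by (rule Bochner_Integration.integrable_bound[OF integrable_mult_right[OF IQ, of "lam * b"]])
      (use Ub pos b1 in \<open>auto simp: abs_mult intro!: AE_I2\<close>)
  have e0: "Q 0 l * r l = Q 0 l * (case pt 0 l of (i, j) \<Rightarrow> gen f i j) + U l" for l
    by (simp add: lvl0 U_def algebra_simps)
  have IR: "integrable (count_space UNIV) (\<lambda>l. Q 0 l * r l)"
    unfolding e0 using S'[of 0] IU by (rule Bochner_Integration.integrable_add)
  have "(\<integral>l. Q 0 l * r l \<partial>count_space UNIV) = sum2 (h 0) + (\<integral>l. U l \<partial>count_space UNIV)"
    unfolding e0 using S'[of 0] IU by (subst Bochner_Integration.integral_add) (auto simp: S)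
  moreover have "(\<integral>l. V l \<partial>count_space UNIV) = sum2 (h 1)"
    unfolding VV by (rule S)
  ultimately have "(\<integral>l. U l - V l \<partial>count_space UNIV) = (\<integral>l. Q 0 l * r l \<partial>count_space UNIV)"
    using sum0 IU IV by simp
  also have "\<dots> \<ge> Q 0 0 * r 0"
    by (rule count_space_member_le_integral[OF IR]) (use Qpos r_pos in \<open>auto intro!: mult_nonneg_nonneg less_imp_le\<close>)
  finally show "(\<integral>l. U l - V l \<partial>count_space UNIV) > 0"
    using mult_pos_pos[OF Qpos[of 0 0] r_pos[of 0]] by linarith
qed

end

section \<open>Geometric decay\<close>

lemma integrable_geometric_int:
  fixes t :: real
  assumes "0 \<le> t" "t < 1"
  shows "integrable (count_space UNIV) (\<lambda>l::int. t ^ nat \<bar>l\<bar>)"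
proof -
  have s: "Infinite_Set_Sum.abs_summable_on (\<lambda>n::nat. t ^ n) UNIV"
    using assms by (simp add: abs_summable_on_nat_iff' summable_geometric)
  have "Infinite_Set_Sum.abs_summable_on (\<lambda>l. t ^ nat \<bar>l\<bar>) (range int)"
    by (rule abs_summable_on_reindex_iff[THEN iffD1]) (use s in auto)
  moreover have "Infinite_Set_Sum.abs_summable_on (\<lambda>l. t ^ nat \<bar>l\<bar>) (range (\<lambda>n. - int n))"
    by (rule abs_summable_on_reindex_iff[THEN iffD1]) (use s in \<open>auto simp: inj_on_def\<close>)
  ultimately have "Infinite_Set_Sum.abs_summable_on (\<lambda>l. t ^ nat \<bar>l\<bar>) (range int \<union> range (\<lambda>n. - int n))"
    by (rule abs_summable_on_union)
  moreover have "range int \<union> range (\<lambda>n. - int n) = UNIV"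
    by (auto simp: image_iff) (metis int_cases2)
  ultimately show ?thesis by (simp add: Infinite_Set_Sum.abs_summable_on_def)
qed

text \<open>\<open>g1\<close> and \<open>g2\<close> are \<open>\<gamma>1\<close> and
  \<open>\<gamma>2\<close> divided by \<open>lam + \<alpha>1 + \<alpha>2\<close>;
  \<open>pooled\<close> makes both geometric ratios in \<open>w\<close> less than 1.\<close>

locale jsoq_pooled = jsoq_stable +
  fixes g1 g2 :: real
  assumes g1: "g1 = m1 * \<rho>\<^sup>2 + lam2" and g2: "g2 = m2 * \<rho>\<^sup>2 + lam1"
    and pooled: "g1 < g2 + lam0" "g2 < g1 + lam0"
begin

lemma g_pos: "g1 > 0" "g2 > 0"
  using m_pos rho_pos pos by (auto simp: g1 g2 intro!: add_pos_pos mult_pos_pos)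

lemma b_rho: "b * \<rho> = 1" using rho_pos by (simp add: b_def)

text \<open>The limit vector without the factors \<open>x0\<close> and
  \<open>\<rho> ^ nat \<bar>l\<bar>\<close>. It is the reversible measure of the difference process
  under the transformed rates, normalized at 0; the halves of \<open>lam0\<close> come from the
  tie-breaking at \<open>l = 0\<close>.\<close>

definition w :: "int \<Rightarrow> real" where
  "w l = (if l > 0 then (g1 + lam0 / 2) / g1 * (g1 / (g2 + lam0)) ^ nat \<bar>l\<bar>
     else if l < 0 then (g2 + lam0 / 2) / g2 * (g2 / (g1 + lam0)) ^ nat \<bar>l\<bar> else 1)"

lemma w_pos: "w l > 0"
  using g_pos pos unfolding w_def by (auto intro!: mult_pos_pos divide_pos_pos zero_less_power add_pos_pos)

lemma w_0 [simp]: "w 0 = 1" by (simp add: w_def)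

lemma w_integrable: "integrable (count_space UNIV) w"
proof -
  define t where "t = max (g1 / (g2 + lam0)) (g2 / (g1 + lam0))"
  define A where "A = max 1 (max ((g1 + lam0 / 2) / g1) ((g2 + lam0 / 2) / g2))"
  have t: "0 \<le> t" "t < 1" using pooled g_pos pos by (auto simp: t_def max_def)
  define r1 r2 c1 c2 where rc: "r1 = g1 / (g2 + lam0)" "r2 = g2 / (g1 + lam0)"
    "c1 = (g1 + lam0 / 2) / g1" "c2 = (g2 + lam0 / 2) / g2"
  have le: "0 \<le> r1" "0 \<le> r2" "r1 \<le> t" "r2 \<le> t" "c1 \<le> A" "c2 \<le> A" "1 \<le> A"
    using g_pos pos by (auto simp: rc t_def A_def)
  have "w l = (if l > 0 then c1 * r1 ^ nat \<bar>l\<bar> else if l < 0 then c2 * r2 ^ nat \<bar>l\<bar> else 1)" for l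
    by (simp add: w_def rc)
  hence "w l \<le> A * t ^ nat \<bar>l\<bar>" for l
    using le by (auto intro!: mult_mono power_mono)
  from order.trans[OF this abs_ge_self]
  have "norm (w l) \<le> norm (A * t ^ nat \<bar>l\<bar>)" for l
    by (simp only: real_norm_def abs_of_pos[OF w_pos])
  thus ?thesis
    by (intro Bochner_Integration.integrable_bound[OF integrable_mult_right[OF integrable_geometric_int[OF t], of A]])
      (auto intro!: AE_I2)
qed

lemma w_balance_right:
  assumes "l \<ge> 0"
  shows "w l * (g1 + (if l = 0 then lam0 / 2 else 0)) = w (l + 1) * (g2 + lam0)"
proof (cases "l = 0")
  case True
  thus ?thesis using g_pos pos by (simp add: w_def)
next
  case False
  hence "nat \<bar>l + 1\<bar> = Suc (nat \<bar>l\<bar>)" using assms by simp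
  thus ?thesis using False assms g_pos pos by (simp add: w_def)
qed

lemma w_balance_left:
  assumes "l \<le> 0"
  shows "w l * (g2 + (if l = 0 then lam0 / 2 else 0)) = w (l - 1) * (g1 + lam0)"
proof (cases "l = 0")
  case True
  thus ?thesis using g_pos pos by (simp add: w_def)
next
  case False
  hence "nat \<bar>l - 1\<bar> = Suc (nat \<bar>l\<bar>)" using assms by simp
  thus ?thesis using False assms g_pos pos by (simp add: w_def)
qed

text \<open>\<open>rate (d, s) l\<close> belongs to the jump from \<open>(m, l)\<close> to \<open>(m + 1 - d, l + s)\<close>, after the change
  of measure by \<open>\<rho>\<^sup>-\<^sup>(\<^sup>i\<^sup>+\<^sup>j\<^sup>)\<close>.\<close>

definition rate :: "nat \<times> int \<Rightarrow> int \<Rightarrow> real" where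
  "rate e l =
    (if e = (1, 1) then (if l > 0 then lam2 * b else if l = 0 then (lam2 + lam0 / 2) * b else m1 * \<rho>)
     else if e = (1, -1) then (if l < 0 then lam1 * b else if l = 0 then (lam1 + lam0 / 2) * b else m2 * \<rho>)
     else if e = (2, 1) then (if l \<ge> 0 then m1 * \<rho> else 0)
     else if e = (2, -1) then (if l \<le> 0 then m2 * \<rho> else 0)
     else if e = (0, -1) then (if l > 0 then (lam0 + lam1) * b else 0)
     else if e = (0, 1) then (if l < 0 then (lam0 + lam2) * b else 0)
     else 0)"

definition K :: "nat \<times> int \<Rightarrow> int \<Rightarrow> real" where "K e l = w l * rate e l"

definition tot :: real where "tot = lam * b + lam"

lemma m_rho: "m1 * \<rho> + m2 * \<rho> = lam"
  using m_sum b_rho by (metis distrib_right mult.assoc mult.right_neutral)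

lemma tot_eq: "tot = (g1 + g2 + lam0) * b"
proof -
  have "(g1 + g2 + lam0) * b = (m1 * \<rho> + m2 * \<rho>) * (b * \<rho>) + lam * b"
    by (simp add: g1 g2 algebra_simps power2_eq_square)
  thus ?thesis by (simp add: m_rho b_rho tot_def)
qed

lemma tot_pos: "tot > 0" using pos b_gt_1 by (simp add: tot_def add_pos_pos)

lemma g_b: "g1 * b = m1 * \<rho> + lam2 * b" "g2 * b = m2 * \<rho> + lam1 * b"
proof -
  have "g1 * b = m1 * \<rho> * (b * \<rho>) + lam2 * b" "g2 * b = m2 * \<rho> * (b * \<rho>) + lam1 * b"
    by (simp_all add: g1 g2 algebra_simps power2_eq_square)
  thus "g1 * b = m1 * \<rho> + lam2 * b" "g2 * b = m2 * \<rho> + lam1 * b" by (simp_all add: b_rho)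
qed

text \<open>Harmonicity of \<open>b ^ (i + j)\<close> in terms of rates: the change of measure
  exchanges the totals of arrivals and retrials, \<open>lam\<close> and \<open>lam * b\<close>, and
  preserves their sum.\<close>

lemma rate_out: "(\<Sum>e\<in>edges. rate e l) = tot"
proof -
  consider "l > 0" | "l = 0" | "l < 0" by linarith
  thus ?thesis
  proof cases
    case 1
    hence "(\<Sum>e\<in>edges. rate e l) = lam * b + (m1 * \<rho> + m2 * \<rho>)"
      unfolding sum_edges by (simp add: rate_def algebra_simps)
    thus ?thesis by (simp only: m_rho tot_def)
  next
    case 2
    hence "(\<Sum>e\<in>edges. rate e l) = lam * b + (m1 * \<rho> + m2 * \<rho>)"
      unfolding sum_edges by (simp add: rate_def algebra_simps)
    thus ?thesis by (simp only: m_rho tot_def)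
  next
    case 3
    hence "(\<Sum>e\<in>edges. rate e l) = lam * b + (m1 * \<rho> + m2 * \<rho>)"
      unfolding sum_edges by (simp add: rate_def algebra_simps)
    thus ?thesis by (simp only: m_rho tot_def)
  qed
qed

lemma rate_right: "l \<ge> 0 \<Longrightarrow> rate (1, 1) l + rate (2, 1) l = (g1 + (if l = 0 then lam0 / 2 else 0)) * b"
  "l > 0 \<Longrightarrow> rate (0, -1) l + rate (1, -1) l = (g2 + lam0) * b"
  by (auto simp: rate_def distrib_right g_b)

lemma rate_left: "l \<le> 0 \<Longrightarrow> rate (1, -1) l + rate (2, -1) l = (g2 + (if l = 0 then lam0 / 2 else 0)) * b"
  "l < 0 \<Longrightarrow> rate (0, 1) l + rate (1, 1) l = (g1 + lam0) * b"
  by (auto simp: rate_def distrib_right g_b)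

text \<open>Stationarity from detailed balance: the inflow from each neighbour of \<open>l\<close>
  equals the outflow towards it, by the cut equations \<open>w_balance_right\<close> and
  \<open>w_balance_left\<close>.\<close>

lemma rate_in: "(\<Sum>e\<in>edges. K e (l - snd e)) = tot * w l"
proof -
  have right: "K (0,-1) (l+1) + K (1,-1) (l+1) + K (2,-1) (l+1) = w l * (g1 + (if l = 0 then lam0 / 2 else 0)) * b"
    if "l \<ge> 0"
  proof -
    have "rate (2, -1) (l + 1) = 0" using that by (simp add: rate_def)
    hence "K (0,-1) (l+1) + K (1,-1) (l+1) + K (2,-1) (l+1) = w (l + 1) * (rate (0,-1) (l+1) + rate (1,-1) (l+1))"
      by (simp add: K_def algebra_simps)
    thus ?thesis using that w_balance_right[OF that] rate_right(2)[of "l+1"] by simp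
  qed
  have left: "K (0,1) (l-1) + K (1,1) (l-1) + K (2,1) (l-1) = w l * (g2 + (if l = 0 then lam0 / 2 else 0)) * b"
    if "l \<le> 0"
  proof -
    have "rate (2, 1) (l - 1) = 0" using that by (simp add: rate_def)
    hence "K (0,1) (l-1) + K (1,1) (l-1) + K (2,1) (l-1) = w (l - 1) * (rate (0,1) (l-1) + rate (1,1) (l-1))"
      by (simp add: K_def algebra_simps)
    thus ?thesis using that w_balance_left[OF that] rate_left(2)[of "l-1"] by simp
  qed
  have out_right: "K (0,1) (l-1) + K (1,1) (l-1) + K (2,1) (l-1) = w l * (g2 + lam0) * b" if "l > 0"
  proof -
    have "rate (0, 1) (l - 1) = 0" using that by (simp add: rate_def)
    hence "K (0,1) (l-1) + K (1,1) (l-1) + K (2,1) (l-1) = w (l - 1) * (rate (1,1) (l-1) + rate (2,1) (l-1))"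
      by (simp add: K_def algebra_simps)
    thus ?thesis using that w_balance_right[of "l-1"] rate_right(1)[of "l-1"] by simp
  qed
  have out_left: "K (0,-1) (l+1) + K (1,-1) (l+1) + K (2,-1) (l+1) = w l * (g1 + lam0) * b" if "l < 0"
  proof -
    have "rate (0, -1) (l + 1) = 0" using that by (simp add: rate_def)
    hence "K (0,-1) (l+1) + K (1,-1) (l+1) + K (2,-1) (l+1) = w (l + 1) * (rate (1,-1) (l+1) + rate (2,-1) (l+1))"
      by (simp add: K_def algebra_simps)
    thus ?thesis using that w_balance_left[of "l+1"] rate_left(1)[of "l+1"] by simp
  qed
  have "(\<Sum>e\<in>edges. K e (l - snd e)) = (K (0,-1) (l+1) + K (1,-1) (l+1) + K (2,-1) (l+1))
      + (K (0,1) (l-1) + K (1,1) (l-1) + K (2,1) (l-1))"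
    unfolding sum_edges by simp
  also have "\<dots> = tot * w l"
  proof -
    consider "l > 0" | "l = 0" | "l < 0" by linarith
    thus ?thesis
    proof cases
      case 1
      with right out_right show ?thesis by (simp add: tot_eq algebra_simps)
    next
      case 2
      with right left show ?thesis by (simp add: tot_eq algebra_simps)
    next
      case 3
      with left out_left show ?thesis by (simp add: tot_eq algebra_simps)
    qed
  qed
  finally show ?thesis .
qed

lemma rate_nonneg: "rate e l \<ge> 0"
  using pos m_pos rho_pos b_gt_1 by (auto simp: rate_def)

sublocale MA: markov_additive K "\<lambda>l. tot * w l"
proof
  show "K e l \<ge> 0" for e l
    unfolding K_def using rate_nonneg w_pos by (simp add: less_imp_le)
  show "(\<Sum>e\<in>edges. K e l) = tot * w l" for l
    unfolding K_def sum_distrib_left[symmetric] rate_out by simp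
  show "(\<Sum>e\<in>edges. K e (l - snd e)) = tot * w l" for l by (rule rate_in)
  show "integrable (count_space UNIV) (\<lambda>l. tot * w l)" by (intro integrable_mult_right w_integrable)
  show "K (1, 1) l > 0" if "l \<ge> 0" for l
    unfolding K_def using w_pos[of l] pos b_gt_1 m_pos rho_pos that
    by (auto simp: rate_def intro!: mult_pos_pos add_pos_pos)
  show "K (1, -1) l > 0" if "l \<le> 0" for l
    unfolding K_def using w_pos[of l] pos b_gt_1 m_pos rho_pos that
    by (auto simp: rate_def intro!: mult_pos_pos add_pos_pos)
  show "K (2, 1) 0 > 0"
    unfolding K_def using m_pos rho_pos by (simp add: rate_def)
qed

lemma \<kappa>_0: "MA.\<kappa> 0 l = w l * up l * b"
  by (simp add: MA.\<kappa>_def K_def rate_def up_def)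

lemma \<kappa>_2: "MA.\<kappa> 2 l = w l * dn l * \<rho>"
  by (simp add: MA.\<kappa>_def K_def rate_def dn_def algebra_simps)

text \<open>Since \<open>i + j = 2 * m + \<bar>l\<bar>\<close> and \<open>\<bar>l\<bar>\<close> has
  mean drift zero in stationarity, twice the drift of \<open>m\<close> is that of
  \<open>i + j\<close>. After the change of measure the latter is \<open>lam * b - lam\<close> in
  every state.\<close>

lemma drift_pos: "MA.drift > 0"
proof -
  define R where "R l = (if l \<ge> 0 then w l * (rate (1,1) l + rate (2,1) l) else 0)" for l
  define L where "L l = (if l \<le> 0 then w l * (rate (1,-1) l + rate (2,-1) l) else 0)" for l
  have rate_le: "rate e l \<le> tot" if "e \<in> edges" for e l
    unfolding rate_out[of l, symmetric] by (rule member_le_sum[OF that]) (auto simp: rate_nonneg)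
  have bnd: "integrable (count_space UNIV) h" if "\<And>l. 0 \<le> h l" "\<And>l. h l \<le> w l * (tot + tot)" for h :: "int \<Rightarrow> real"
    by (rule Bochner_Integration.integrable_bound[OF integrable_mult_left[OF w_integrable, of "tot + tot"]])
      (use that order.trans[OF that] in \<open>auto intro!: AE_I2 simp: abs_of_nonneg\<close>)
  have two: "0 \<le> w l * (rate e l + rate e' l)" "w l * (rate e l + rate e' l) \<le> w l * (tot + tot)" "0 \<le> w l * (tot + tot)"
    if "e \<in> edges" "e' \<in> edges" for e e' l
    using rate_nonneg[of e l] rate_nonneg[of e' l] less_imp_le[OF w_pos[of l]] tot_pos
      rate_le[OF that(1), of l] rate_le[OF that(2), of l]
    by (auto intro!: mult_left_mono)
  have IR: "integrable (count_space UNIV) R"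
    by (rule bnd) (use two[of "(1,1)" "(2,1)"] in \<open>auto simp: R_def edges_def\<close>)
  have IL: "integrable (count_space UNIV) L"
    by (rule bnd) (use two[of "(1,-1)" "(2,-1)"] in \<open>auto simp: L_def edges_def\<close>)
  have R1: "R (l - 1) = w l * (rate (0,-1) l + rate (1,-1) l)" if "l > 0" for l
    using w_balance_right[of "l - 1"] rate_right(1)[of "l - 1"] rate_right(2)[of l] that by (simp add: R_def)
  have L1: "L (l + 1) = w l * (rate (0,1) l + rate (1,1) l)" if "l < 0" for l
    using w_balance_left[of "l + 1"] rate_left(1)[of "l + 1"] rate_left(2)[of l] that by (simp add: L_def)
  \<comment> \<open>\<open>R\<close> and \<open>L\<close> are the flows away from 0 across the cuts
    to the right and left of \<open>l\<close>. By the cut equations the bracket is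
    \<open>w l\<close> times the drift of \<open>\<bar>l\<bar>\<close>, and it telescopes when
    summed over \<open>l\<close>.\<close>
  have key: "2 * (MA.\<kappa> 0 l - MA.\<kappa> 2 l) = lam * (b - 1) * w l - ((R l - R (l - 1)) + (L l - L (l - (-1))))" for l
  proof -
    have lhs: "2 * (MA.\<kappa> 0 l - MA.\<kappa> 2 l) = w l * (2 * (up l * b - dn l * \<rho>))"
      by (simp add: \<kappa>_0 \<kappa>_2 algebra_simps)
    have "\<exists>x. (R l - R (l - 1)) + (L l - L (l - (-1))) = w l * x
      \<and> 2 * (up l * b - dn l * \<rho>) = (lam * b - (m1 * \<rho> + m2 * \<rho>)) - x"
    proof -
      consider "l > 0" | "l = 0" | "l < 0" by linarith
      thus ?thesis
      proof cases
        case 1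
        hence "(R l - R (l - 1)) + (L l - L (l - (-1))) =
            w l * (rate (1,1) l + rate (2,1) l - rate (0,-1) l - rate (1,-1) l)"
          using R1[OF 1] by (simp add: R_def L_def algebra_simps)
        moreover have "2 * (up l * b - dn l * \<rho>) = (lam * b - (m1 * \<rho> + m2 * \<rho>))
            - (rate (1,1) l + rate (2,1) l - rate (0,-1) l - rate (1,-1) l)"
          using 1 by (simp add: rate_def up_def dn_def algebra_simps)
        ultimately show ?thesis by blast
      next
        case 2
        hence "(R l - R (l - 1)) + (L l - L (l - (-1))) =
            w l * (rate (1,1) 0 + rate (2,1) 0 + (rate (1,-1) 0 + rate (2,-1) 0))"
          by (simp add: R_def L_def)
        moreover have "2 * (up l * b - dn l * \<rho>) = (lam * b - (m1 * \<rho> + m2 * \<rho>))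
            - (rate (1,1) 0 + rate (2,1) 0 + (rate (1,-1) 0 + rate (2,-1) 0))"
          using 2 by (simp add: rate_def up_def dn_def algebra_simps)
        ultimately show ?thesis by blast
      next
        case 3
        hence "(R l - R (l - 1)) + (L l - L (l - (-1))) =
            w l * (rate (1,-1) l + rate (2,-1) l - rate (0,1) l - rate (1,1) l)"
          using L1[OF 3] by (simp add: R_def L_def algebra_simps)
        moreover have "2 * (up l * b - dn l * \<rho>) = (lam * b - (m1 * \<rho> + m2 * \<rho>))
            - (rate (1,-1) l + rate (2,-1) l - rate (0,1) l - rate (1,1) l)"
          using 3 by (simp add: rate_def up_def dn_def algebra_simps)
        ultimately show ?thesis by blast
      qed
    qed
    then obtain x where x: "(R l - R (l - 1)) + (L l - L (l - (-1))) = w l * x"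
      "2 * (up l * b - dn l * \<rho>) = lam * (b - 1) - x"
      unfolding m_rho by (auto simp: right_diff_distrib)
    show ?thesis unfolding lhs x by (simp only: right_diff_distrib mult.commute)
  qed
  have "2 * MA.drift = (\<integral>l. 2 * (MA.\<kappa> 0 l - MA.\<kappa> 2 l) \<partial>count_space UNIV)"
    unfolding MA.drift_def by (rule integral_mult_right_zero[symmetric])
  also have "\<dots> = lam * (b - 1) * (\<integral>l. w l \<partial>count_space UNIV)
      - (((\<integral>l. R l \<partial>count_space UNIV) - (\<integral>l. R (l - 1) \<partial>count_space UNIV))
         + ((\<integral>l. L l \<partial>count_space UNIV) - (\<integral>l. L (l - (-1)) \<partial>count_space UNIV)))"
  proof -
    note IR' = integral_int_shift(2)[of R 1, THEN iffD2, OF IR]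
    note IL' = integral_int_shift(2)[of L "- 1", THEN iffD2, OF IL]
    note i = Bochner_Integration.integrable_diff[OF IR IR'] Bochner_Integration.integrable_diff[OF IL IL']
    show ?thesis unfolding key
      by (simp only: Bochner_Integration.integral_diff[OF integrable_mult_right[OF w_integrable] Bochner_Integration.integrable_add[OF i]]
          Bochner_Integration.integral_add[OF i] Bochner_Integration.integral_diff[OF IR IR']
          Bochner_Integration.integral_diff[OF IL IL'] integral_mult_right_zero)
  qed
  also have "\<dots> = lam * (b - 1) * (\<integral>l. w l \<partial>count_space UNIV)"
    unfolding integral_int_shift(1) by simp
  also have "\<dots> > 0"
  proof -
    have "w 0 \<le> (\<integral>l. w l \<partial>count_space UNIV)"
      by (rule count_space_member_le_integral[OF w_integrable]) (simp add: w_pos less_imp_le)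
    moreover have "lam * (b - 1) > 0" using pos b_gt_1 by simp
    ultimately show ?thesis by simp
  qed
  finally show ?thesis by simp
qed

section \<open>The invariant measure scaled by its decay rate\<close>

definition V :: "nat \<Rightarrow> int \<Rightarrow> real" where "V m l = Q m l * b ^ (2 * m + nat \<bar>l\<bar>)"

text \<open>This is \<open>q_balance\<close> at a point of level \<open>m + 1\<close>, where both
  orbits are nonempty and the rates are homogeneous, multiplied by \<open>b ^ (i + j)\<close>.
  Arrivals thus acquire a factor \<open>b\<close>, retrials a factor \<rho>.\<close>

lemma V_balance:
  "(\<Sum>e\<in>edges. rate e (l - snd e) * V (m + fst e) (l - snd e)) = tot * V (Suc m) l"
proof -
  define Z where "Z i j = q i j * b ^ (i + j)" for i j
  have VZ: "V m l = Z (m + nat (- l)) (m + nat l)" for m l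
  proof -
    have e: "m + nat (- l) + (m + nat l) = 2 * m + nat \<bar>l\<bar>" by simp
    show ?thesis unfolding V_def Q_def pt_def Z_def prod.case e ..
  qed
  have bal: "tot * Z (Suc i) (Suc j) = m1 * \<rho> * Z (Suc (Suc i)) (Suc j) + m2 * \<rho> * Z (Suc i) (Suc (Suc j))
      + arr1 i (Suc j) * b * Z i (Suc j) + arr2 (Suc i) j * b * Z (Suc i) j" for i j
  proof -
    have "q (Suc i) (Suc j) * (lam + (m1 + m2)) = m1 * q (Suc (Suc i)) (Suc j) + m2 * q (Suc i) (Suc (Suc j))
       + arr1 i (Suc j) * q i (Suc j) + arr2 (Suc i) j * q (Suc i) j"
      using q_balance[of "Suc i" "Suc j"] by (simp add: srv_interior add.assoc)
    hence "q (Suc i) (Suc j) * tot = m1 * q (Suc (Suc i)) (Suc j) + m2 * q (Suc i) (Suc (Suc j))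
       + arr1 i (Suc j) * q i (Suc j) + arr2 (Suc i) j * q (Suc i) j"
      unfolding m_sum tot_def by (simp add: add.commute)
    moreover define B where "B = b ^ (Suc i + Suc j)"
    ultimately have "q (Suc i) (Suc j) * tot * B = (m1 * q (Suc (Suc i)) (Suc j) + m2 * q (Suc i) (Suc (Suc j))
       + arr1 i (Suc j) * q i (Suc j) + arr2 (Suc i) j * q (Suc i) j) * B" by simp
    moreover have "m1 * \<rho> * Z (Suc (Suc i)) (Suc j) = m1 * q (Suc (Suc i)) (Suc j) * B * (b * \<rho>)"
      "m2 * \<rho> * Z (Suc i) (Suc (Suc j)) = m2 * q (Suc i) (Suc (Suc j)) * B * (b * \<rho>)"
      "arr1 i (Suc j) * b * Z i (Suc j) = arr1 i (Suc j) * q i (Suc j) * B"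
      "arr2 (Suc i) j * b * Z (Suc i) j = arr2 (Suc i) j * q (Suc i) j * B"
      "tot * Z (Suc i) (Suc j) = q (Suc i) (Suc j) * tot * B"
      by (simp_all add: Z_def B_def mult_ac)
    ultimately show ?thesis by (simp only: b_rho distrib_right mult_1_right)
  qed
  consider n where "l = int (Suc n)" | "l = 0" | n where "l = - int (Suc n)"
    by (cases l rule: int_cases3) (metis Suc_pred)+
  thus ?thesis
  proof cases
    case 1
    show ?thesis unfolding sum_edges VZ using bal[of m "m + Suc n"] 1
      by (simp add: rate_def arr1_def arr2_def jsq_h_def nat_add_distrib algebra_simps)
  next
    case 2
    show ?thesis unfolding sum_edges VZ using bal[of m m] 2
      by (simp add: rate_def arr1_def arr2_def jsq_h_def algebra_simps)
  next
    case 3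
    have e: "l - - 1 = - int n" "l - 1 = - int (Suc (Suc n))" using 3 by simp_all
    show ?thesis unfolding sum_edges fst_conv snd_conv e VZ unfolding 3 using bal[of "m + Suc n" m]
      by (simp add: rate_def arr1_def arr2_def jsq_h_def nat_add_distrib algebra_simps)
  qed
qed

theorem Q_limit: "\<exists>c>0. \<forall>l. (\<lambda>m. V m l) \<longlonglongrightarrow> c * w l"
proof -
  define u where "u m l = V m l / w l" for m l
  have wu: "w l * u m l = V m l" for m l using w_pos[of l] by (simp add: u_def)
  have Q0: "Q m l > 0" for m l using q_pos by (simp add: Q_def split_def)
  have V0: "V m l \<ge> 0" for m l using Q0[of m l] b_gt_1 by (simp add: V_def)
  have harm: "MA.harmonic u"
    unfolding MA.harmonic_def
  proof (intro allI conjI)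
    fix m l
    show "u m l \<ge> 0" using V0[of m l] w_pos[of l] by (simp add: u_def)
    show "(\<Sum>e\<in>edges. K e (l - snd e) * u (m + fst e) (l - snd e)) = tot * w l * u (Suc m) l"
    proof -
      have "K e l' * u m' l' = rate e l' * V m' l'" for e m' l'
        unfolding K_def wu[symmetric] by (simp add: mult_ac)
      moreover have "tot * w l * u (Suc m) l = tot * V (Suc m) l" unfolding mult.assoc wu ..
      ultimately show ?thesis by (simp only: V_balance)
    qed
  qed
  obtain B where B: "\<And>i j. i > 0 \<Longrightarrow> j > 0 \<Longrightarrow> q i j * b ^ (i + j) \<le> B"
    using interior_bound by blast
  \<comment> \<open>\<open>interior_bound\<close> excludes the axes, so the origin
    \<open>m = 0\<close> is covered by its own value.\<close>
  have bound: "u m 0 \<le> max B (q 0 0)" for m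
  proof (cases "m = 0")
    case False
    have "u m 0 = q m m * b ^ (m + m)" by (simp add: u_def V_def Q_def pt_def mult_2)
    thus ?thesis using B[of m m] False by simp
  qed (simp add: u_def V_def Q_def pt_def)
  \<comment> \<open>The two parts of the flux of \<open>u\<close> through the lowest cut are the
    functions of \<open>boundary_flux\<close>; the weight \<open>w\<close> cancels.\<close>
  have e0: "MA.\<kappa> 0 l * u 0 l = up l * b ^ Suc (nat \<bar>l\<bar>) * Q 0 l" for l
    using wu[of l 0] by (simp add: \<kappa>_0 V_def mult_ac)
  have e1: "MA.\<kappa> 2 l * u (Suc 0) l = dn l * b ^ Suc (nat \<bar>l\<bar>) * Q 1 l" for l
  proof -
    have "MA.\<kappa> 2 l * u (Suc 0) l = dn l * \<rho> * V 1 l" using wu[of l 1] by (simp add: \<kappa>_2 mult_ac)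
    also have "\<dots> = dn l * (b * \<rho>) * b ^ Suc (nat \<bar>l\<bar>) * Q 1 l" by (simp add: V_def algebra_simps)
    finally show ?thesis by (simp add: b_rho)
  qed
  have "\<exists>c>0. \<forall>l. (\<lambda>m. u m l) \<longlonglongrightarrow> c"
    by (rule MA.harmonic_limit[OF harm drift_pos bound])
      (use boundary_flux in \<open>simp_all only: MA.flux_def e0 e1\<close>)
  then obtain c where c: "c > 0" "\<And>l. (\<lambda>m. u m l) \<longlonglongrightarrow> c" by blast
  have "(\<lambda>m. V m l) \<longlonglongrightarrow> c * w l" for l
  proof -
    have "(\<lambda>m. u m l * w l) \<longlonglongrightarrow> c * w l" by (intro tendsto_intros c)
    thus ?thesis using w_pos[of l] by (simp add: u_def)
  qed
  with c show ?thesis by blast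
qed

end

section \<open>The decay rate theorem\<close>

lemma tendsto_geometric_at_top_iff:
  fixes f :: "int \<Rightarrow> real"
  assumes "A > 0" "t \<ge> 0" and f: "\<And>l. l \<ge> 1 \<Longrightarrow> f l = A * t ^ nat l"
  shows "(f \<longlongrightarrow> 0) at_top \<longleftrightarrow> t < 1"
proof
  assume "(f \<longlongrightarrow> 0) at_top"
  hence "(\<lambda>n. f (int n)) \<longlonglongrightarrow> 0"
    using filterlim_int_sequentially by (rule filterlim_compose)
  hence "eventually (\<lambda>n. f (int n) < A) sequentially"
    using \<open>A > 0\<close> by (rule order_tendstoD)
  hence "eventually (\<lambda>n. f (int n) < A \<and> n \<ge> 1) sequentially"
    using eventually_ge_at_top by (rule eventually_conj)
  then obtain n where n: "f (int n) < A" "n \<ge> 1"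
    unfolding eventually_sequentially by blast
  show "t < 1"
  proof (rule ccontr)
    assume "\<not> t < 1"
    hence "A * 1 \<le> A * t ^ n" using \<open>A > 0\<close> by (intro mult_left_mono one_le_power) auto
    thus False using n f[of "int n"] by simp
  qed
next
  assume "t < 1"
  hence "(\<lambda>n. A * t ^ n) \<longlonglongrightarrow> A * 0"
    using assms by (intro tendsto_intros LIMSEQ_power_zero) auto
  hence "((\<lambda>l. A * t ^ nat l) \<longlongrightarrow> 0) at_top"
    using filterlim_nat_sequentially by (auto intro: filterlim_compose)
  moreover have "eventually (\<lambda>l. A * t ^ nat l = f l) at_top"
    using eventually_ge_at_top[of 1] by eventually_elim (simp add: f)
  ultimately show "(f \<longlongrightarrow> 0) at_top" using tendsto_cong by fast
qed

text \<open>The factor \<open>\<rho> ^ nat \<bar>l\<bar>\<close> of the vector cancels half of the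
  weight in the definition, leaving geometric sequences with ratios
  \<open>\<gamma>1 / (\<gamma>2 + lamh0) / \<rho>\<close> and
  \<open>\<gamma>2 / (\<gamma>1 + lamh0) / \<rho>\<close>; each vanishes in the limit iff its ratio
  is below 1.\<close>

lemma strongly_balanced_limit_vector_iff:
  assumes "lamh0 > 0" "\<gamma>1 > 0" "\<gamma>2 > 0" "\<rho> > 0" "x0 > 0"
  shows "strongly_balanced \<rho> (limit_vector lamh0 \<gamma>1 \<gamma>2 \<rho> x0) \<longleftrightarrow>
    \<gamma>2 < \<rho> * (\<gamma>1 + lamh0) \<and> \<gamma>1 < \<rho> * (\<gamma>2 + lamh0)"
proof -
  let ?x = "limit_vector lamh0 \<gamma>1 \<gamma>2 \<rho> x0"
  have pw: "\<rho> powi (- 2 * l) = (1 / \<rho>\<^sup>2) ^ nat l" if "l \<ge> 1" for l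
    using that \<open>\<rho> > 0\<close>
    by (simp add: power_int_minus power_int_def nat_mult_distrib power_mult power_one_over inverse_eq_divide)
  have eq: "(1 / \<rho>\<^sup>2) ^ n * (c * (\<rho> * y) ^ n) = c * (y / \<rho>) ^ n" for c y :: real and n
  proof -
    have "(1 / \<rho>\<^sup>2) ^ n * (\<rho> * y) ^ n = (y / \<rho>) ^ n"
      unfolding power_mult_distrib[symmetric] using \<open>\<rho> > 0\<close> by (simp add: power2_eq_square)
    thus ?thesis by simp
  qed
  have "((\<lambda>l. \<rho> powi (- 2 * l) * ?x l) \<longlongrightarrow> 0) at_top \<longleftrightarrow> \<gamma>1 / (\<gamma>2 + lamh0) / \<rho> < 1"
  proof (rule tendsto_geometric_at_top_iff)
    show "(\<gamma>1 + lamh0 / 2) / \<gamma>1 * x0 > 0" using assms by simp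
    show "\<rho> powi (- 2 * l) * ?x l = (\<gamma>1 + lamh0 / 2) / \<gamma>1 * x0 * (\<gamma>1 / (\<gamma>2 + lamh0) / \<rho>) ^ nat l"
      if "l \<ge> 1" for l
      using that unfolding pw[OF that] eq[symmetric] by (simp add: limit_vector_def)
  qed (use assms in simp)
  moreover have "((\<lambda>l. \<rho> powi (2 * l) * ?x l) \<longlongrightarrow> 0) at_bot \<longleftrightarrow> \<gamma>2 / (\<gamma>1 + lamh0) / \<rho> < 1"
    unfolding at_bot_mirror filterlim_filtermap
  proof (rule tendsto_geometric_at_top_iff)
    show "(\<gamma>2 + lamh0 / 2) / \<gamma>2 * x0 > 0" using assms by simp
    show "\<rho> powi (2 * - l) * ?x (- l) = (\<gamma>2 + lamh0 / 2) / \<gamma>2 * x0 * (\<gamma>2 / (\<gamma>1 + lamh0) / \<rho>) ^ nat l"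
      if "l \<ge> 1" for l
      using that pw[OF that] unfolding eq[symmetric] by (simp add: limit_vector_def)
  qed (use assms in simp)
  moreover have "y / (z + lamh0) / \<rho> < 1 \<longleftrightarrow> y < \<rho> * (z + lamh0)" if "z > 0" for y z
  proof -
    have "z + lamh0 > 0" using assms that by simp
    thus ?thesis using \<open>\<rho> > 0\<close> by (simp add: divide_less_eq mult.commute)
  qed
  ultimately show ?thesis using assms unfolding strongly_balanced_def by auto
qed

theorem theorem4p1:
  fixes lam lam0 lam1 lam2 \<mu> \<alpha>1 \<alpha>2 :: real
    and lamh lamh0 lamh1 lamh2 \<mu>h1 \<mu>h2 \<rho> \<rho>1 \<rho>2 \<gamma>1 \<gamma>2 :: real
    and M :: "'a measure"
    and N1 N2 :: "nat \<Rightarrow> 'a \<Rightarrow> nat" and C :: "nat \<Rightarrow> 'a \<Rightarrow> bool"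
  assumes pos: "lam0 > 0" "lam1 > 0" "lam2 > 0" "\<mu> > 0" "\<alpha>1 > 0" "\<alpha>2 > 0"
    and lam: "lam = lam0 + lam1 + lam2"
    and normalized: "lam + \<mu> + \<alpha>1 + \<alpha>2 = 1"
    and lamh: "lamh = lam * (lam + \<alpha>1 + \<alpha>2)"
    and lamh0: "lamh0 = lam0 * (lam + \<alpha>1 + \<alpha>2)"
    and lamh1: "lamh1 = lam1 * (lam + \<alpha>1 + \<alpha>2)"
    and lamh2: "lamh2 = lam2 * (lam + \<alpha>1 + \<alpha>2)"
    and muh1: "\<mu>h1 = \<mu> * \<alpha>1"
    and muh2: "\<mu>h2 = \<mu> * \<alpha>2"
    and rho1: "\<rho>1 = lamh1 / \<mu>h1"
    and rho2: "\<rho>2 = lamh2 / \<mu>h2"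
    and rho: "\<rho> = lamh / (\<mu>h1 + \<mu>h2)"
    and gamma1: "\<gamma>1 = \<mu>h1 * \<rho>\<^sup>2 + lamh2"
    and gamma2: "\<gamma>2 = \<mu>h2 * \<rho>\<^sup>2 + lamh1"
    and chain: "markov_chain M (jsoq_trans lam0 lam1 lam2 \<mu> \<alpha>1 \<alpha>2)
                  (\<lambda>n \<omega>. (N1 n \<omega>, N2 n \<omega>, C n \<omega>))"
    and recurrent: "positive_recurrent (jsoq_trans lam0 lam1 lam2 \<mu> \<alpha>1 \<alpha>2)"
    and rho_bounds: "max \<rho>1 \<rho>2 < \<rho>" "\<rho> < 1"
    and lamh0_bound: "lamh0 > \<bar>lamh2 - lamh1 + \<rho>\<^sup>2 * (\<mu>h1 - \<mu>h2)\<bar>"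
  shows "\<exists>x0 > 0.
    (\<forall>l. (\<lambda>m. \<rho> powi (- 2 * int m) * busy_limit_prob M N1 N2 C m l)
            \<longlonglongrightarrow> limit_vector lamh0 \<gamma>1 \<gamma>2 \<rho> x0 l) \<and>
    (strongly_balanced \<rho> (limit_vector lamh0 \<gamma>1 \<gamma>2 \<rho> x0) \<longleftrightarrow>
       \<gamma>2 < \<rho> * (\<gamma>1 + lamh0) \<and> \<gamma>1 < \<rho> * (\<gamma>2 + lamh0))"
proof -
  define dd where "dd = lam + \<alpha>1 + \<alpha>2"
  have dd: "dd > 0" using pos by (simp add: dd_def lam)
  have lamp: "lam > 0" using pos by (simp add: lam)
  have hats: "lamh = dd * lam" "lamh0 = dd * lam0" "lamh1 = dd * lam1" "lamh2 = dd * lam2"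
    by (simp_all add: lamh lamh0 lamh1 lamh2 dd_def)
  interpret rec: jsoq_recurrent lam0 lam1 lam2 \<mu> \<alpha>1 \<alpha>2
    by unfold_locales (use pos normalized lam recurrent in auto)
  define g1 where "g1 = \<mu> * \<alpha>1 / dd * \<rho>\<^sup>2 + lam2"
  define g2 where "g2 = \<mu> * \<alpha>2 / dd * \<rho>\<^sup>2 + lam1"
  have \<gamma>: "\<gamma>1 = dd * g1" "\<gamma>2 = dd * g2"
    using dd by (simp_all add: gamma1 gamma2 g1_def g2_def hats muh1 muh2 distrib_left)
  have mu: "\<mu>h1 > 0" "\<mu>h2 > 0" using pos by (simp_all add: muh1 muh2)
  \<comment> \<open>The hypothesis on \<open>lamh0\<close> is a bound on this difference, so it
    splits into the two inequalities of \<open>pooled\<close> once the common factor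
    \<open>dd\<close> is removed.\<close>
  have "lamh2 - lamh1 + \<rho>\<^sup>2 * (\<mu>h1 - \<mu>h2) = \<gamma>1 - \<gamma>2"
    by (simp add: gamma1 gamma2 algebra_simps)
  hence "\<bar>\<gamma>1 - \<gamma>2\<bar> < lamh0" using lamh0_bound by simp
  hence "\<gamma>1 < \<gamma>2 + lamh0" "\<gamma>2 < \<gamma>1 + lamh0" by linarith+
  hence "dd * g1 < dd * (g2 + lam0)" "dd * g2 < dd * (g1 + lam0)"
    by (simp_all add: \<gamma> hats distrib_left)
  hence pooled: "g1 < g2 + lam0" "g2 < g1 + lam0" using dd by simp_all
  have r: "\<rho> * (\<mu> * (\<alpha>1 + \<alpha>2)) = lam * dd"
  proof -
    have "\<mu> * (\<alpha>1 + \<alpha>2) = \<mu>h1 + \<mu>h2" by (simp add: muh1 muh2 distrib_left)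
    thus ?thesis using mu by (simp add: rho hats mult.commute)
  qed
  have r1: "lam1 * dd < \<rho> * (\<mu> * \<alpha>1)" "lam2 * dd < \<rho> * (\<mu> * \<alpha>2)"
    using rho_bounds(1) mu by (simp_all add: rho1 rho2 hats muh1 muh2 divide_less_eq mult.commute)
  interpret walk: jsoq_stable lam0 lam1 lam2 \<mu> \<alpha>1 \<alpha>2 "\<lambda>i j. rec.stat (i, j, True)" \<rho>
    by unfold_locales (use r r1 rho_bounds(2) in \<open>simp_all add: dd_def lam\<close>)
  have D: "walk.D = dd" by (simp add: walk.D_def dd_def lam)
  interpret pooled: jsoq_pooled lam0 lam1 lam2 \<mu> \<alpha>1 \<alpha>2 "\<lambda>i j. rec.stat (i, j, True)" \<rho> g1 g2
    by unfold_locales (use pooled in \<open>simp_all add: walk.m1_def walk.m2_def D g1_def g2_def\<close>)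
  obtain x0 where x0: "x0 > 0" "\<And>l. (\<lambda>m. pooled.V m l) \<longlonglongrightarrow> x0 * pooled.w l"
    using pooled.Q_limit by blast
  have rho0: "\<rho> > 0" by (rule walk.rho_pos)
  \<comment> \<open>Minimum and difference determine the pair of orbit lengths, so the event is a
    visit to a single state and \<open>law_limit\<close> applies.\<close>
  have busy: "busy_limit_prob M N1 N2 C m l = walk.Q m l" for m l
  proof -
    have "{\<omega> \<in> space M. min (N1 n \<omega>) (N2 n \<omega>) = m \<and> int (N2 n \<omega>) - int (N1 n \<omega>) = l \<and> C n \<omega>}
       = {\<omega> \<in> space M. (N1 n \<omega>, N2 n \<omega>, C n \<omega>) = (m + nat (- l), m + nat l, True)}" for n
      by (auto simp: min_def split: if_splits)
    hence "(\<lambda>n. measure M {\<omega> \<in> space M. min (N1 n \<omega>) (N2 n \<omega>) = m \<and> int (N2 n \<omega>) - int (N1 n \<omega>) = l \<and> C n \<omega>})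
        \<longlonglongrightarrow> rec.stat (m + nat (- l), m + nat l, True)"
      using rec.law_limit[OF chain, of "(m + nat (- l), m + nat l, True)"]
      by (simp only: rec.law_def[OF chain])
    thus ?thesis unfolding busy_limit_prob_def by (simp add: limI walk.Q_def walk.pt_def)
  qed
  have lim: "(\<lambda>m. \<rho> powi (- 2 * int m) * busy_limit_prob M N1 N2 C m l)
      \<longlonglongrightarrow> limit_vector lamh0 \<gamma>1 \<gamma>2 \<rho> x0 l" for l
  proof -
    \<comment> \<open>\<open>V\<close> also carries the power of \<open>b\<close> belonging to
      \<open>\<bar>l\<bar>\<close>; multiplying by \<open>\<rho> ^ nat \<bar>l\<bar>\<close> removes
      it on the left and restores the factor of the limit vector on the right.\<close>
    have "(\<lambda>m. pooled.V m l * \<rho> ^ nat \<bar>l\<bar>) \<longlonglongrightarrow> x0 * pooled.w l * \<rho> ^ nat \<bar>l\<bar>"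
      by (intro tendsto_intros x0)
    moreover have "pooled.V m l * \<rho> ^ nat \<bar>l\<bar> = \<rho> powi (- 2 * int m) * busy_limit_prob M N1 N2 C m l" for m
    proof -
      have "\<rho> powi (- 2 * int m) = walk.b ^ (2 * m)"
        using rho0 by (simp add: power_int_minus power_int_def nat_mult_distrib walk.b_def power_one_over inverse_eq_divide)
      moreover have "walk.b ^ nat \<bar>l\<bar> * \<rho> ^ nat \<bar>l\<bar> = 1"
        using rho0 by (simp add: walk.b_def flip: power_mult_distrib)
      ultimately show ?thesis by (simp add: pooled.V_def busy power_add mult.assoc)
    qed
    moreover have "x0 * pooled.w l * \<rho> ^ nat \<bar>l\<bar> = limit_vector lamh0 \<gamma>1 \<gamma>2 \<rho> x0 l"
    proof -
      have c: "(dd * y + dd * lam0 / 2) / (dd * y) = (y + lam0 / 2) / y"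
        "dd * y / (dd * z + dd * lam0) = y / (z + lam0)" for y z
        using dd by (simp_all add: divide_simps flip: distrib_left) (simp_all add: algebra_simps)
      show ?thesis
        by (simp add: limit_vector_def pooled.w_def \<gamma> hats c mult.commute[of \<rho>] flip: power_mult_distrib)
    qed
    ultimately show ?thesis by simp
  qed
  have "lamh0 > 0" "\<gamma>1 > 0" "\<gamma>2 > 0"
    using dd pos pooled.g_pos by (simp_all add: hats \<gamma>)
  from strongly_balanced_limit_vector_iff[OF this rho0 x0(1)] lim x0(1) show ?thesis by blast
qed

end
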